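(* Let $P$ be a quasi CW-poset and $K$ a field. The category $\mathrm{Sq}_PR$ of squarefree $P$-modules over $K$ is equivalent to the opposite of the category $\mathrm{Sh}\,P$ of sheaves of finite $K$-vector spaces on $P$: $$\mathrm{Sq}_PR\cong(\mathrm{Sh}\,P)^{\mathsf{op}} .$$
   Context: All posets are finite and have a minimal element $\hat 0$; $\widehat P=P\setminus\{\hat 0\}$, $\partial\sigma=\{\tau\in P:\tau<\sigma\}$; $\Delta_P$ is the simplicial complex of all chains of $\widehat P$ (including $\emptyset$). $P$ is a quasi CW-poset if for every $\sigma\in\widehat P$ the order complex $\Delta_{\partial\sigma}$ is Gorenstein* over $K$, i.e. for every face $F$ of $\Delta=\Delta_{\partial\sigma}$ (including $\emptyset$), $\tilde H_i(\mathrm{lk}_\Delta F;K)$ is $K$ for $i=\dim\Delta-|F|$ and $0$ otherwise. Let $R=K[x_\sigma:\sigma\in\widehat P]$ with the $\mathbb Z^{|\widehat P|}$-grading $\deg x_\sigma=\mathbf e_\sigma$ (unit vectors). For $\mathbf u=\sum u_\sigma\mathbf e_\sigma\in\mathbb N^{|\widehat P|}$ let $\operatorname{supp}(\mathbf u)=\{\sigma:u_\sigma\ne0\}$. A squarefree $P$-module over $K$ is a finitely generated $\mathbb N^{|\widehat P|}$-graded $R$-module $M$ such that (a) $M_{\mathbf u}=0$ whenever $\operatorname{supp}(\mathbf u)\notin\Delta_P$; (b) for $\mathbf u$ with $\operatorname{supp}(\mathbf u)\in\Delta_P$ nonempty and $\tau\in\widehat P$, the multiplication $\times x_\tau:M_{\mathbf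 u}\to M_{\mathbf u+\mathbf e_\tau}$ is bijective if $\operatorname{supp}(\mathbf u+\mathbf e_\tau)\in\Delta_P$ and $\tau\le\max(\operatorname{supp}(\mathbf u))$. $\mathrm{Sq}_PR$ is the full subcategory of the category of $\mathbb Z^{|\widehat P|}$-graded $R$-modules and degree-preserving $R$-homomorphisms whose objects are the squarefree $P$-modules. A sheaf $\mathcal F$ (of finite $K$-vector spaces) on $P$ consists of a finite-dimensional $K$-vector space $\mathcal F_\sigma$ for each $\sigma\in P$ and linear maps $\mathrm{res}^\sigma_\tau:\mathcal F_\sigma\to\mathcal F_\tau$ for all $\sigma>\tau$ in $P$ with $\mathrm{res}^\tau_\rho\circ\mathrm{res}^\sigma_\tau=\mathrm{res}^\sigma_\rho$ for all $\sigma>\tau>\rho$. A morphism of sheaves $\mathcal F\to\mathcal G$ is a family of linear maps $\mathcal F_\sigma\to\mathcal G_\sigma$ ($\sigma\in P$) commuting with the restriction maps. *)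

theory Defs
  imports "HOL-Algebra.Algebraic_Closure_Type" "HOL-Library.Poly_Mapping" "HOL-Library.FuncSet"
begin

text \<open>
  The finite posets with least element are the types \<open>'p :: {finite, order_bot}\<close>; the minimal
  element is \<open>bot\<close>.  The coefficient field is a type \<open>'k :: field\<close>, viewed as an algebraic
  structure through \<open>ring_of_type_algebra\<close>.
\<close>

section \<open>Categories and equivalences\<close>

text \<open>
  Hom-sets need not be disjoint, so identities and composition carry the objects involved:
  \<open>Comp C A B E g f\<close> is the composite of \<open>f : A \<rightarrow> B\<close> and \<open>g : B \<rightarrow> E\<close>.
\<close>

record ('o, 'a) cat =
  Ob :: "'o set"
  Hom :: "'o \<Rightarrow> 'o \<Rightarrow> 'a set"
  Id :: "'o \<Rightarrow> 'a"
  Comp :: "'o \<Rightarrow> 'o \<Rightarrow> 'o \<Rightarrow> 'a \<Rightarrow> 'a \<Rightarrow> 'a"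

definition category :: "('o, 'a) cat \<Rightarrow> bool" where
  "category C \<longleftrightarrow>
    (\<forall>A\<in>Ob C. Id C A \<in> Hom C A A) \<and>
    (\<forall>A\<in>Ob C. \<forall>B\<in>Ob C. \<forall>E\<in>Ob C. \<forall>f\<in>Hom C A B. \<forall>g\<in>Hom C B E.
        Comp C A B E g f \<in> Hom C A E) \<and>
    (\<forall>A\<in>Ob C. \<forall>B\<in>Ob C. \<forall>f\<in>Hom C A B.
        Comp C A A B f (Id C A) = f \<and> Comp C A B B (Id C B) f = f) \<and>
    (\<forall>V\<in>Ob C. \<forall>A\<in>Ob C. \<forall>B\<in>Ob C. \<forall>E\<in>Ob C.
      \<forall>f\<in>Hom C V A. \<forall>g\<in>Hom C A B. \<forall>h\<in>Hom C B E.
        Comp C V B E h (Comp C V A B g f) = Comp C V A E (Comp C A B E h g) f)"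

definition opposite :: "('o, 'a) cat \<Rightarrow> ('o, 'a) cat" where
  "opposite C = \<lparr>Ob = Ob C, Hom = (\<lambda>A B. Hom C B A), Id = Id C,
                 Comp = (\<lambda>A B E g f. Comp C E B A f g)\<rparr>"

text \<open>A functor is given by its action \<open>Fo\<close> on objects and \<open>Fa A B\<close> on \<open>Hom C A B\<close>.\<close>

definition is_functor ::
  "('o, 'a) cat \<Rightarrow> ('o2, 'a2) cat \<Rightarrow> ('o \<Rightarrow> 'o2) \<Rightarrow> ('o \<Rightarrow> 'o \<Rightarrow> 'a \<Rightarrow> 'a2) \<Rightarrow> bool" where
  "is_functor C D Fo Fa \<longleftrightarrow>
    (\<forall>A\<in>Ob C. Fo A \<in> Ob D) \<and>
    (\<forall>A\<in>Ob C. \<forall>B\<in>Ob C. \<forall>f\<in>Hom C A B. Fa A B f \<in> Hom D (Fo A) (Fo B)) \<and>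
    (\<forall>A\<in>Ob C. Fa A A (Id C A) = Id D (Fo A)) \<and>
    (\<forall>A\<in>Ob C. \<forall>B\<in>Ob C. \<forall>E\<in>Ob C. \<forall>f\<in>Hom C A B. \<forall>g\<in>Hom C B E.
        Fa A E (Comp C A B E g f) = Comp D (Fo A) (Fo B) (Fo E) (Fa B E g) (Fa A B f))"

definition is_iso :: "('o, 'a) cat \<Rightarrow> 'o \<Rightarrow> 'o \<Rightarrow> 'a \<Rightarrow> bool" where
  "is_iso C A B f \<longleftrightarrow> f \<in> Hom C A B \<and>
    (\<exists>g\<in>Hom C B A. Comp C A B A g f = Id C A \<and> Comp C B A B f g = Id C B)"

definition natural_iso ::
  "('o, 'a) cat \<Rightarrow> ('o2, 'a2) cat \<Rightarrow> ('o \<Rightarrow> 'o2) \<Rightarrow> ('o \<Rightarrow> 'o \<Rightarrow> 'a \<Rightarrow> 'a2) \<Rightarrow>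
    ('o \<Rightarrow> 'o2) \<Rightarrow> ('o \<Rightarrow> 'o \<Rightarrow> 'a \<Rightarrow> 'a2) \<Rightarrow> ('o \<Rightarrow> 'a2) \<Rightarrow> bool" where
  "natural_iso C D Fo Fa Go Ga \<eta> \<longleftrightarrow>
    (\<forall>A\<in>Ob C. is_iso D (Fo A) (Go A) (\<eta> A)) \<and>
    (\<forall>A\<in>Ob C. \<forall>B\<in>Ob C. \<forall>f\<in>Hom C A B.
        Comp D (Fo A) (Fo B) (Go B) (\<eta> B) (Fa A B f)
      = Comp D (Fo A) (Go A) (Go B) (Ga A B f) (\<eta> A))"

definition equivalent_categories :: "('o, 'a) cat \<Rightarrow> ('o2, 'a2) cat \<Rightarrow> bool" where
  "equivalent_categories C D \<longleftrightarrow> category C \<and> category D \<and>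
    (\<exists>Fo Fa Go Ga \<eta> \<epsilon>.
      is_functor C D Fo Fa \<and> is_functor D C Go Ga \<and>
      natural_iso C C (\<lambda>A. A) (\<lambda>A B f. f)
        (\<lambda>A. Go (Fo A)) (\<lambda>A B f. Ga (Fo A) (Fo B) (Fa A B f)) \<eta> \<and>
      natural_iso D D (\<lambda>A. Fo (Go A)) (\<lambda>A B f. Fa (Go A) (Go B) (Ga A B f))
        (\<lambda>A. A) (\<lambda>A B f. f) \<epsilon>)"

section \<open>Modules\<close>

text \<open>
  Homomorphisms are made extensional (\<open>undefined\<close> off the carrier), so that equality of functions
  is equality of homomorphisms.
\<close>

definition mod_hom ::
  "('r, 'x) ring_scheme \<Rightarrow> ('r, 'a, 'y) module_scheme \<Rightarrow> ('r, 'b, 'z) module_scheme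
    \<Rightarrow> ('a \<Rightarrow> 'b) set" where
  "mod_hom R M N = {f \<in> carrier M \<rightarrow>\<^sub>E carrier N.
     (\<forall>x\<in>carrier M. \<forall>y\<in>carrier M. f (x \<oplus>\<^bsub>M\<^esub> y) = f x \<oplus>\<^bsub>N\<^esub> f y) \<and>
     (\<forall>r\<in>carrier R. \<forall>x\<in>carrier M. f (r \<odot>\<^bsub>M\<^esub> x) = r \<odot>\<^bsub>N\<^esub> f x)}"

definition isomorphic_modules ::
  "('r, 'x) ring_scheme \<Rightarrow> ('r, 'a, 'y) module_scheme \<Rightarrow> ('r, 'b, 'z) module_scheme \<Rightarrow> bool" where
  "isomorphic_modules R M N \<longleftrightarrow> (\<exists>f\<in>mod_hom R M N. bij_betw f (carrier M) (carrier N))"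

definition finitely_generated ::
  "('r, 'x) ring_scheme \<Rightarrow> ('r, 'a, 'y) module_scheme \<Rightarrow> bool" where
  "finitely_generated R M \<longleftrightarrow>
    (\<exists>S. finite S \<and> S \<subseteq> carrier M \<and>
      (\<forall>x\<in>carrier M. \<exists>c\<in>S \<rightarrow> carrier R. x = (\<Oplus>\<^bsub>M\<^esub>s\<in>S. c s \<odot>\<^bsub>M\<^esub> s)))"

text \<open>
  The quotient by a submodule \<open>N\<close>.  The library's record of modules also has multiplicative
  components; they play no role for modules.
\<close>

definition quotient_module :: "('r, 'a, 'y) module_scheme \<Rightarrow> 'a set \<Rightarrow> ('r, 'a set) module" where
  "quotient_module M N =
    \<lparr>carrier = a_rcosets\<^bsub>M\<^esub> N, monoid.mult = undefined, one = undefined,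
     zero = N, add = (\<lambda>A B. A <+>\<^bsub>M\<^esub> B),
     module.smult = (\<lambda>r A. \<Union>x\<in>A. N +>\<^bsub>M\<^esub> (r \<odot>\<^bsub>M\<^esub> x))\<rparr>"

definition self_module :: "('k::field, 'k) module" where
  "self_module = \<lparr>carrier = UNIV, monoid.mult = (*), one = 1, zero = 0, add = (+), module.smult = (*)\<rparr>"

section \<open>Quasi CW-posets\<close>

text \<open>
  The order complex of a subset \<open>Q\<close> containing \<open>bot\<close>: the chains of \<open>Q - {bot}\<close>.
\<close>

definition order_complex :: "'p::order_bot set \<Rightarrow> 'p set set" where
  "order_complex Q = {F. F \<subseteq> Q - {bot} \<and> Complete_Partial_Order.chain (\<le>) F}"

definition link :: "'p set set \<Rightarrow> 'p set \<Rightarrow> 'p set set" where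
  "link \<Delta> F = {G. G \<inter> F = {} \<and> G \<union> F \<in> \<Delta>}"

definition complex_dim :: "'p set set \<Rightarrow> int" where
  "complex_dim \<Delta> = int (Max (card ` \<Delta>)) - 1"

text \<open>
  Reduced simplicial chains over \<open>'k\<close>.  All complexes considered are subcomplexes of order complexes,
  so the partial order on the vertices is total on each face and orients it.  A chain is its
  coefficient function on faces; the empty face spans degree -1.  In the boundary,
  \<open>card {w \<in> G. w < v}\<close> is the position of the vertex \<open>v\<close> in the face \<open>insert v G\<close>.
\<close>

definition simplicial_chains :: "'p set set \<Rightarrow> int \<Rightarrow> ('p set \<Rightarrow> 'k::field) set" where
  "simplicial_chains \<Delta> i = {c. \<forall>F. c F \<noteq> 0 \<longrightarrow> F \<in> \<Delta> \<and> int (card F) = i + 1}"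

definition boundary :: "'p::{finite,order} set set \<Rightarrow> ('p set \<Rightarrow> 'k::field) \<Rightarrow> 'p set \<Rightarrow> 'k" where
  "boundary \<Delta> c G =
    (\<Sum>v | v \<notin> G \<and> insert v G \<in> \<Delta>. (-1) ^ card {w\<in>G. w < v} * c (insert v G))"

definition cycle_module ::
  "'p::{finite,order} set set \<Rightarrow> int \<Rightarrow> ('k::field, 'p set \<Rightarrow> 'k) module" where
  "cycle_module \<Delta> i =
    \<lparr>carrier = {c \<in> simplicial_chains \<Delta> i. boundary \<Delta> c = (\<lambda>_. 0)}, monoid.mult = undefined, one = undefined,
     zero = (\<lambda>_. 0), add = (\<lambda>c d F. c F + d F), module.smult = (\<lambda>r c F. r * c F)\<rparr>"

definition reduced_homology ::
  "'p::{finite,order} set set \<Rightarrow> int \<Rightarrow> ('k::field, ('p set \<Rightarrow> 'k) set) module" where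
  "reduced_homology \<Delta> i = quotient_module (cycle_module \<Delta> i) (boundary \<Delta> ` simplicial_chains \<Delta> (i + 1))"

definition gorenstein_star :: "'k::field itself \<Rightarrow> 'p::{finite,order} set set \<Rightarrow> bool" where
  "gorenstein_star _ \<Delta> \<longleftrightarrow>
    (\<forall>F\<in>\<Delta>. \<forall>i.
      let H = (reduced_homology (link \<Delta> F) i :: ('k, ('p set \<Rightarrow> 'k) set) module) in
      if i = complex_dim \<Delta> - int (card F)
      then isomorphic_modules (ring_of_type_algebra :: 'k ring) H self_module
      else carrier H = {\<zero>\<^bsub>H\<^esub>})"

definition quasi_CW_poset :: "'p::{finite,order_bot} itself \<Rightarrow> 'k::field itself \<Rightarrow> bool" where
  "quasi_CW_poset _ k \<longleftrightarrow>
    (\<forall>\<sigma>::'p. \<sigma> \<noteq> bot \<longrightarrow> gorenstein_star k (order_complex {\<tau>. \<tau> < \<sigma>}))"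

section \<open>Squarefree modules\<close>

text \<open>
  The polynomial ring with variables \<open>x\<^sub>\<sigma>\<close> for \<open>\<sigma> \<noteq> bot\<close>, inside the ring of all polynomials with
  variables indexed by \<open>'p\<close>.
\<close>

type_synonym ('p, 'k) mpoly = "('p \<Rightarrow>\<^sub>0 nat) \<Rightarrow>\<^sub>0 'k"

definition poly_ring :: "('p::order_bot, 'k::field) mpoly ring" where
  "poly_ring = ring_of_type_algebra\<lparr>carrier := {f. \<forall>a\<in>Poly_Mapping.keys f. bot \<notin> Poly_Mapping.keys a}\<rparr>"

definition poly_var :: "'p \<Rightarrow> ('p, 'k::field) mpoly" where
  "poly_var \<sigma> = Poly_Mapping.single (Poly_Mapping.single \<sigma> 1) 1"

text \<open>The group of degrees: integer vectors indexed by \<open>'p\<close> without \<open>bot\<close>.\<close>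

definition degrees :: "('p::order_bot \<Rightarrow> int) set" where
  "degrees = {u. u bot = 0}"

definition unit_vec :: "'p \<Rightarrow> 'p \<Rightarrow> int" where
  "unit_vec \<tau> = (\<lambda>\<sigma>. if \<sigma> = \<tau> then 1 else 0)"

definition supp :: "('p \<Rightarrow> int) \<Rightarrow> 'p set" where
  "supp u = {\<sigma>. u \<sigma> \<noteq> 0}"

text \<open>\<open>hcomp M u\<close> is the homogeneous component of degree \<open>u\<close>; only \<open>u \<in> degrees\<close> matters.\<close>

record ('r, 'm, 'd) gr_module = "('r, 'm) module" +
  hcomp :: "'d \<Rightarrow> 'm set"

type_synonym ('p, 'k, 'm) gr_mod = "(('p, 'k) mpoly, 'm, 'p \<Rightarrow> int) gr_module"

definition graded_module :: "('p::{finite,order_bot}, 'k::field, 'm) gr_mod \<Rightarrow> bool" where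
  "graded_module M \<longleftrightarrow>
    module poly_ring M \<and>
    (\<forall>u\<in>degrees. additive_subgroup (hcomp M u) M) \<and>
    (\<forall>x\<in>carrier M. \<exists>!c. (\<forall>u\<in>degrees. c u \<in> hcomp M u) \<and> (\<forall>u. u \<notin> degrees \<longrightarrow> c u = \<zero>\<^bsub>M\<^esub>) \<and>
        finite {u. c u \<noteq> \<zero>\<^bsub>M\<^esub>} \<and> x = (\<Oplus>\<^bsub>M\<^esub>u\<in>{u. c u \<noteq> \<zero>\<^bsub>M\<^esub>}. c u)) \<and>
    (\<forall>a r. \<forall>u\<in>degrees. \<forall>x\<in>hcomp M u. bot \<notin> Poly_Mapping.keys a \<longrightarrow>
        Poly_Mapping.single a r \<odot>\<^bsub>M\<^esub> x \<in> hcomp M (\<lambda>\<sigma>. u \<sigma> + int (Poly_Mapping.lookup a \<sigma>)))"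

definition squarefree_module :: "('p::{finite,order_bot}, 'k::field, 'm) gr_mod \<Rightarrow> bool" where
  "squarefree_module M \<longleftrightarrow>
    graded_module M \<and> finitely_generated poly_ring M \<and>
    (\<forall>u\<in>degrees. \<not> (\<forall>\<sigma>. 0 \<le> u \<sigma>) \<longrightarrow> hcomp M u = {\<zero>\<^bsub>M\<^esub>}) \<and>
    (\<forall>u\<in>degrees. (\<forall>\<sigma>. 0 \<le> u \<sigma>) \<longrightarrow> supp u \<notin> order_complex UNIV \<longrightarrow> hcomp M u = {\<zero>\<^bsub>M\<^esub>}) \<and>
    (\<forall>u\<in>degrees. \<forall>\<tau>. (\<forall>\<sigma>. 0 \<le> u \<sigma>) \<longrightarrow> supp u \<in> order_complex UNIV \<longrightarrow> supp u \<noteq> {} \<longrightarrow>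
        \<tau> \<noteq> bot \<longrightarrow> supp (\<lambda>\<sigma>. u \<sigma> + unit_vec \<tau> \<sigma>) \<in> order_complex UNIV \<longrightarrow>
        \<tau> \<le> (GREATEST \<sigma>. \<sigma> \<in> supp u) \<longrightarrow>
        bij_betw (\<lambda>x. poly_var \<tau> \<odot>\<^bsub>M\<^esub> x) (hcomp M u) (hcomp M (\<lambda>\<sigma>. u \<sigma> + unit_vec \<tau> \<sigma>)))"

definition gr_hom ::
  "('p::{finite,order_bot}, 'k::field, 'm) gr_mod \<Rightarrow> ('p, 'k, 'm) gr_mod \<Rightarrow> ('m \<Rightarrow> 'm) set" where
  "gr_hom M N = {f \<in> mod_hom poly_ring M N. \<forall>u\<in>degrees. f ` hcomp M u \<subseteq> hcomp N u}"

text \<open>The squarefree modules with elements in \<open>'m\<close>.\<close>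

definition Sq :: "(('p::{finite,order_bot}, 'k::field, 'm) gr_mod, 'm \<Rightarrow> 'm) cat" where
  "Sq = \<lparr>Ob = {M. squarefree_module M}, Hom = gr_hom,
         Id = (\<lambda>M. \<lambda>x\<in>carrier M. x),
         Comp = (\<lambda>L M N g f. compose (carrier L) g f)\<rparr>"

section \<open>Sheaves\<close>

text \<open>\<open>res F \<sigma> \<tau>\<close> is the restriction map from \<open>\<sigma>\<close> to \<open>\<tau>\<close>; only \<open>\<tau> < \<sigma>\<close> matters.\<close>

record ('p, 'k, 'v) sheaf =
  stalk :: "'p \<Rightarrow> ('k, 'v) module"
  res :: "'p \<Rightarrow> 'p \<Rightarrow> 'v \<Rightarrow> 'v"

definition is_sheaf :: "('p::{finite,order_bot}, 'k::field, 'v) sheaf \<Rightarrow> bool" where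
  "is_sheaf F \<longleftrightarrow>
    (\<forall>\<sigma>. module ring_of_type_algebra (stalk F \<sigma>) \<and>
         finitely_generated ring_of_type_algebra (stalk F \<sigma>)) \<and>
    (\<forall>\<sigma> \<tau>. \<tau> < \<sigma> \<longrightarrow> res F \<sigma> \<tau> \<in> mod_hom ring_of_type_algebra (stalk F \<sigma>) (stalk F \<tau>)) \<and>
    (\<forall>\<sigma> \<tau> \<rho>. \<tau> < \<sigma> \<longrightarrow> \<rho> < \<tau> \<longrightarrow> (\<forall>x\<in>carrier (stalk F \<sigma>). res F \<tau> \<rho> (res F \<sigma> \<tau> x) = res F \<sigma> \<rho> x))"

definition sheaf_hom ::
  "('p::{finite,order_bot}, 'k::field, 'v) sheaf \<Rightarrow> ('p, 'k, 'v) sheaf \<Rightarrow> ('p \<Rightarrow> 'v \<Rightarrow> 'v) set" where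
  "sheaf_hom F G = {\<phi>.
     (\<forall>\<sigma>. \<phi> \<sigma> \<in> mod_hom ring_of_type_algebra (stalk F \<sigma>) (stalk G \<sigma>)) \<and>
     (\<forall>\<sigma> \<tau>. \<tau> < \<sigma> \<longrightarrow> (\<forall>x\<in>carrier (stalk F \<sigma>). \<phi> \<tau> (res F \<sigma> \<tau> x) = res G \<sigma> \<tau> (\<phi> \<sigma> x)))}"

text \<open>The sheaves of finite-dimensional vector spaces with elements in \<open>'v\<close>.\<close>

definition Sh :: "(('p::{finite,order_bot}, 'k::field, 'v) sheaf, 'p \<Rightarrow> 'v \<Rightarrow> 'v) cat" where
  "Sh = \<lparr>Ob = {F. is_sheaf F}, Hom = sheaf_hom,
         Id = (\<lambda>F \<sigma>. \<lambda>x\<in>carrier (stalk F \<sigma>). x),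
         Comp = (\<lambda>F G H \<psi> \<phi> \<sigma>. compose (carrier (stalk F \<sigma>)) (\<psi> \<sigma>) (\<phi> \<sigma>))\<rparr>"

text \<open>
  A collection of all modules is not available in HOL, so elements are drawn from a fixed type.
  Every finite-dimensional vector space over \<open>'k\<close>, and more generally every one of countable
  dimension, is isomorphic to one with elements in \<open>'a\<close> as soon as \<open>'k list\<close> embeds into \<open>'a\<close>.
  Finitely generated modules over \<open>poly_ring\<close> have countable dimension, so above this size the
  categories \<open>Sq\<close> and \<open>Sh\<close> do not depend on the type of elements, up to equivalence.
\<close>

definition large_enough :: "'k itself \<Rightarrow> 'a itself \<Rightarrow> bool" where
  "large_enough _ _ \<longleftrightarrow> (\<exists>j :: 'k list \<Rightarrow> 'a. inj j)"

end

theory Submission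
  imports Defs "Jordan_Normal_Form.Matrix" "HOL-Library.Function_Algebras" "HOL-Library.Countable"
begin

text \<open>
  A squarefree module \<open>M\<close> is determined by its components in degree 0 and in the degrees of the
  variables. For \<open>t < s\<close> the variable \<open>x\<^sub>t\<close> acts bijectively from degree \<open>s\<close> to degree \<open>s + t\<close>, so
  multiplying by \<open>x\<^sub>s\<close> and dividing by \<open>x\<^sub>t\<close> gives maps from the component at \<open>t\<close> to the one at \<open>s\<close>;
  they form a covariant functor from the poset to finite-dimensional vector spaces. Conversely such
  a functor \<open>V\<close> gives the module whose component in a chain-supported degree \<open>u\<close> is \<open>V\<close> at the
  largest element of the support of \<open>u\<close>. Dualising a covariant functor gives a sheaf and reverses
  the arrows. The functors from representations by matrices (functors with values in coordinate
  spaces) to squarefree modules and to the opposite of the category of sheaves are both fully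
  faithful and essentially surjective, so their targets are equivalent.
\<close>

section \<open>Fully faithful and essentially surjective functors\<close>

text \<open>\<open>Rep\<close> stands between the two categories because elements of modules and
  elements of sheaves come from unrelated types \<open>'m\<close> and \<open>'v\<close>. Matrices
  are neutral: an injection of coordinate data into a type carries them there. Finite generation
  makes all components and stalks finite-dimensional, so matrices describe all linear maps and
  transposition loses nothing. The minimal element \<open>bot\<close> stands for degree 0, its
  variable being read as 1. This fits the bijectivity condition, which concerns only degrees with
  nonempty support: nothing needs to be invertible out of degree 0, while the map from there to
  degree \<open>s\<close> is plain multiplication by \<open>x\<^sub>s\<close>. The delicate point is
  that these quotients of variables compose. For \<open>r\<close> \<le> \<open>t\<close> \<le>
  \<open>s\<close> two variables have to be cancelled, one of them in the degree of
  \<open>x\<^sub>s x\<^sub>t\<close>; this is possible because the three elements form a chain with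
  \<open>s\<close> on top.\<close>

lemma category_Id: "category C \<Longrightarrow> A \<in> Ob C \<Longrightarrow> Id C A \<in> Hom C A A"
  by (auto simp: category_def)

lemma category_Comp:
  "\<lbrakk>category C; A \<in> Ob C; B \<in> Ob C; E \<in> Ob C; f \<in> Hom C A B; g \<in> Hom C B E\<rbrakk>
    \<Longrightarrow> Comp C A B E g f \<in> Hom C A E"
  unfolding category_def by blast

lemma category_unit:
  assumes "category C" "A \<in> Ob C" "B \<in> Ob C" "f \<in> Hom C A B"
  shows "Comp C A A B f (Id C A) = f" "Comp C A B B (Id C B) f = f"
  using assms unfolding category_def by blast+

lemma category_assoc:
  "\<lbrakk>category C; V \<in> Ob C; A \<in> Ob C; B \<in> Ob C; E \<in> Ob C;
    f \<in> Hom C V A; g \<in> Hom C A B; h \<in> Hom C B E\<rbrakk>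
    \<Longrightarrow> Comp C V B E h (Comp C V A B g f) = Comp C V A E (Comp C A B E h g) f"
  unfolding category_def by blast

lemma category_opposite: "category C \<Longrightarrow> category (opposite C)"
  unfolding category_def opposite_def by simp

lemma functor_Ob: "is_functor C D Fo Fa \<Longrightarrow> A \<in> Ob C \<Longrightarrow> Fo A \<in> Ob D"
  by (auto simp: is_functor_def)

lemma functor_Hom:
  "\<lbrakk>is_functor C D Fo Fa; A \<in> Ob C; B \<in> Ob C; f \<in> Hom C A B\<rbrakk> \<Longrightarrow> Fa A B f \<in> Hom D (Fo A) (Fo B)"
  by (auto simp: is_functor_def)

lemma functor_Id: "is_functor C D Fo Fa \<Longrightarrow> A \<in> Ob C \<Longrightarrow> Fa A A (Id C A) = Id D (Fo A)"
  by (auto simp: is_functor_def)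

lemma functor_Comp:
  "\<lbrakk>is_functor C D Fo Fa; A \<in> Ob C; B \<in> Ob C; E \<in> Ob C; f \<in> Hom C A B; g \<in> Hom C B E\<rbrakk>
    \<Longrightarrow> Fa A E (Comp C A B E g f) = Comp D (Fo A) (Fo B) (Fo E) (Fa B E g) (Fa A B f)"
  unfolding is_functor_def by blast

definition fully_faithful ::
  "('o, 'a) cat \<Rightarrow> ('o2, 'a2) cat \<Rightarrow> ('o \<Rightarrow> 'o2) \<Rightarrow> ('o \<Rightarrow> 'o \<Rightarrow> 'a \<Rightarrow> 'a2) \<Rightarrow> bool" where
  "fully_faithful C D Fo Fa \<longleftrightarrow>
    (\<forall>A\<in>Ob C. \<forall>B\<in>Ob C. bij_betw (Fa A B) (Hom C A B) (Hom D (Fo A) (Fo B)))"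

definition essentially_surjective :: "('o, 'a) cat \<Rightarrow> ('o2, 'a2) cat \<Rightarrow> ('o \<Rightarrow> 'o2) \<Rightarrow> bool" where
  "essentially_surjective C D Fo \<longleftrightarrow> (\<forall>Y\<in>Ob D. \<exists>A\<in>Ob C. \<exists>f. is_iso D (Fo A) Y f)"

lemma fully_faithful_inj:
  "\<lbrakk>fully_faithful C D Fo Fa; A \<in> Ob C; B \<in> Ob C; f \<in> Hom C A B; g \<in> Hom C A B; Fa A B f = Fa A B g\<rbrakk>
    \<Longrightarrow> f = g"
  unfolding fully_faithful_def bij_betw_def by (meson inj_onD)

lemma fully_faithful_lift:
  assumes "fully_faithful C D Fo Fa" "A \<in> Ob C" "B \<in> Ob C" "h \<in> Hom D (Fo A) (Fo B)"
  obtains f where "f \<in> Hom C A B" "Fa A B f = h"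
  using assms unfolding fully_faithful_def bij_betw_def by (metis imageE)

text \<open>The inverse in \<open>D\<close> has a preimage by fullness, and by faithfulness that
  preimage composes with \<open>f\<close> to identities, as this is so after applying the
  functor.\<close>

lemma functor_reflects_iso:
  assumes cat: "category C" "category D" and F: "is_functor C D Fo Fa" "fully_faithful C D Fo Fa"
    and AB: "A \<in> Ob C" "B \<in> Ob C" and f: "f \<in> Hom C A B" and iso: "is_iso D (Fo A) (Fo B) (Fa A B f)"
  shows "is_iso C A B f"
proof -
  obtain h where h: "h \<in> Hom D (Fo B) (Fo A)"
      "Comp D (Fo A) (Fo B) (Fo A) h (Fa A B f) = Id D (Fo A)"
      "Comp D (Fo B) (Fo A) (Fo B) (Fa A B f) h = Id D (Fo B)"
    using iso unfolding is_iso_def by blast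
  obtain g where g: "g \<in> Hom C B A" "Fa B A g = h"
    using fully_faithful_lift[OF F(2) AB(2,1) h(1)] .
  have "Comp C A B A g f = Id C A"
    by (rule fully_faithful_inj[OF F(2) AB(1) AB(1)])
      (use AB f g h cat F in \<open>simp_all add: category_Comp category_Id functor_Comp functor_Id\<close>)
  moreover have "Comp C B A B f g = Id C B"
    by (rule fully_faithful_inj[OF F(2) AB(2) AB(2)])
      (use AB f g h cat F in \<open>simp_all add: category_Comp category_Id functor_Comp functor_Id\<close>)
  ultimately show ?thesis using f g unfolding is_iso_def by blast
qed

lemma functor_preserves_iso:
  assumes "is_functor C D Fo Fa" "A \<in> Ob C" "B \<in> Ob C" "is_iso C A B f"
  shows "is_iso D (Fo A) (Fo B) (Fa A B f)"
proof -
  obtain g where g: "f \<in> Hom C A B" "g \<in> Hom C B A" "Comp C A B A g f = Id C A" "Comp C B A B f g = Id C B"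
    using assms(4) unfolding is_iso_def by blast
  show ?thesis unfolding is_iso_def
    using g assms(1-3) functor_Comp[OF assms(1-3) assms(2) g(1,2)] functor_Comp[OF assms(1) assms(3,2,3) g(2,1)]
    by (metis functor_Hom functor_Id)
qed

lemma is_iso_trans:
  assumes C: "category C" and O: "A \<in> Ob C" "B \<in> Ob C" "E \<in> Ob C" and "is_iso C A B f" "is_iso C B E g"
  shows "is_iso C A E (Comp C A B E g f)"
proof -
  obtain f' where f: "f \<in> Hom C A B" "f' \<in> Hom C B A" "Comp C A B A f' f = Id C A" "Comp C B A B f f' = Id C B"
    using assms(5) unfolding is_iso_def by blast
  obtain g' where g: "g \<in> Hom C B E" "g' \<in> Hom C E B" "Comp C B E B g' g = Id C B" "Comp C E B E g g' = Id C E"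
    using assms(6) unfolding is_iso_def by blast
  note [simp] = category_Comp[OF C] category_unit[OF C] O f g
  have "Comp C A E A (Comp C E B A f' g') (Comp C A B E g f) =
      Comp C A B A f' (Comp C A B B (Comp C B E B g' g) f)"
    using category_assoc[OF C O(1,3,2,1), of "Comp C A B E g f" g' f']
      category_assoc[OF C O(1,2,3,2), of f g g'] by simp
  moreover have "Comp C E A E (Comp C A B E g f) (Comp C E B A f' g') =
      Comp C E B E g (Comp C E B B (Comp C B A B f f') g')"
    using category_assoc[OF C O(3,1,2,3), of "Comp C E B A f' g'" f g]
      category_assoc[OF C O(3,2,1,2), of g' f' f] by simp
  ultimately show ?thesis unfolding is_iso_def by (metis O category_Comp[OF C] category_unit[OF C] f g)
qed

lemma fully_faithful_essentially_surjective_comp: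
  assumes "is_functor C D Fo Fa" "fully_faithful C D Fo Fa" "essentially_surjective C D Fo"
    and "is_functor D E Go Ga" "fully_faithful D E Go Ga" "essentially_surjective D E Go"
    and E: "category E"
  shows "is_functor C E (\<lambda>A. Go (Fo A)) (\<lambda>A B f. Ga (Fo A) (Fo B) (Fa A B f))"
    and "fully_faithful C E (\<lambda>A. Go (Fo A)) (\<lambda>A B f. Ga (Fo A) (Fo B) (Fa A B f))"
    and "essentially_surjective C E (\<lambda>A. Go (Fo A))"
proof -
  show "is_functor C E (\<lambda>A. Go (Fo A)) (\<lambda>A B f. Ga (Fo A) (Fo B) (Fa A B f))"
    using assms(1,4) unfolding is_functor_def by simp
  show "fully_faithful C E (\<lambda>A. Go (Fo A)) (\<lambda>A B f. Ga (Fo A) (Fo B) (Fa A B f))"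
    unfolding fully_faithful_def
  proof (intro ballI)
    fix A B assume AB: "A \<in> Ob C" "B \<in> Ob C"
    show "bij_betw (\<lambda>f. Ga (Fo A) (Fo B) (Fa A B f)) (Hom C A B) (Hom E (Go (Fo A)) (Go (Fo B)))"
      using bij_betw_trans[of "Fa A B" "Hom C A B" _ "Ga (Fo A) (Fo B)"] assms(2,5) AB functor_Ob[OF assms(1)]
      unfolding fully_faithful_def comp_def by blast
  qed
  show "essentially_surjective C E (\<lambda>A. Go (Fo A))"
    unfolding essentially_surjective_def
  proof
    fix Y assume Y: "Y \<in> Ob E"
    obtain B g where B: "B \<in> Ob D" "is_iso E (Go B) Y g"
      using assms(6) Y unfolding essentially_surjective_def by blast
    obtain A f where A: "A \<in> Ob C" "is_iso D (Fo A) B f"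
      using assms(3) B unfolding essentially_surjective_def by blast
    have "is_iso E (Go (Fo A)) (Go B) (Ga (Fo A) B f)"
      using functor_preserves_iso[OF assms(4) functor_Ob[OF assms(1) A(1)] B(1) A(2)] .
    then show "\<exists>A\<in>Ob C. \<exists>f. is_iso E (Go (Fo A)) Y f"
      using is_iso_trans[OF E _ _ Y _ B(2)] A(1) B(1) functor_Ob assms(1,4) by meson
  qed
qed

text \<open>Every \<open>Y\<close> is represented by a chosen object \<open>Go Y\<close> together
  with an isomorphism, and arrows are conjugated by these isomorphisms and then lifted through
  \<open>Fa\<close>. The quasi-inverse is also recorded as fully faithful and essentially
  surjective, since it is going to be composed with a second functor.\<close>

lemma quasi_inverse:
  assumes C: "category C" and D: "category D" and F: "is_functor C D Fo Fa"
    and ff: "fully_faithful C D Fo Fa" and es: "essentially_surjective C D Fo"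
  obtains Go Ga \<eta> \<epsilon> where "is_functor D C Go Ga" "fully_faithful D C Go Ga" "essentially_surjective D C Go"
    "natural_iso C C (\<lambda>A. A) (\<lambda>A B f. f)
        (\<lambda>A. Go (Fo A)) (\<lambda>A B f. Ga (Fo A) (Fo B) (Fa A B f)) \<eta>"
    "natural_iso D D (\<lambda>A. Fo (Go A)) (\<lambda>A B f. Fa (Go A) (Go B) (Ga A B f))
        (\<lambda>A. A) (\<lambda>A B f. f) \<epsilon>"
proof -
  have "\<exists>A e e'. A \<in> Ob C \<and> e \<in> Hom D (Fo A) Y \<and> e' \<in> Hom D Y (Fo A) \<and>
      Comp D (Fo A) Y (Fo A) e' e = Id D (Fo A) \<and> Comp D Y (Fo A) Y e e' = Id D Y"
    if "Y \<in> Ob D" for Y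
    using es that unfolding essentially_surjective_def is_iso_def by blast
  then obtain Go e e' where G: "\<And>Y. Y \<in> Ob D \<Longrightarrow> Go Y \<in> Ob C"
      "\<And>Y. Y \<in> Ob D \<Longrightarrow> e Y \<in> Hom D (Fo (Go Y)) Y"
      "\<And>Y. Y \<in> Ob D \<Longrightarrow> e' Y \<in> Hom D Y (Fo (Go Y))"
      "\<And>Y. Y \<in> Ob D \<Longrightarrow> Comp D (Fo (Go Y)) Y (Fo (Go Y)) (e' Y) (e Y) = Id D (Fo (Go Y))"
      "\<And>Y. Y \<in> Ob D \<Longrightarrow> Comp D Y (Fo (Go Y)) Y (e Y) (e' Y) = Id D Y"
    by metis
  note FO = functor_Ob[OF F]
  note DC = category_Comp[OF D]
  \<comment> \<open>\<open>u\<close> is conjugation by the chosen isomorphisms and \<open>w\<close>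
    is conjugation back; they are mutually inverse on Hom-sets.\<close>
  define u where "u Y Z f = Comp D (Fo (Go Y)) Z (Fo (Go Z)) (e' Z) (Comp D (Fo (Go Y)) Y Z f (e Y))" for Y Z f
  define w where "w Y Z h = Comp D Y (Fo (Go Z)) Z (e Z) (Comp D Y (Fo (Go Y)) (Fo (Go Z)) h (e' Y))" for Y Z h
  have u_Hom: "u Y Z f \<in> Hom D (Fo (Go Y)) (Fo (Go Z))" if "Y \<in> Ob D" "Z \<in> Ob D" "f \<in> Hom D Y Z" for Y Z f
    unfolding u_def using that by (intro DC) (auto intro: G FO)
  have w_Hom: "w Y Z h \<in> Hom D Y Z" if "Y \<in> Ob D" "Z \<in> Ob D" "h \<in> Hom D (Fo (Go Y)) (Fo (Go Z))" for Y Z h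
    unfolding w_def using that by (intro DC) (auto intro: G FO)
  have eu: "Comp D (Fo (Go Y)) (Fo (Go Z)) Z (e Z) (u Y Z f) = Comp D (Fo (Go Y)) Y Z f (e Y)"
    if "Y \<in> Ob D" "Z \<in> Ob D" "f \<in> Hom D Y Z" for Y Z f
    unfolding u_def
    by (subst category_assoc[OF D]) (use that G FO in \<open>auto simp: DC category_unit[OF D]\<close>)
  have ue: "Comp D Y (Fo (Go Y)) (Fo (Go Z)) (u Y Z f) (e' Y) = Comp D Y Z (Fo (Go Z)) (e' Z) f"
    if "Y \<in> Ob D" "Z \<in> Ob D" "f \<in> Hom D Y Z" for Y Z f
  proof -
    have "Comp D Y (Fo (Go Y)) Z (Comp D (Fo (Go Y)) Y Z f (e Y)) (e' Y) = f"
      by (subst category_assoc[OF D, symmetric]) (use that G FO in \<open>auto simp: DC category_unit[OF D]\<close>)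
    then show ?thesis unfolding u_def
      by (subst category_assoc[OF D, symmetric]) (use that G FO in \<open>auto simp: DC\<close>)
  qed
  have wu: "w Y Z (u Y Z f) = f" if "Y \<in> Ob D" "Z \<in> Ob D" "f \<in> Hom D Y Z" for Y Z f
    unfolding w_def using that
    by (subst ue) (auto simp: G FO DC category_unit[OF D] category_assoc[OF D, of _ _ _ _ _ "e' _" "e _"]
       category_assoc[OF D, of Y Z "Fo (Go Z)" Z])
  have we: "Comp D (Fo (Go Y)) Y Z (w Y Z h) (e Y) = Comp D (Fo (Go Y)) (Fo (Go Z)) Z (e Z) h"
    if "Y \<in> Ob D" "Z \<in> Ob D" "h \<in> Hom D (Fo (Go Y)) (Fo (Go Z))" for Y Z h
  proof -
    have "Comp D (Fo (Go Y)) Y (Fo (Go Z)) (Comp D Y (Fo (Go Y)) (Fo (Go Z)) h (e' Y)) (e Y) = h"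
      by (subst category_assoc[OF D, symmetric]) (use that G FO in \<open>auto simp: DC category_unit[OF D]\<close>)
    then show ?thesis unfolding w_def
      by (subst category_assoc[OF D, symmetric]) (use that G FO in \<open>auto simp: DC\<close>)
  qed
  have uw: "u Y Z (w Y Z h) = h" if "Y \<in> Ob D" "Z \<in> Ob D" "h \<in> Hom D (Fo (Go Y)) (Fo (Go Z))" for Y Z h
    unfolding u_def using that
    by (subst we) (auto simp: G FO DC category_unit[OF D] category_assoc[OF D, of "Fo (Go Y)" "Fo (Go Z)" Z "Fo (Go Z)"])
  have u_bij: "bij_betw (u Y Z) (Hom D Y Z) (Hom D (Fo (Go Y)) (Fo (Go Z)))" if "Y \<in> Ob D" "Z \<in> Ob D" for Y Z
    by (rule bij_betw_byWitness[where f' = "w Y Z"]) (use that in \<open>auto simp: wu uw u_Hom w_Hom\<close>)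
  have u_Id: "u Y Y (Id D Y) = Id D (Fo (Go Y))" if "Y \<in> Ob D" for Y
    unfolding u_def using that by (simp add: category_unit[OF D] FO G)
  have u_Comp: "u Y V (Comp D Y Z V g f) = Comp D (Fo (Go Y)) (Fo (Go Z)) (Fo (Go V)) (u Z V g) (u Y Z f)"
    if O: "Y \<in> Ob D" "Z \<in> Ob D" "V \<in> Ob D" and fg: "f \<in> Hom D Y Z" "g \<in> Hom D Z V" for Y Z V f g
  proof -
    have "Comp D (Fo (Go Y)) (Fo (Go Z)) V (Comp D (Fo (Go Z)) Z V g (e Z)) (u Y Z f) =
        Comp D (Fo (Go Y)) Y V (Comp D Y Z V g f) (e Y)"
      by (subst category_assoc[OF D, symmetric])
        (use O fg G FO in \<open>auto simp: u_Hom eu category_assoc[OF D]\<close>)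
    then show ?thesis
      unfolding u_def[of Y V] u_def[of Z V]
      by (subst category_assoc[OF D, symmetric]) (use O fg G FO in \<open>auto simp: u_Hom DC\<close>)
  qed
  \<comment> \<open>Each law for \<open>Ga\<close> is checked after applying \<open>Fa\<close>,
    which is injective on Hom-sets and turns \<open>Ga\<close> into \<open>u\<close>.\<close>
  define Ga where "Ga Y Z f = inv_into (Hom C (Go Y) (Go Z)) (Fa (Go Y) (Go Z)) (u Y Z f)" for Y Z f
  have Fbij: "bij_betw (Fa A B) (Hom C A B) (Hom D (Fo A) (Fo B))" if "A \<in> Ob C" "B \<in> Ob C" for A B
    using ff that unfolding fully_faithful_def by blast
  have FG: "Fa (Go Y) (Go Z) (Ga Y Z f) = u Y Z f" "Ga Y Z f \<in> Hom C (Go Y) (Go Z)"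
    if "Y \<in> Ob D" "Z \<in> Ob D" "f \<in> Hom D Y Z" for Y Z f
    unfolding Ga_def using Fbij[OF G(1)[OF that(1)] G(1)[OF that(2)]] u_Hom[OF that]
    by (auto simp: bij_betw_def f_inv_into_f intro: inv_into_into)
  have Gbij: "bij_betw (Ga Y Z) (Hom D Y Z) (Hom C (Go Y) (Go Z))" if "Y \<in> Ob D" "Z \<in> Ob D" for Y Z
    using bij_betw_trans[OF u_bij[OF that] bij_betw_inv_into[OF Fbij[OF G(1)[OF that(1)] G(1)[OF that(2)]]]]
    unfolding Ga_def comp_def .
  note inj = fully_faithful_inj[OF ff]
  have Gf: "is_functor D C Go Ga"
    unfolding is_functor_def
  proof (intro conjI ballI)
    fix A assume "A \<in> Ob D"
    then show "Ga A A (Id D A) = Id C (Go A)"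
      by (intro inj[of "Go A" "Go A"]) (auto simp: G FG category_Id D C u_Id functor_Id[OF F])
  next
    fix A B E f g assume "A \<in> Ob D" "B \<in> Ob D" "E \<in> Ob D" "f \<in> Hom D A B" "g \<in> Hom D B E"
    then show "Ga A E (Comp D A B E g f) = Comp C (Go A) (Go B) (Go E) (Ga B E g) (Ga A B f)"
      by (intro inj[of "Go A" "Go E"])
        (auto simp: G FG DC category_Comp[OF C] u_Comp functor_Comp[OF F])
  qed (auto simp: G FG)
  \<comment> \<open>The unit at \<open>A\<close> lifts the inverse of the chosen isomorphism at
    \<open>Fo A\<close>; its naturality becomes \<open>ue\<close>. The counit is \<open>e\<close>
    itself, with naturality \<open>eu\<close>.\<close>
  define \<eta> where "\<eta> A = inv_into (Hom C A (Go (Fo A))) (Fa A (Go (Fo A))) (e' (Fo A))" for A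
  have \<eta>: "Fa A (Go (Fo A)) (\<eta> A) = e' (Fo A)" "\<eta> A \<in> Hom C A (Go (Fo A))" if "A \<in> Ob C" for A
    unfolding \<eta>_def using Fbij[OF that G(1)[OF FO[OF that]]] G(3)[OF FO[OF that]]
    by (auto simp: bij_betw_def f_inv_into_f intro: inv_into_into)
  have \<eta>_iso: "is_iso C A (Go (Fo A)) (\<eta> A)" if "A \<in> Ob C" for A
    by (rule functor_reflects_iso[OF C D F ff that G(1)[OF FO[OF that]] \<eta>(2)[OF that]])
      (use that G FO in \<open>auto simp: \<eta> is_iso_def intro!: bexI[of _ "e (Fo A)"]\<close>)
  have n\<eta>: "natural_iso C C (\<lambda>A. A) (\<lambda>A B f. f)
        (\<lambda>A. Go (Fo A)) (\<lambda>A B f. Ga (Fo A) (Fo B) (Fa A B f)) \<eta>"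
    unfolding natural_iso_def
  proof (intro conjI ballI)
    fix A B f assume O: "A \<in> Ob C" "B \<in> Ob C" and f: "f \<in> Hom C A B"
    show "Comp C A B (Go (Fo B)) (\<eta> B) f = Comp C A (Go (Fo A)) (Go (Fo B)) (Ga (Fo A) (Fo B) (Fa A B f)) (\<eta> A)"
      by (rule inj[of A "Go (Fo B)"])
        (use O f in \<open>auto simp: G FG FO \<eta> category_Comp[OF C] functor_Comp[OF F] functor_Hom[OF F] ue\<close>)
  qed (rule \<eta>_iso)
  have n\<epsilon>: "natural_iso D D (\<lambda>A. Fo (Go A)) (\<lambda>A B f. Fa (Go A) (Go B) (Ga A B f))
        (\<lambda>A. A) (\<lambda>A B f. f) e"
    unfolding natural_iso_def
  proof (intro conjI ballI)
    fix Y assume "Y \<in> Ob D"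
    then show "is_iso D (Fo (Go Y)) Y (e Y)"
      unfolding is_iso_def using G by blast
  qed (simp add: FG eu)
  have Gff: "fully_faithful D C Go Ga"
    unfolding fully_faithful_def using Gbij by blast
  have Ges: "essentially_surjective D C Go"
    unfolding essentially_surjective_def
  proof
    fix A assume A: "A \<in> Ob C"
    obtain g where "\<eta> A \<in> Hom C A (Go (Fo A))" "g \<in> Hom C (Go (Fo A)) A"
        "Comp C A (Go (Fo A)) A g (\<eta> A) = Id C A"
        "Comp C (Go (Fo A)) A (Go (Fo A)) (\<eta> A) g = Id C (Go (Fo A))"
      using \<eta>_iso[OF A] unfolding is_iso_def by blast
    then have "is_iso C (Go (Fo A)) A g"
      unfolding is_iso_def by blast
    then show "\<exists>Y\<in>Ob D. \<exists>f. is_iso C (Go Y) A f"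
      using FO[OF A] by blast
  qed
  show thesis
    by (rule that[OF Gf Gff Ges n\<eta> n\<epsilon>])
qed

text \<open>Reversing the leg to \<open>C\<close> by a quasi-inverse and following the leg to
  \<open>D\<close> gives a fully faithful, essentially surjective functor from \<open>C\<close> to
  \<open>D\<close>, to which \<open>quasi_inverse\<close> applies once more.\<close>

lemma equivalent_categories_span:
  assumes "category B" "category C" "category D"
    and "is_functor B C Fo Fa" "fully_faithful B C Fo Fa" "essentially_surjective B C Fo"
    and "is_functor B D Ho Ha" "fully_faithful B D Ho Ha" "essentially_surjective B D Ho"
  shows "equivalent_categories C D"
proof -
  obtain Go Ga where G: "is_functor C B Go Ga" "fully_faithful C B Go Ga" "essentially_surjective C B Go"
    by (rule quasi_inverse[OF assms(1,2,4,5,6)])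
  note K = fully_faithful_essentially_surjective_comp[OF G assms(7-9,3)]
  show ?thesis
    by (rule quasi_inverse[OF assms(2,3) K])
      (unfold equivalent_categories_def, intro conjI exI, (rule assms K; assumption?)+)
qed

section \<open>Linear maps, homomorphisms and spans over a ring\<close>

no_notation fps_nth (infixl "$" 75)

abbreviation scalars :: "'k::field ring" where
  "scalars \<equiv> ring_of_type_algebra"

lemma scalars_simps [simp]:
  "carrier scalars = UNIV" "monoid.mult scalars = (*)" "monoid.one scalars = 1"
  "zero scalars = 0" "add scalars = (+)"
  by (simp_all add: ring_of_type_algebra_def)

lemma cring_scalars: "cring (scalars :: 'k::field ring)"
  by (rule cring_from_type_algebra)

text \<open>Membership in \<open>mod_hom\<close> without extensionality, so that composites and
  inverses can be formed without restricting them to the carrier each time.\<close>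

definition linear_map ::
  "('r, 'x) ring_scheme \<Rightarrow> ('r, 'a, 'y) module_scheme \<Rightarrow> ('r, 'b, 'z) module_scheme \<Rightarrow> ('a \<Rightarrow> 'b) \<Rightarrow> bool" where
  "linear_map R V W f \<longleftrightarrow> (\<forall>x\<in>carrier V. f x \<in> carrier W) \<and>
    (\<forall>x\<in>carrier V. \<forall>y\<in>carrier V. f (x \<oplus>\<^bsub>V\<^esub> y) = f x \<oplus>\<^bsub>W\<^esub> f y) \<and>
    (\<forall>r\<in>carrier R. \<forall>x\<in>carrier V. f (r \<odot>\<^bsub>V\<^esub> x) = r \<odot>\<^bsub>W\<^esub> f x)"

lemma linear_mapI:
  assumes "\<And>x. x \<in> carrier V \<Longrightarrow> f x \<in> carrier W"
    and "\<And>x y. x \<in> carrier V \<Longrightarrow> y \<in> carrier V \<Longrightarrow> f (x \<oplus>\<^bsub>V\<^esub> y) = f x \<oplus>\<^bsub>W\<^esub> f y"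
    and "\<And>r x. r \<in> carrier R \<Longrightarrow> x \<in> carrier V \<Longrightarrow> f (r \<odot>\<^bsub>V\<^esub> x) = r \<odot>\<^bsub>W\<^esub> f x"
  shows "linear_map R V W f"
  using assms unfolding linear_map_def by blast

lemma linear_mapD:
  assumes "linear_map R V W f"
  shows "x \<in> carrier V \<Longrightarrow> f x \<in> carrier W"
    and "x \<in> carrier V \<Longrightarrow> y \<in> carrier V \<Longrightarrow> f (x \<oplus>\<^bsub>V\<^esub> y) = f x \<oplus>\<^bsub>W\<^esub> f y"
    and "r \<in> carrier R \<Longrightarrow> x \<in> carrier V \<Longrightarrow> f (r \<odot>\<^bsub>V\<^esub> x) = r \<odot>\<^bsub>W\<^esub> f x"
  using assms unfolding linear_map_def by blast+

lemma mod_hom_iff: "f \<in> mod_hom R M N \<longleftrightarrow> linear_map R M N f \<and> f \<in> extensional (carrier M)"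
  unfolding mod_hom_def linear_map_def PiE_def by auto

lemma linear_map_cong:
  assumes "module R V" "\<And>x. x \<in> carrier V \<Longrightarrow> f x = g x"
  shows "linear_map R V W f = linear_map R V W g"
proof -
  interpret module R V by fact
  show ?thesis using assms(2) unfolding linear_map_def by auto
qed

lemma restrict_in_mod_hom: "module R V \<Longrightarrow> linear_map R V W f \<Longrightarrow> restrict f (carrier V) \<in> mod_hom R V W"
  using linear_map_cong[of R V f "restrict f (carrier V)" W] by (simp add: mod_hom_iff)

lemma linear_map_id: "linear_map R V V (\<lambda>x. x)"
  unfolding linear_map_def by blast

lemma linear_map_comp:
  assumes "linear_map R U V f" "linear_map R V W g"
  shows "linear_map R U W (\<lambda>x. g (f x))"
  using linear_mapD[OF assms(1)] linear_mapD[OF assms(2)] by (intro linear_mapI) simp_all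

lemma linear_map_inv:
  assumes V: "module R V" and f: "linear_map R V W f" and b: "bij_betw f (carrier V) (carrier W)"
  shows "linear_map R W V (inv_into (carrier V) f)"
proof -
  interpret module R V by fact
  let ?g = "inv_into (carrier V) f"
  have g: "?g y \<in> carrier V" "f (?g y) = y" if "y \<in> carrier W" for y
    using that b by (auto simp: bij_betw_def inv_into_into f_inv_into_f)
  have gf: "?g (f x) = x" if "x \<in> carrier V" for x
    using b that by (simp add: bij_betw_inv_into_left)
  show ?thesis
  proof (rule linear_mapI)
    fix x y assume xy: "x \<in> carrier W" "y \<in> carrier W"
    have "f (?g x \<oplus>\<^bsub>V\<^esub> ?g y) = x \<oplus>\<^bsub>W\<^esub> y"
      using xy g linear_mapD(2)[OF f] by simp
    then show "?g (x \<oplus>\<^bsub>W\<^esub> y) = ?g x \<oplus>\<^bsub>V\<^esub> ?g y"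
      using gf[of "?g x \<oplus>\<^bsub>V\<^esub> ?g y"] xy g by simp
  next
    fix r x assume rx: "r \<in> carrier R" "x \<in> carrier W"
    have "f (r \<odot>\<^bsub>V\<^esub> ?g x) = r \<odot>\<^bsub>W\<^esub> x"
      using rx g linear_mapD(3)[OF f] by simp
    then show "?g (r \<odot>\<^bsub>W\<^esub> x) = r \<odot>\<^bsub>V\<^esub> ?g x"
      using gf[of "r \<odot>\<^bsub>V\<^esub> ?g x"] rx g by simp
  qed (rule g)
qed

lemma linear_map_zero:
  assumes "module R V" "module R W" "linear_map R V W f"
  shows "f \<zero>\<^bsub>V\<^esub> = \<zero>\<^bsub>W\<^esub>"
proof -
  interpret V: module R V by fact
  interpret W: module R W by fact
  show ?thesis
    using linear_mapD(3)[OF assms(3), of "\<zero>\<^bsub>R\<^esub>" "\<zero>\<^bsub>V\<^esub>"] linear_mapD(1)[OF assms(3), of "\<zero>\<^bsub>V\<^esub>"] by simp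
qed

lemma linear_map_finsum:
  assumes "module R V" "module R W" "linear_map R V W f" "finite A" "g \<in> A \<rightarrow> carrier V"
  shows "f (\<Oplus>\<^bsub>V\<^esub>a\<in>A. g a) = (\<Oplus>\<^bsub>W\<^esub>a\<in>A. f (g a))"
proof -
  interpret V: module R V by fact
  interpret W: module R W by fact
  show ?thesis using assms(4,5)
  proof (induction A)
    case empty
    then show ?case using linear_map_zero[OF assms(1-3)] by simp
  next
    case (insert a A)
    then have "(\<lambda>a. f (g a)) \<in> A \<rightarrow> carrier W" "f (g a) \<in> carrier W"
      using linear_mapD(1)[OF assms(3)] by auto
    with insert show ?case
      by (simp add: linear_mapD(2)[OF assms(3)] V.finsum_closed)
  qed
qed

text \<open>Phrased exactly like the combinations in \<open>finitely_generated\<close>, which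
  thereby becomes an inclusion of sets.\<close>

definition module_span ::
  "('r, 'x) ring_scheme \<Rightarrow> ('r, 'a, 'y) module_scheme \<Rightarrow> 'a set \<Rightarrow> 'a set" where
  "module_span R M S = {x. \<exists>c\<in>S \<rightarrow> carrier R. x = (\<Oplus>\<^bsub>M\<^esub>s\<in>S. c s \<odot>\<^bsub>M\<^esub> s)}"

lemma finitely_generated_iff:
  "finitely_generated R M \<longleftrightarrow> (\<exists>S. finite S \<and> S \<subseteq> carrier M \<and> carrier M \<subseteq> module_span R M S)"
  unfolding finitely_generated_def module_span_def by blast

context module begin

lemma module_span_closed:
  assumes "finite S" "S \<subseteq> carrier M"
  shows "module_span R M S \<subseteq> carrier M"
  using assms unfolding module_span_def by (auto intro!: finsum_closed smult_closed)

lemma module_span_add: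
  assumes "finite S" "S \<subseteq> carrier M" "x \<in> module_span R M S" "y \<in> module_span R M S"
  shows "x \<oplus>\<^bsub>M\<^esub> y \<in> module_span R M S"
proof -
  obtain c d where c: "c \<in> S \<rightarrow> carrier R" "x = (\<Oplus>\<^bsub>M\<^esub>s\<in>S. c s \<odot>\<^bsub>M\<^esub> s)"
    and d: "d \<in> S \<rightarrow> carrier R" "y = (\<Oplus>\<^bsub>M\<^esub>s\<in>S. d s \<odot>\<^bsub>M\<^esub> s)"
    using assms(3,4) unfolding module_span_def by blast
  have "x \<oplus>\<^bsub>M\<^esub> y = (\<Oplus>\<^bsub>M\<^esub>s\<in>S. c s \<odot>\<^bsub>M\<^esub> s \<oplus>\<^bsub>M\<^esub> d s \<odot>\<^bsub>M\<^esub> s)"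
    unfolding c(2) d(2) using c(1) d(1) assms(2) by (subst M.finsum_addf) (auto intro!: smult_closed)
  also have "\<dots> = (\<Oplus>\<^bsub>M\<^esub>s\<in>S. (c s \<oplus> d s) \<odot>\<^bsub>M\<^esub> s)"
    by (rule M.finsum_cong') (use c(1) d(1) assms(2) in \<open>auto simp: smult_l_distr Pi_iff subset_iff intro!: smult_closed\<close>)
  finally show ?thesis
    unfolding module_span_def using c(1) d(1) by (auto intro!: bexI[of _ "\<lambda>s. c s \<oplus> d s"])
qed

lemma module_span_smult:
  assumes "finite S" "S \<subseteq> carrier M" "x \<in> module_span R M S" "r \<in> carrier R"
  shows "r \<odot>\<^bsub>M\<^esub> x \<in> module_span R M S"
proof -
  obtain c where c: "c \<in> S \<rightarrow> carrier R" "x = (\<Oplus>\<^bsub>M\<^esub>s\<in>S. c s \<odot>\<^bsub>M\<^esub> s)"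
    using assms(3) unfolding module_span_def by blast
  have "r \<odot>\<^bsub>M\<^esub> x = (\<Oplus>\<^bsub>M\<^esub>s\<in>S. r \<odot>\<^bsub>M\<^esub> (c s \<odot>\<^bsub>M\<^esub> s))"
    unfolding c(2) using c(1) assms by (subst finsum_smult_ldistr) (auto intro!: smult_closed)
  also have "\<dots> = (\<Oplus>\<^bsub>M\<^esub>s\<in>S. (r \<otimes> c s) \<odot>\<^bsub>M\<^esub> s)"
    by (rule M.finsum_cong') (use c(1) assms in \<open>auto simp: smult_assoc1 Pi_iff subset_iff intro!: smult_closed\<close>)
  finally show ?thesis
    unfolding module_span_def using c(1) assms(4) by (auto intro!: bexI[of _ "\<lambda>s. r \<otimes> c s"])
qed

lemma module_span_zero:
  assumes "finite S" "S \<subseteq> carrier M"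
  shows "\<zero>\<^bsub>M\<^esub> \<in> module_span R M S"
proof -
  have "(\<Oplus>\<^bsub>M\<^esub>s\<in>S. \<zero> \<odot>\<^bsub>M\<^esub> s) = (\<Oplus>\<^bsub>M\<^esub>s\<in>S. \<zero>\<^bsub>M\<^esub>)"
    by (rule M.finsum_cong') (use assms in auto)
  then show ?thesis unfolding module_span_def by (auto intro!: bexI[of _ "\<lambda>s. \<zero>"])
qed

lemma module_span_incl:
  assumes "finite S" "S \<subseteq> carrier M" "s \<in> S"
  shows "s \<in> module_span R M S"
proof -
  have "(\<Oplus>\<^bsub>M\<^esub>t\<in>S. (if t = s then \<one> else \<zero>) \<odot>\<^bsub>M\<^esub> t) = (\<Oplus>\<^bsub>M\<^esub>t\<in>S. if s = t then t else \<zero>\<^bsub>M\<^esub>)"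
    by (rule M.finsum_cong') (use assms in auto)
  also have "\<dots> = s"
    by (rule M.finsum_singleton) (use assms in auto)
  finally show ?thesis
    unfolding module_span_def by (auto intro!: bexI[of _ "\<lambda>t. if t = s then \<one> else \<zero>"])
qed

lemma module_span_finsum:
  assumes "finite S" "S \<subseteq> carrier M" "finite A" "f \<in> A \<rightarrow> module_span R M S"
  shows "(\<Oplus>\<^bsub>M\<^esub>a\<in>A. f a) \<in> module_span R M S"
  using assms(3,4)
proof (induction A)
  case empty
  then show ?case using module_span_zero[OF assms(1,2)] by simp
next
  case (insert a A)
  then have "f \<in> A \<rightarrow> carrier M" "f a \<in> carrier M"
    using module_span_closed[OF assms(1,2)] by blast+
  with insert show ?case using module_span_add[OF assms(1,2)] by simp
qed

lemma module_span_induct [consumes 3, case_names zero gen add smult]: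
  assumes x: "x \<in> module_span R M S" and S: "finite S" "S \<subseteq> carrier M"
    and zero: "P \<zero>\<^bsub>M\<^esub>" and gen: "\<And>s. s \<in> S \<Longrightarrow> P s"
    and add: "\<And>x y. x \<in> carrier M \<Longrightarrow> y \<in> carrier M \<Longrightarrow> P x \<Longrightarrow> P y \<Longrightarrow> P (x \<oplus>\<^bsub>M\<^esub> y)"
    and smult: "\<And>r x. r \<in> carrier R \<Longrightarrow> x \<in> carrier M \<Longrightarrow> P x \<Longrightarrow> P (r \<odot>\<^bsub>M\<^esub> x)"
  shows "P x"
proof -
  obtain c where c: "c \<in> S \<rightarrow> carrier R" "x = (\<Oplus>\<^bsub>M\<^esub>s\<in>S. c s \<odot>\<^bsub>M\<^esub> s)"
    using x unfolding module_span_def by blast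
  \<comment> \<open>The induction runs over subsets \<open>A\<close> of \<open>S\<close> with the
    coefficient function \<open>c\<close> held fixed.\<close>
  have "P (\<Oplus>\<^bsub>M\<^esub>s\<in>A. c s \<odot>\<^bsub>M\<^esub> s)" if "finite A" "A \<subseteq> S" for A
    using that
  proof (induction A)
    case (insert a A)
    have cs: "c s \<in> carrier R" "s \<in> carrier M" if "s \<in> insert a A" for s
      using c(1) insert.prems S(2) that by blast+
    have cl: "c s \<odot>\<^bsub>M\<^esub> s \<in> carrier M" if "s \<in> insert a A" for s
      using cs[OF that] by simp
    have "(\<Oplus>\<^bsub>M\<^esub>s\<in>insert a A. c s \<odot>\<^bsub>M\<^esub> s) = c a \<odot>\<^bsub>M\<^esub> a \<oplus>\<^bsub>M\<^esub> (\<Oplus>\<^bsub>M\<^esub>s\<in>A. c s \<odot>\<^bsub>M\<^esub> s)"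
      by (rule M.finsum_insert) (use insert.hyps cl in auto)
    moreover have "(\<Oplus>\<^bsub>M\<^esub>s\<in>A. c s \<odot>\<^bsub>M\<^esub> s) \<in> carrier M"
      by (rule M.finsum_closed) (use cl in auto)
    moreover have "P (c a \<odot>\<^bsub>M\<^esub> a)" using smult[OF cs[of a]] gen[of a] insert.prems by simp
    moreover have "P (\<Oplus>\<^bsub>M\<^esub>s\<in>A. c s \<odot>\<^bsub>M\<^esub> s)" using insert by blast
    ultimately show ?case using add cl by simp
  qed (simp add: zero)
  then show ?thesis using c(2) S(1) by blast
qed

end

lemma linear_map_eqI:
  assumes V: "module R V" and W: "module R W" and f: "linear_map R V W f" and g: "linear_map R V W g"
    and S: "finite S" "S \<subseteq> carrier V" "carrier V \<subseteq> module_span R V S"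
    and eq: "\<And>s. s \<in> S \<Longrightarrow> f s = g s" and x: "x \<in> carrier V"
  shows "f x = g x"
proof -
  interpret V: module R V by fact
  interpret W: module R W by fact
  have "x \<in> module_span R V S" using x S(3) by blast
  then show ?thesis using S(1,2)
  proof (induction rule: V.module_span_induct)
    case zero
    show ?case using linear_map_zero[OF V W] f g by metis
  qed (use eq linear_mapD[OF f] linear_mapD[OF g] in simp_all)
qed

section \<open>Coordinates\<close>

abbreviation vecs :: "nat \<Rightarrow> ('k::field, 'k vec) module" where
  "vecs \<equiv> module_vec TYPE('k)"

lemma module_vecs: "module scalars (vecs n :: ('k::field, 'k vec) module)"
proof (intro module.intro cring_scalars abelian_groupI module_axioms.intro)
  fix v assume "v \<in> carrier (vecs n :: ('k, 'k vec) module)"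
  then show "\<exists>w\<in>carrier (vecs n). w \<oplus>\<^bsub>vecs n\<^esub> v = \<zero>\<^bsub>vecs n\<^esub>"
    by (intro bexI[of _ "- v"]) (auto simp: module_vec_simps)
qed (auto simp: module_vec_simps add_smult_distrib_vec smult_add_distrib_vec smult_smult_assoc
        comm_add_vec[of _ n] assoc_add_vec[of _ n])

lemma linear_map_mult_mat:
  "A \<in> carrier_mat m n \<Longrightarrow> linear_map scalars (vecs n) (vecs m) (\<lambda>v. A *\<^sub>v v)"
  by (intro linear_mapI) (auto simp: module_vec_simps mult_add_distrib_mat_vec mult_mat_vec)

definition matrix_of :: "nat \<Rightarrow> nat \<Rightarrow> ('k::field vec \<Rightarrow> 'k vec) \<Rightarrow> 'k mat" where
  "matrix_of m n f = mat m n (\<lambda>(i, j). f (Matrix.unit_vec n j) $ i)"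

lemma matrix_of_carrier [simp]: "matrix_of m n f \<in> carrier_mat m n"
  by (simp add: matrix_of_def)

lemma vecs_span: "carrier_vec n \<subseteq> module_span scalars (vecs n) (Matrix.unit_vec n ` {..<n})"
proof
  interpret module scalars "vecs n :: ('a, 'a vec) module" by (rule module_vecs)
  let ?S = "Matrix.unit_vec n ` {..<n} :: 'a vec set"
  have S: "finite ?S" "?S \<subseteq> carrier (vecs n)" by (auto simp: module_vec_simps)
  \<comment> \<open>Induction on \<open>k\<close>, a bound from which on all coordinates vanish;
    coordinate \<open>k\<close> is peeled off with \<open>Matrix.unit_vec n k\<close>.\<close>
  have *: "\<forall>i<n. k \<le> i \<longrightarrow> v $ i = 0 \<Longrightarrow> v \<in> carrier_vec n \<Longrightarrow> k \<le> n \<Longrightarrow> v \<in> module_span scalars (vecs n) ?S"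
    for k and v :: "'a vec"
  proof (induction k arbitrary: v)
    case 0
    then have "v = 0\<^sub>v n" by (intro eq_vecI) auto
    then show ?case using module_span_zero[OF S] by (simp add: module_vec_simps)
  next
    case (Suc k)
    let ?w = "v - v $ k \<cdot>\<^sub>v Matrix.unit_vec n k"
    have "?w \<in> module_span scalars (vecs n) ?S"
      by (rule Suc.IH) (use Suc.prems in \<open>auto simp: less_Suc_eq_le Suc_le_eq le_less\<close>)
    moreover have "v $ k \<cdot>\<^sub>v Matrix.unit_vec n k \<in> module_span scalars (vecs n) ?S"
      using module_span_smult[OF S module_span_incl[OF S, of "Matrix.unit_vec n k"], of "v $ k"] Suc.prems(3)
      by (simp add: module_vec_simps)
    ultimately have "?w + v $ k \<cdot>\<^sub>v Matrix.unit_vec n k \<in> module_span scalars (vecs n) ?S"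
      using module_span_add[OF S] by (simp add: module_vec_simps)
    moreover have "?w + v $ k \<cdot>\<^sub>v Matrix.unit_vec n k = v"
      using Suc.prems(2) by (intro eq_vecI) auto
    ultimately show ?case by simp
  qed
  fix v :: "'a vec" assume "v \<in> carrier_vec n"
  then show "v \<in> module_span scalars (vecs n) ?S"
    using *[of n v] by simp
qed

lemma unit_vecs_generate:
  "finite (Matrix.unit_vec n ` {..<n})" "Matrix.unit_vec n ` {..<n} \<subseteq> carrier (vecs n)"
  "carrier (vecs n) \<subseteq> module_span scalars (vecs n) (Matrix.unit_vec n ` {..<n})"
  by simp (auto simp: module_vec_simps vecs_span simp del: lessThan_iff)

text \<open>Two linear maps are compared on the unit vectors, which span and whose images are the
  columns.\<close>

lemma matrix_of:
  assumes f: "linear_map scalars (vecs n) (vecs m) f" and v: "v \<in> carrier_vec n"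
  shows "matrix_of m n f *\<^sub>v v = f v"
proof (rule linear_map_eqI[OF module_vecs module_vecs linear_map_mult_mat[OF matrix_of_carrier] f unit_vecs_generate])
  show "v \<in> carrier (vecs n)" using v by (simp add: module_vec_simps)
  fix s :: "'a vec" assume "s \<in> Matrix.unit_vec n ` {..<n}"
  then obtain j where j: "j < n" "s = Matrix.unit_vec n j" by auto
  have "f s \<in> carrier_vec m"
    using linear_mapD(1)[OF f, of s] by (simp add: module_vec_simps j(2))
  then show "matrix_of m n f *\<^sub>v s = f s"
    using j by (intro eq_vecI) (simp_all add: matrix_of_def)
qed

text \<open>The unit vectors already detect all columns. Structure maps will be known through their
  values, so matrix identities are proved by letting both sides act.\<close>

lemma mat_eqI_mult_vec:
  assumes "A \<in> carrier_mat m n" "B \<in> carrier_mat m n" "\<And>v. v \<in> carrier_vec n \<Longrightarrow> A *\<^sub>v v = B *\<^sub>v v"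
  shows "A = (B :: 'k::field mat)"
proof (rule eq_matI)
  fix i j assume ij: "i < dim_row B" "j < dim_col B"
  then have "(A *\<^sub>v Matrix.unit_vec n j) $ i = (B *\<^sub>v Matrix.unit_vec n j) $ i"
    using assms by simp
  then show "A $$ (i, j) = B $$ (i, j)"
    using ij assms(1,2) by simp
qed (use assms in auto)

text \<open>A basis, recorded as the isomorphism from coordinate space that it determines; in this
  form it composes directly with other linear maps, also in dimension 0.\<close>

definition is_coords :: "nat \<Rightarrow> ('k::field vec \<Rightarrow> 'a) \<Rightarrow> ('k, 'a, 'z) module_scheme \<Rightarrow> bool" where
  "is_coords n b V \<longleftrightarrow> linear_map scalars (vecs n) V b \<and> bij_betw b (carrier_vec n) (carrier V)"

text \<open>A generating set of least cardinality is a basis: a nontrivial relation among its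
  members would allow one of them to be discarded.\<close>

lemma coords_exist:
  fixes V :: "('k::field, 'a, 'z) module_scheme"
  assumes V: "module scalars V" and fg: "finitely_generated scalars V"
  shows "\<exists>n b. is_coords n b V"
proof -
  interpret V: module scalars V by fact
  define gens where "gens S \<longleftrightarrow> finite S \<and> S \<subseteq> carrier V \<and> carrier V \<subseteq> module_span scalars V S" for S
  obtain S0 where "gens S0" using fg unfolding finitely_generated_iff gens_def by blast
  \<comment> \<open>Minimality stands in for linear independence and is what makes \<open>b\<close>
    injective.\<close>
  then obtain S where S: "gens S" and min: "\<And>T. gens T \<Longrightarrow> card S \<le> card T"
    using ex_has_least_nat[of gens S0 card] by blast
  have gen: "finite S" "S \<subseteq> carrier V" "carrier V \<subseteq> module_span scalars V S"
    using S unfolding gens_def by auto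
  obtain h where h: "bij_betw h {..<card S} S"
    using ex_bij_betw_nat_finite[OF gen(1)] by (auto simp: atLeast0LessThan)
  define n where "n = card S"
  define b where "b v = (\<Oplus>\<^bsub>V\<^esub>i\<in>{..<n}. (v $ i) \<odot>\<^bsub>V\<^esub> h i)" for v :: "'k vec"
  have hV: "h i \<in> carrier V" if "i < n" for i
    using that h gen unfolding n_def bij_betw_def by auto
  have lin: "linear_map scalars (vecs n) V b"
  proof (rule linear_mapI)
    fix v w :: "'k vec" assume "v \<in> carrier (vecs n)" "w \<in> carrier (vecs n)"
    then have vw: "v \<in> carrier_vec n" "w \<in> carrier_vec n" by (simp_all add: module_vec_simps)
    have "b (v + w) = (\<Oplus>\<^bsub>V\<^esub>i\<in>{..<n}. (v $ i) \<odot>\<^bsub>V\<^esub> h i \<oplus>\<^bsub>V\<^esub> (w $ i) \<odot>\<^bsub>V\<^esub> h i)"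
      unfolding b_def by (rule V.finsum_cong') (use vw hV V.smult_l_distr[of "v $ _" "w $ _"] in auto)
    also have "\<dots> = b v \<oplus>\<^bsub>V\<^esub> b w"
      unfolding b_def by (rule V.finsum_addf) (use hV in auto)
    finally show "b (v \<oplus>\<^bsub>vecs n\<^esub> w) = b v \<oplus>\<^bsub>V\<^esub> b w" by (simp add: module_vec_simps)
  next
    fix r and v :: "'k vec" assume "v \<in> carrier (vecs n)"
    then have v: "v \<in> carrier_vec n" by (simp add: module_vec_simps)
    have "b (r \<cdot>\<^sub>v v) = (\<Oplus>\<^bsub>V\<^esub>i\<in>{..<n}. r \<odot>\<^bsub>V\<^esub> ((v $ i) \<odot>\<^bsub>V\<^esub> h i))"
      unfolding b_def by (rule V.finsum_cong') (use v hV V.smult_assoc1[of r "v $ _"] in auto)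
    also have "\<dots> = r \<odot>\<^bsub>V\<^esub> b v"
      unfolding b_def by (rule V.finsum_smult_ldistr[symmetric]) (use hV in auto)
    finally show "b (r \<odot>\<^bsub>vecs n\<^esub> v) = r \<odot>\<^bsub>V\<^esub> b v" by (simp add: module_vec_simps)
  qed (auto simp: b_def hV intro!: V.finsum_closed)
  have surj: "x \<in> b ` carrier_vec n" if x: "x \<in> carrier V" for x
  proof -
    obtain c where c: "x = (\<Oplus>\<^bsub>V\<^esub>s\<in>S. c s \<odot>\<^bsub>V\<^esub> s)"
      using gen x unfolding module_span_def by blast
    have "x = (\<Oplus>\<^bsub>V\<^esub>i\<in>{..<n}. c (h i) \<odot>\<^bsub>V\<^esub> h i)"
      unfolding c using h gen
      by (subst V.finsum_reindex[symmetric]) (auto simp: bij_betw_def n_def)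
    also have "\<dots> = b (vec n (\<lambda>i. c (h i)))"
      unfolding b_def by (rule V.finsum_cong') (auto simp: hV)
    finally show ?thesis by auto
  qed
  have ker: "v = 0\<^sub>v n" if v: "v \<in> carrier_vec n" and bv: "b v = \<zero>\<^bsub>V\<^esub>" for v
  proof (rule ccontr)
    assume "v \<noteq> 0\<^sub>v n"
    then obtain k where k: "k < n" "v $ k \<noteq> 0"
      using v by (metis carrier_vecD eq_vecI index_zero_vec)
    let ?T = "h ` ({..<n} - {k})"
    have T: "finite ?T" "?T \<subseteq> carrier V" using hV by auto
    have "carrier V \<subseteq> module_span scalars V ?T"
    proof
      fix x assume "x \<in> carrier V"
      then obtain w where w: "w \<in> carrier_vec n" "x = b w" using surj by auto
      \<comment> \<open>Since \<open>b v\<close> is zero, adding multiples of \<open>v\<close> does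
        not change \<open>b w\<close>. This multiple clears coordinate \<open>k\<close>, so the
        generator \<open>h k\<close> drops out of the sum.\<close>
      let ?w = "w + (- (w $ k / v $ k)) \<cdot>\<^sub>v v"
      have "b ?w = x"
        using linear_mapD(2)[OF lin, of w "(- (w $ k / v $ k)) \<cdot>\<^sub>v v"]
          linear_mapD(3)[OF lin, of "- (w $ k / v $ k)" v] v w bv \<open>x \<in> carrier V\<close>
        by (simp add: module_vec_simps)
      moreover have "b ?w \<in> module_span scalars V ?T"
        unfolding b_def
      proof (rule V.module_span_finsum[OF T], simp, intro funcsetI)
        fix i assume i: "i \<in> {..<n}"
        show "?w $ i \<odot>\<^bsub>V\<^esub> h i \<in> module_span scalars V ?T"
        proof (cases "i = k")
          case True
          then have "?w $ i = 0" using k v w by simp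
          then show ?thesis using V.module_span_zero[OF T] i hV V.smult_l_null by simp
        next
          case False
          then show ?thesis using i by (intro V.module_span_smult[OF T V.module_span_incl[OF T]]) auto
        qed
      qed
      ultimately show "x \<in> module_span scalars V ?T" by simp
    qed
    then have "card S \<le> card ?T" using T by (intro min) (simp add: gens_def)
    also have "\<dots> \<le> card ({..<n} - {k})" by (rule card_image_le) simp
    also have "\<dots> < n" using k by simp
    finally show False by (simp add: n_def)
  qed
  have "inj_on b (carrier_vec n)"
  proof (rule inj_onI)
    fix v w assume vw: "v \<in> carrier_vec n" "w \<in> carrier_vec n" "b v = b w"
    have bc: "b u \<in> carrier V" if "u \<in> carrier_vec n" for u
      using linear_mapD(1)[OF lin] that by (simp add: module_vec_simps)
    have "b (v + (-1) \<cdot>\<^sub>v w) = b w \<oplus>\<^bsub>V\<^esub> (-1) \<odot>\<^bsub>V\<^esub> b w"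
      using linear_mapD(2)[OF lin, of v "(-1) \<cdot>\<^sub>v w"] linear_mapD(3)[OF lin, of "-1" w] vw
      by (simp add: module_vec_simps)
    also have "\<dots> = (1 + (-1)) \<odot>\<^bsub>V\<^esub> b w"
      using V.smult_l_distr[of 1 "-1" "b w"] V.smult_one[of "b w"] bc vw by simp
    also have "\<dots> = \<zero>\<^bsub>V\<^esub>" using V.smult_l_null[of "b w"] bc vw by simp
    finally have "v + (-1) \<cdot>\<^sub>v w = 0\<^sub>v n" using ker vw by simp
    then show "v = w" using vw by (auto simp: vec_eq_iff)
  qed
  then have "is_coords n b V"
    using lin surj linear_mapD(1)[OF lin] unfolding is_coords_def bij_betw_def
    by (auto simp: module_vec_simps)
  then show ?thesis by blast
qed

section \<open>Representations of the poset by matrices\<close>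

type_synonym ('p, 'k) rep = "('p \<Rightarrow> nat) \<times> ('p \<Rightarrow> 'p \<Rightarrow> 'k mat)"

text \<open>A functor from the poset to coordinate spaces, with \<open>snd V t s\<close> leading
  from \<open>t\<close> up to \<open>s\<close>. Reflexive pairs are included, so that composites
  with \<open>r = t\<close> or \<open>t = s\<close> obey the same law; sheaves, in contrast, have
  restrictions only for \<open>t < s\<close>.\<close>

definition is_rep :: "('p::order, 'k::field) rep \<Rightarrow> bool" where
  "is_rep V \<longleftrightarrow>
    (\<forall>t s. t \<le> s \<longrightarrow> snd V t s \<in> carrier_mat (fst V s) (fst V t)) \<and>
    (\<forall>s. snd V s s = 1\<^sub>m (fst V s)) \<and>
    (\<forall>r t s. r \<le> t \<longrightarrow> t \<le> s \<longrightarrow> snd V t s * snd V r t = snd V r s)"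

definition rep_hom :: "('p::order, 'k::field) rep \<Rightarrow> ('p, 'k) rep \<Rightarrow> ('p \<Rightarrow> 'k mat) set" where
  "rep_hom V W = {\<phi>. (\<forall>s. \<phi> s \<in> carrier_mat (fst W s) (fst V s)) \<and>
    (\<forall>t s. t \<le> s \<longrightarrow> \<phi> s * snd V t s = snd W t s * \<phi> t)}"

definition Rep :: "(('p::order, 'k::field) rep, 'p \<Rightarrow> 'k mat) cat" where
  "Rep = \<lparr>Ob = {V. is_rep V}, Hom = rep_hom, Id = (\<lambda>V s. 1\<^sub>m (fst V s)),
          Comp = (\<lambda>U V W g f s. g s * f s)\<rparr>"

lemma is_repD:
  assumes "is_rep V"
  shows "t \<le> s \<Longrightarrow> snd V t s \<in> carrier_mat (fst V s) (fst V t)"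
    and "snd V s s = 1\<^sub>m (fst V s)"
    and "r \<le> t \<Longrightarrow> t \<le> s \<Longrightarrow> snd V t s * snd V r t = snd V r s"
  using assms unfolding is_rep_def by blast+

lemma rep_homD:
  assumes "\<phi> \<in> rep_hom V W"
  shows "\<phi> s \<in> carrier_mat (fst W s) (fst V s)"
    and "t \<le> s \<Longrightarrow> \<phi> s * snd V t s = snd W t s * \<phi> t"
  using assms unfolding rep_hom_def by blast+

lemma category_Rep: "category (Rep :: (('p::order, 'k::field) rep, 'p \<Rightarrow> 'k mat) cat)"
proof -
  have id: "(\<lambda>s. 1\<^sub>m (fst V s)) \<in> rep_hom V V" if "is_rep V" for V :: "('p, 'k) rep"
    using is_repD(1)[OF that] unfolding rep_hom_def by (auto intro!: trans[OF left_mult_one_mat right_mult_one_mat[symmetric]])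
  have comp: "(\<lambda>s. g s * f s) \<in> rep_hom U W"
    if V: "is_rep U" "is_rep V" "is_rep W" and fg: "f \<in> rep_hom U V" "g \<in> rep_hom V W"
    for U V W :: "('p, 'k) rep" and f g
    unfolding rep_hom_def
  proof (intro CollectI conjI allI impI)
    fix s show "g s * f s \<in> carrier_mat (fst W s) (fst U s)"
      using rep_homD(1)[OF fg(1)] rep_homD(1)[OF fg(2)] by (rule mult_carrier_mat[rotated])
  next
    fix t s :: 'p assume ts: "t \<le> s"
    note car = rep_homD(1)[OF fg(1)] rep_homD(1)[OF fg(2)] is_repD(1)[OF V(1) ts]
      is_repD(1)[OF V(2) ts] is_repD(1)[OF V(3) ts]
    have "g s * f s * snd U t s = g s * (snd V t s * f t)"
      unfolding rep_homD(2)[OF fg(1) ts, symmetric] by (rule assoc_mult_mat[OF car(2,1,3)])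
    also have "\<dots> = (g s * snd V t s) * f t"
      by (rule assoc_mult_mat[OF car(2,4,1), symmetric])
    also have "\<dots> = snd W t s * (g t * f t)"
      unfolding rep_homD(2)[OF fg(2) ts] by (rule assoc_mult_mat[OF car(5,2,1)])
    finally show "g s * f s * snd U t s = snd W t s * (g t * f t)" .
  qed
  show ?thesis
    unfolding category_def
  proof (intro conjI ballI)
    fix U V W Y :: "('p, 'k) rep" and f g h
    assume "f \<in> Hom Rep U V" "g \<in> Hom Rep V W" "h \<in> Hom Rep W Y"
    then have car: "f s \<in> carrier_mat (fst V s) (fst U s)" "g s \<in> carrier_mat (fst W s) (fst V s)"
      "h s \<in> carrier_mat (fst Y s) (fst W s)" for s
      by (auto simp: Rep_def dest: rep_homD(1))
    show "Comp Rep U W Y h (Comp Rep U V W g f) = Comp Rep U V Y (Comp Rep V W Y h g) f"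
      using assoc_mult_mat[OF car(3) car(2) car(1)] by (simp add: Rep_def)
  next
    fix V W :: "('p, 'k) rep" and f assume "f \<in> Hom Rep V W"
    then have car: "f s \<in> carrier_mat (fst W s) (fst V s)" for s by (auto simp: Rep_def dest: rep_homD(1))
    show "Comp Rep V V W f (Id Rep V) = f" "Comp Rep V W W (Id Rep W) f = f"
      using left_mult_one_mat[OF car] right_mult_one_mat[OF car] by (simp_all add: Rep_def)
  qed (use id comp in \<open>auto simp: Rep_def\<close>)
qed

section \<open>Sheaves and the duality functor\<close>

lemma is_sheafD:
  assumes "is_sheaf F"
  shows "module scalars (stalk F s)" "finitely_generated scalars (stalk F s)"
    "t < s \<Longrightarrow> res F s t \<in> mod_hom scalars (stalk F s) (stalk F t)"
    "t < s \<Longrightarrow> r < t \<Longrightarrow> x \<in> carrier (stalk F s) \<Longrightarrow> res F t r (res F s t x) = res F s r x"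
  using assms unfolding is_sheaf_def by blast+

lemma sheaf_homD:
  assumes "\<phi> \<in> sheaf_hom F G"
  shows "\<phi> s \<in> mod_hom scalars (stalk F s) (stalk G s)"
    "t < s \<Longrightarrow> x \<in> carrier (stalk F s) \<Longrightarrow> \<phi> t (res F s t x) = res G s t (\<phi> s x)"
  using assms unfolding sheaf_hom_def by blast+

lemma mod_hom_compose:
  assumes "module R U" "f \<in> mod_hom R U V" "g \<in> mod_hom R V W"
  shows "compose (carrier U) g f \<in> mod_hom R U W"
  using restrict_in_mod_hom[OF assms(1), of W "\<lambda>x. g (f x)"] linear_map_comp[of R U V f W g] assms(2,3)
  by (simp add: mod_hom_iff compose_def)

lemma mod_hom_id: "module R U \<Longrightarrow> (\<lambda>x\<in>carrier U. x) \<in> mod_hom R U U"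
  by (rule restrict_in_mod_hom) (simp_all add: linear_map_id)

lemma mod_homD: "f \<in> mod_hom R U V \<Longrightarrow> x \<in> carrier U \<Longrightarrow> f x \<in> carrier V"
  "f \<in> mod_hom R U V \<Longrightarrow> f \<in> extensional (carrier U)"
  by (auto simp: mod_hom_iff linear_map_def)

lemma compose_unit:
  assumes "f \<in> extensional A" "\<And>x. x \<in> A \<Longrightarrow> f x \<in> B"
  shows "compose A f (\<lambda>x\<in>A. x) = f" "compose A (\<lambda>x\<in>B. x) f = f"
  using assms by (auto simp: compose_def extensional_def fun_eq_iff)

lemma compose_assoc':
  "(\<And>x. x \<in> A \<Longrightarrow> f x \<in> B) \<Longrightarrow> compose A h (compose A g f) = compose A (compose B h g) f"
  by (auto simp: compose_def fun_eq_iff)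

lemma category_Sh: "category (Sh :: (('p::{finite,order_bot}, 'k::field, 'v) sheaf, 'p \<Rightarrow> 'v \<Rightarrow> 'v) cat)"
proof -
  have id: "(\<lambda>s. \<lambda>x\<in>carrier (stalk F s). x) \<in> sheaf_hom F F" if "is_sheaf F" for F :: "('p, 'k, 'v) sheaf"
    using is_sheafD(1,3)[OF that] unfolding sheaf_hom_def
    by (auto intro: mod_hom_id dest: mod_homD(1))
  have comp: "(\<lambda>s. compose (carrier (stalk F s)) (g s) (f s)) \<in> sheaf_hom F H"
    if F: "is_sheaf F" and f: "f \<in> sheaf_hom F G" and g: "g \<in> sheaf_hom G H"
    for F G H :: "('p, 'k, 'v) sheaf" and f g
    using mod_hom_compose[OF is_sheafD(1)[OF F] sheaf_homD(1)[OF f] sheaf_homD(1)[OF g]]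
      sheaf_homD(2)[OF f] sheaf_homD(2)[OF g] mod_homD(1)[OF sheaf_homD(1)[OF f]]
      mod_homD(1)[OF is_sheafD(3)[OF F]]
    by (simp add: sheaf_hom_def compose_def)
  have ff: "x \<in> carrier (stalk F s) \<Longrightarrow> f s x \<in> carrier (stalk G s)" "f s \<in> extensional (carrier (stalk F s))"
    if "f \<in> sheaf_hom F G" for F G :: "('p, 'k, 'v) sheaf" and f s x
    using mod_homD[OF sheaf_homD(1)[OF that]] by auto
  show ?thesis
    unfolding category_def
  proof (intro conjI ballI)
    fix F G H K :: "('p, 'k, 'v) sheaf" and f g h assume "f \<in> Hom Sh F G"
    then have "f \<in> sheaf_hom F G" by (simp add: Sh_def)
    then show "Comp Sh F H K h (Comp Sh F G H g f) = Comp Sh F G K (Comp Sh G H K h g) f"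
      unfolding Sh_def by simp (rule ext, rule compose_assoc', rule ff(1))
  next
    fix F G :: "('p, 'k, 'v) sheaf" and f assume "f \<in> Hom Sh F G"
    then have f: "f \<in> sheaf_hom F G" by (simp add: Sh_def)
    show "Comp Sh F F G f (Id Sh F) = f" "Comp Sh F G G (Id Sh G) f = f"
      using compose_unit[OF ff(2)[OF f] ff(1)[OF f]] by (simp_all add: Sh_def)
  qed (use id comp in \<open>auto simp: Sh_def\<close>)
qed

section \<open>Coordinate spaces in the element type of sheaves, and transposition\<close>

definition embedded_vecs :: "('k::field vec \<Rightarrow> 'v) \<Rightarrow> nat \<Rightarrow> ('k, 'v) module" where
  "embedded_vecs e n = \<lparr>carrier = e ` carrier_vec n, monoid.mult = undefined, one = undefined,
     zero = e (0\<^sub>v n), add = (\<lambda>x y. e (inv_into UNIV e x + inv_into UNIV e y)), module.smult = (\<lambda>r x. e (r \<cdot>\<^sub>v inv_into UNIV e x))\<rparr>"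

lemma embedded_vecs_simps [simp]:
  "carrier (embedded_vecs e n) = e ` carrier_vec n" "\<zero>\<^bsub>embedded_vecs e n\<^esub> = e (0\<^sub>v n)"
  "inj e \<Longrightarrow> e v \<oplus>\<^bsub>embedded_vecs e n\<^esub> e w = e (v + w)"
  "inj e \<Longrightarrow> r \<odot>\<^bsub>embedded_vecs e n\<^esub> e v = e (r \<cdot>\<^sub>v v)"
  by (simp_all add: embedded_vecs_def)

lemma module_embedded_vecs:
  assumes e: "inj e" shows "module scalars (embedded_vecs e n :: ('k::field, 'v) module)"
proof (intro module.intro cring_scalars abelian_groupI module_axioms.intro)
  fix v assume "v \<in> carrier (embedded_vecs e n)"
  then obtain w where "w \<in> carrier_vec n" "v = e w" by auto
  then show "\<exists>w\<in>carrier (embedded_vecs e n). w \<oplus>\<^bsub>embedded_vecs e n\<^esub> v = \<zero>\<^bsub>embedded_vecs e n\<^esub>"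
    using e by (intro bexI[of _ "e (- w)"]) auto
next
  fix x y z assume "x \<in> carrier (embedded_vecs e n)" "y \<in> carrier (embedded_vecs e n)" "z \<in> carrier (embedded_vecs e n)"
  then show "x \<oplus>\<^bsub>embedded_vecs e n\<^esub> y \<oplus>\<^bsub>embedded_vecs e n\<^esub> z =
      x \<oplus>\<^bsub>embedded_vecs e n\<^esub> (y \<oplus>\<^bsub>embedded_vecs e n\<^esub> z)"
    using e by (auto simp: assoc_add_vec[of _ n])
qed (use e in \<open>auto simp: add_smult_distrib_vec smult_add_distrib_vec smult_smult_assoc
        comm_add_vec[of _ n]\<close>)

lemma coords_embedded_vecs: "inj e \<Longrightarrow> is_coords n e (embedded_vecs e n)"
  unfolding is_coords_def
  by (auto intro!: linear_mapI simp: module_vec_simps bij_betw_def inj_on_def inj_def)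

lemma coords_imp_finitely_generated:
  assumes V: "module scalars V" and b: "is_coords n b V"
  shows "finitely_generated scalars V"
proof -
  interpret V: module scalars V by fact
  have lin: "linear_map scalars (vecs n) V b" and bij: "bij_betw b (carrier_vec n) (carrier V)"
    using b unfolding is_coords_def by auto
  let ?U = "Matrix.unit_vec n ` {..<n} :: 'a vec set"
  have bU: "b ` ?U \<subseteq> carrier V" using linear_mapD(1)[OF lin] by (auto simp: module_vec_simps)
  have "b v \<in> module_span scalars V (b ` ?U)" if "v \<in> carrier (vecs n)" for v
  proof -
    interpret C: module scalars "vecs n :: ('a, 'a vec) module" by (rule module_vecs)
    have "v \<in> module_span scalars (vecs n) ?U" using unit_vecs_generate(3) that by blast
    then show ?thesis using unit_vecs_generate(1,2)
    proof (induction rule: C.module_span_induct)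
      case zero
      then show ?case
        using linear_map_zero[OF module_vecs V lin] V.module_span_zero[OF _ bU] by simp
    next
      case (gen v)
      then show ?case by (intro V.module_span_incl bU) auto
    next
      case (add v w)
      then show ?case using linear_mapD(2)[OF lin] V.module_span_add[OF _ bU] by simp
    next
      case (smult r v)
      then show ?case using linear_mapD(3)[OF lin] V.module_span_smult[OF _ bU] by simp
    qed
  qed
  then have "carrier V \<subseteq> module_span scalars V (b ` ?U)"
    unfolding bij_betw_imp_surj_on[OF bij, symmetric] by (auto simp: module_vec_simps)
  then show ?thesis unfolding finitely_generated_iff using bU by (intro exI[of _ "b ` ?U"]) simp
qed

text \<open>The dual map in dual coordinates. The domain is read off from \<open>dim_row M\<close>,
  which makes the map extensional without extra dimension arguments.\<close>

definition transpose_map :: "('k::field vec \<Rightarrow> 'v) \<Rightarrow> 'k mat \<Rightarrow> 'v \<Rightarrow> 'v" where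
  "transpose_map e M = (\<lambda>x \<in> e ` carrier_vec (dim_row M). e (transpose_mat M *\<^sub>v inv_into UNIV e x))"

lemma transpose_map_apply [simp]:
  "inj e \<Longrightarrow> M \<in> carrier_mat m n \<Longrightarrow> v \<in> carrier_vec m \<Longrightarrow> transpose_map e M (e v) = e (transpose_mat M *\<^sub>v v)"
  unfolding transpose_map_def by simp

text \<open>Linear maps of coordinate spaces are matrices, and transposition is an involution. Full
  faithfulness of the duality functor is this bijection at every element of the poset.\<close>

lemma transpose_map_bij:
  fixes e :: "'k::field vec \<Rightarrow> 'v"
  assumes e: "inj e"
  shows "bij_betw (transpose_map e) (carrier_mat m n) (mod_hom scalars (embedded_vecs e m) (embedded_vecs e n))"
  unfolding bij_betw_def
proof (intro conjI inj_onI subset_antisym subsetI)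
  fix M N :: "'k mat" assume MN: "M \<in> carrier_mat m n" "N \<in> carrier_mat m n" "transpose_map e M = transpose_map e N"
  have "transpose_mat M *\<^sub>v v = transpose_mat N *\<^sub>v v" if "v \<in> carrier_vec m" for v
    using fun_cong[OF MN(3), of "e v"] MN(1,2) that e by (simp add: inj_eq)
  then have "transpose_mat M = transpose_mat N"
    using MN by (intro mat_eqI_mult_vec[of _ n m]) auto
  then show "M = N" by (metis transpose_transpose)
next
  fix f assume "f \<in> transpose_map e ` carrier_mat m n"
  then obtain M where M: "M \<in> carrier_mat m n" "f = transpose_map e M" by auto
  have "linear_map scalars (embedded_vecs e m) (embedded_vecs e n) f"
    unfolding M(2) using e M(1)
    by (intro linear_mapI)
       (auto simp: mult_add_distrib_mat_vec[of _ n m] mult_mat_vec[of _ n m] simp del: embedded_vecs_simps(3,4)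
         simp: embedded_vecs_def)
  then show "f \<in> mod_hom scalars (embedded_vecs e m) (embedded_vecs e n)"
    using M by (auto simp: mod_hom_iff transpose_map_def)
next
  fix f assume f: "f \<in> mod_hom scalars (embedded_vecs e m) (embedded_vecs e n)"
  have lin: "linear_map scalars (embedded_vecs e m) (embedded_vecs e n) f"
    using f by (simp add: mod_hom_iff)
  have ei: "e (inv_into UNIV e (f (e v))) = f (e v)" "inv_into UNIV e (f (e v)) \<in> carrier_vec n" if "v \<in> carrier_vec m" for v
    using linear_mapD(1)[OF lin, of "e v"] that e by auto
  \<comment> \<open>Conjugating \<open>f\<close> by \<open>e\<close> gives a map of genuine vectors,
    to which \<open>matrix_of\<close> applies.\<close>
  have lin': "linear_map scalars (vecs m) (vecs n) (\<lambda>v. inv_into UNIV e (f (e v)))"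
  proof (rule linear_mapI)
    fix v w :: "'k vec" assume "v \<in> carrier (vecs m)" "w \<in> carrier (vecs m)"
    then have vw: "v \<in> carrier_vec m" "w \<in> carrier_vec m" by (auto simp: module_vec_simps)
    have "f (e (v + w)) = e (inv_into UNIV e (f (e v)) + inv_into UNIV e (f (e w)))"
      using linear_mapD(2)[OF lin, of "e v" "e w"] vw e by (simp add: embedded_vecs_def)
    then show "inv_into UNIV e (f (e (v \<oplus>\<^bsub>vecs m\<^esub> w))) = inv_into UNIV e (f (e v)) \<oplus>\<^bsub>vecs n\<^esub> inv_into UNIV e (f (e w))"
      using e by (simp add: module_vec_simps)
  next
    fix r and v :: "'k vec" assume "v \<in> carrier (vecs m)"
    then have v: "v \<in> carrier_vec m" by (auto simp: module_vec_simps)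
    have "f (e (r \<cdot>\<^sub>v v)) = e (r \<cdot>\<^sub>v inv_into UNIV e (f (e v)))"
      using linear_mapD(3)[OF lin, of r "e v"] v e by (simp add: embedded_vecs_def)
    then show "inv_into UNIV e (f (e (r \<odot>\<^bsub>vecs m\<^esub> v))) = r \<odot>\<^bsub>vecs n\<^esub> inv_into UNIV e (f (e v))"
      using e by (simp add: module_vec_simps)
  qed (use ei in \<open>auto simp: module_vec_simps\<close>)
  let ?M = "transpose_mat (matrix_of n m (\<lambda>v. inv_into UNIV e (f (e v))))"
  have M: "?M \<in> carrier_mat m n" by simp
  have "f = transpose_map e ?M"
  proof (rule extensionalityI[of f "e ` carrier_vec m"])
    show "f \<in> extensional (e ` carrier_vec m)" using f by (simp add: mod_hom_iff)
    show "transpose_map e ?M \<in> extensional (e ` carrier_vec m)"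
      unfolding transpose_map_def carrier_matD(1)[OF M] by (rule restrict_extensional)
    fix x assume "x \<in> e ` carrier_vec m"
    then obtain v where v: "v \<in> carrier_vec m" "x = e v" by auto
    then show "f x = transpose_map e ?M x"
      using transpose_map_apply[OF e M v(1)] matrix_of[OF lin' v(1)] ei(1)[OF v(1)] by simp
  qed
  then show "f \<in> transpose_map e ` carrier_mat m n" using M by blast
qed

lemma transpose_map_one:
  "inj e \<Longrightarrow> transpose_map e (1\<^sub>m n) = (\<lambda>x\<in>carrier (embedded_vecs e n). x)"
  by (auto simp: transpose_map_def fun_eq_iff)

text \<open>The reversal of the factors is the reason why the functor lands in
  \<open>opposite Sh\<close>.\<close>

lemma transpose_map_mult:
  assumes "inj e" "M \<in> carrier_mat m k" "N \<in> carrier_mat k n"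
  shows "transpose_map e (M * N) = compose (carrier (embedded_vecs e m)) (transpose_map e N) (transpose_map e M)"
  using assms
  by (auto simp: transpose_map_def fun_eq_iff compose_def transpose_mult[of M m k N n])

text \<open>Stalkwise linear dual: a structure map from \<open>t\<close> up to \<open>s\<close>
  dualises to a restriction from \<open>s\<close> down to \<open>t\<close>.\<close>

definition dual_sheaf :: "('k::field vec \<Rightarrow> 'v) \<Rightarrow> ('p::{finite,order_bot}, 'k) rep \<Rightarrow> ('p, 'k, 'v) sheaf" where
  "dual_sheaf e V = \<lparr>stalk = (\<lambda>s. embedded_vecs e (fst V s)), res = (\<lambda>s t. transpose_map e (snd V t s))\<rparr>"

lemma dual_sheaf_simps [simp]:
  "stalk (dual_sheaf e V) s = embedded_vecs e (fst V s)"
  "res (dual_sheaf e V) s t = transpose_map e (snd V t s)"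
  by (simp_all add: dual_sheaf_def)

lemma is_sheaf_dual_sheaf:
  fixes V :: "('p::{finite,order_bot}, 'k::field) rep" and e :: "'k vec \<Rightarrow> 'v"
  assumes e: "inj e" and V: "is_rep V"
  shows "is_sheaf (dual_sheaf e V)"
  unfolding is_sheaf_def
proof (intro conjI allI impI ballI)
  fix s t :: 'p assume "t < s"
  then show "res (dual_sheaf e V) s t \<in> mod_hom scalars (stalk (dual_sheaf e V) s) (stalk (dual_sheaf e V) t)"
    using bij_betwE[OF transpose_map_bij[OF e]] is_repD(1)[OF V, of t s] by simp
next
  fix s t r :: 'p and x assume st: "t < s" "r < t" and x: "x \<in> carrier (stalk (dual_sheaf e V) s)"
  have "transpose_map e (snd V r s) = compose (carrier (embedded_vecs e (fst V s))) (transpose_map e (snd V r t)) (transpose_map e (snd V t s))"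
    using transpose_map_mult[OF e is_repD(1)[OF V] is_repD(1)[OF V], of t s r] is_repD(3)[OF V, of r t s] st by simp
  then show "res (dual_sheaf e V) t r (res (dual_sheaf e V) s t x) = res (dual_sheaf e V) s r x"
    using x by (simp add: compose_def)
qed (use module_embedded_vecs[OF e] coords_imp_finitely_generated[OF module_embedded_vecs[OF e] coords_embedded_vecs[OF e]] in simp_all)

lemma Sh_simps [simp]:
  "Ob Sh = {F. is_sheaf F}" "Hom Sh = sheaf_hom" "Id Sh F = (\<lambda>\<sigma>. \<lambda>x\<in>carrier (stalk F \<sigma>). x)"
  "Comp Sh F G H \<psi> \<phi> = (\<lambda>\<sigma>. compose (carrier (stalk F \<sigma>)) (\<psi> \<sigma>) (\<phi> \<sigma>))"
  by (simp_all add: Sh_def)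

lemma Rep_simps [simp]:
  "Ob Rep = {V. is_rep V}" "Hom Rep = rep_hom" "Id Rep V = (\<lambda>s. 1\<^sub>m (fst V s))"
  "Comp Rep U V W g f = (\<lambda>s. g s * f s)"
  by (simp_all add: Rep_def)

lemma opposite_simps [simp]:
  "Ob (opposite C) = Ob C" "Hom (opposite C) A B = Hom C B A" "Id (opposite C) = Id C"
  "Comp (opposite C) A B E g f = Comp C E B A f g"
  by (simp_all add: opposite_def)

text \<open>Transposition is injective and reverses products, so compatibility with restrictions and
  naturality are one and the same matrix equation. One direction gives the functor, the other its
  fullness.\<close>

lemma dual_sheaf_hom_iff:
  assumes e: "inj e" and V: "is_rep V" and W: "is_rep W"
    and \<phi>: "\<And>s. \<phi> s \<in> carrier_mat (fst W s) (fst V s)"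
  shows "(\<lambda>s. transpose_map e (\<phi> s)) \<in> sheaf_hom (dual_sheaf e W) (dual_sheaf e V) \<longleftrightarrow> \<phi> \<in> rep_hom V W"
proof -
  have *: "(\<forall>x\<in>e ` carrier_vec (fst W s). transpose_map e (\<phi> t) (transpose_map e (snd W t s) x) =
        transpose_map e (snd V t s) (transpose_map e (\<phi> s) x)) \<longleftrightarrow> \<phi> s * snd V t s = snd W t s * \<phi> t"
    if "t < s" for t s
  proof -
    note car = \<phi>[of s] is_repD(1)[OF V, of t s] is_repD(1)[OF W, of t s] \<phi>[of t]
    have ts: "t \<le> s" using that by simp
    have "\<phi> s * snd V t s = snd W t s * \<phi> t \<longleftrightarrow> transpose_map e (\<phi> s * snd V t s) = transpose_map e (snd W t s * \<phi> t)"
      by (rule inj_on_eq_iff[OF bij_betw_imp_inj_on[OF transpose_map_bij[OF e, of "fst W s" "fst V t"]], symmetric])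
        (use car ts in \<open>auto intro: mult_carrier_mat\<close>)
    also have "\<dots> \<longleftrightarrow> compose (e ` carrier_vec (fst W s)) (transpose_map e (snd V t s)) (transpose_map e (\<phi> s)) =
        compose (e ` carrier_vec (fst W s)) (transpose_map e (\<phi> t)) (transpose_map e (snd W t s))"
      using transpose_map_mult[OF e car(1,2)] transpose_map_mult[OF e car(3,4)] ts by simp
    also have "\<dots> \<longleftrightarrow> (\<forall>x\<in>e ` carrier_vec (fst W s). transpose_map e (\<phi> t) (transpose_map e (snd W t s) x) =
        transpose_map e (snd V t s) (transpose_map e (\<phi> s) x))"
      unfolding compose_def fun_eq_iff restrict_def by auto
    finally show ?thesis by simp
  qed
  \<comment> \<open>Morphisms of sheaves speak only of \<open>t < s\<close>; the remaining case
    \<open>t = s\<close> of naturality holds because the structure maps there are identity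
    matrices.\<close>
  have "\<phi> \<in> rep_hom V W \<longleftrightarrow> (\<forall>s t. t < s \<longrightarrow> \<phi> s * snd V t s = snd W t s * \<phi> t)"
    using \<phi> right_mult_one_mat[OF \<phi>] left_mult_one_mat[OF \<phi>]
    unfolding rep_hom_def by (auto simp: order_le_less is_repD(2)[OF V] is_repD(2)[OF W])
  then show ?thesis
    using * bij_betwE[OF transpose_map_bij[OF e]] \<phi> unfolding sheaf_hom_def by simp
qed

lemma dual_sheaf_functor:
  fixes e :: "'k::field vec \<Rightarrow> 'v"
  assumes e: "inj e"
  shows "is_functor (Rep :: (('p::{finite,order_bot}, 'k) rep, _) cat) (opposite Sh) (dual_sheaf e)
          (\<lambda>V W \<phi> s. transpose_map e (\<phi> s))"
    and "fully_faithful (Rep :: (('p::{finite,order_bot}, 'k) rep, _) cat) (opposite Sh) (dual_sheaf e)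
          (\<lambda>V W \<phi> s. transpose_map e (\<phi> s))"
proof -
  show "is_functor (Rep :: (('p::{finite,order_bot}, 'k) rep, _) cat) (opposite Sh) (dual_sheaf e)
          (\<lambda>V W \<phi> s. transpose_map e (\<phi> s))"
    unfolding is_functor_def
  proof (intro conjI ballI)
    fix V W :: "('p, 'k) rep" and \<phi> assume "V \<in> Ob Rep" "W \<in> Ob Rep" "\<phi> \<in> Hom Rep V W"
    then have "is_rep V" "is_rep W" "\<phi> \<in> rep_hom V W" by simp_all
    then show "(\<lambda>s. transpose_map e (\<phi> s)) \<in> Hom (opposite Sh) (dual_sheaf e V) (dual_sheaf e W)"
      using dual_sheaf_hom_iff[OF e, of V W \<phi>] rep_homD(1)[of \<phi> V W] by simp
  next
    fix U V W :: "('p, 'k) rep" and f g assume "f \<in> Hom Rep U V" "g \<in> Hom Rep V W"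
    then have "f \<in> rep_hom U V" "g \<in> rep_hom V W" by simp_all
    then show "(\<lambda>s. transpose_map e (Comp Rep U V W g f s)) =
        Comp (opposite Sh) (dual_sheaf e U) (dual_sheaf e V) (dual_sheaf e W)
          (\<lambda>s. transpose_map e (g s)) (\<lambda>s. transpose_map e (f s))"
      using transpose_map_mult[OF e rep_homD(1)[of g V W] rep_homD(1)[of f U V]] by simp
  qed (simp_all add: is_sheaf_dual_sheaf[OF e] transpose_map_one[OF e])
  show "fully_faithful (Rep :: (('p::{finite,order_bot}, 'k) rep, _) cat) (opposite Sh) (dual_sheaf e)
          (\<lambda>V W \<phi> s. transpose_map e (\<phi> s))"
    unfolding fully_faithful_def
  proof (intro ballI)
    fix V W :: "('p, 'k) rep" assume "V \<in> Ob Rep" "W \<in> Ob Rep"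
    then have VW: "is_rep V" "is_rep W" by simp_all
    show "bij_betw (\<lambda>\<phi> s. transpose_map e (\<phi> s)) (Hom Rep V W) (Hom (opposite Sh) (dual_sheaf e V) (dual_sheaf e W))"
      unfolding bij_betw_def
    proof (intro conjI inj_onI subset_antisym subsetI)
      fix \<phi> \<psi> assume h: "\<phi> \<in> Hom Rep V W" "\<psi> \<in> Hom Rep V W"
        "(\<lambda>s. transpose_map e (\<phi> s)) = (\<lambda>s. transpose_map e (\<psi> s))"
      show "\<phi> = \<psi>"
      proof
        fix s show "\<phi> s = \<psi> s"
          by (rule inj_onD[OF bij_betw_imp_inj_on[OF transpose_map_bij[OF e, of "fst W s" "fst V s"]] fun_cong[OF h(3)]])
            (use h(1,2) in \<open>simp_all add: rep_homD(1)\<close>)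
      qed
    next
      fix f assume "f \<in> (\<lambda>\<phi> s. transpose_map e (\<phi> s)) ` Hom Rep V W"
      then obtain \<phi> where \<phi>: "\<phi> \<in> rep_hom V W" "f = (\<lambda>s. transpose_map e (\<phi> s))" by auto
      then show "f \<in> Hom (opposite Sh) (dual_sheaf e V) (dual_sheaf e W)"
        using dual_sheaf_hom_iff[OF e VW, of \<phi>] rep_homD(1)[OF \<phi>(1)] by simp
    next
      fix f assume "f \<in> Hom (opposite Sh) (dual_sheaf e V) (dual_sheaf e W)"
      then have f: "f \<in> sheaf_hom (dual_sheaf e W) (dual_sheaf e V)" by simp
      have "\<exists>M\<in>carrier_mat (fst W s) (fst V s). f s = transpose_map e M" for s
        using sheaf_homD(1)[OF f, of s] transpose_map_bij[OF e, of "fst W s" "fst V s"]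
        unfolding bij_betw_def by auto
      then obtain \<phi> where \<phi>: "\<And>s. \<phi> s \<in> carrier_mat (fst W s) (fst V s)" "\<And>s. f s = transpose_map e (\<phi> s)"
        by metis
      have "f = (\<lambda>s. transpose_map e (\<phi> s))" using \<phi>(2) by blast
      then show "f \<in> (\<lambda>\<phi> s. transpose_map e (\<phi> s)) ` Hom Rep V W"
        using dual_sheaf_hom_iff[OF e VW \<phi>(1)] f by (intro image_eqI[of _ _ \<phi>]) simp_all
    qed
  qed
qed

text \<open>Inverting on each stalk is enough: applying the compatibility of \<phi> with
  restrictions to \<open>\<psi> s x\<close> yields that of the inverse.\<close>

lemma sheaf_iso:
  assumes F: "is_sheaf F" and G: "is_sheaf G" and \<phi>: "\<phi> \<in> sheaf_hom F G"
    and bij: "\<And>s. bij_betw (\<phi> s) (carrier (stalk F s)) (carrier (stalk G s))"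
  shows "is_iso Sh F G \<phi>"
proof -
  define \<psi> where "\<psi> s = restrict (inv_into (carrier (stalk F s)) (\<phi> s)) (carrier (stalk G s))" for s
  have \<psi>: "\<psi> s y \<in> carrier (stalk F s)" "\<phi> s (\<psi> s y) = y" if "y \<in> carrier (stalk G s)" for s y
    using bij[of s] that by (auto simp: \<psi>_def bij_betw_def inv_into_into f_inv_into_f)
  have \<psi>\<phi>: "\<psi> s (\<phi> s x) = x" if "x \<in> carrier (stalk F s)" for s x
    using bij_betw_inv_into_left[OF bij that] mod_homD(1)[OF sheaf_homD(1)[OF \<phi>] that] by (simp add: \<psi>_def)
  have lin: "\<psi> s \<in> mod_hom scalars (stalk G s) (stalk F s)" for s
    unfolding \<psi>_def using linear_map_inv[OF is_sheafD(1)[OF F] _ bij] sheaf_homD(1)[OF \<phi>]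
    by (intro restrict_in_mod_hom is_sheafD(1)[OF G]) (simp add: mod_hom_iff)
  have "\<psi> \<in> sheaf_hom G F"
    unfolding sheaf_hom_def
  proof (intro CollectI conjI allI impI ballI lin)
    fix s t x assume st: "t < s" and x: "x \<in> carrier (stalk G s)"
    have "\<psi> t (\<phi> t (res F s t (\<psi> s x))) = res F s t (\<psi> s x)"
      using mod_homD(1)[OF is_sheafD(3)[OF F st]] \<psi>(1)[OF x] by (simp add: \<psi>\<phi>)
    then show "\<psi> t (res G s t x) = res F s t (\<psi> s x)"
      using sheaf_homD(2)[OF \<phi> st] \<psi>[OF x] by simp
  qed
  then show ?thesis
    unfolding is_iso_def using \<phi>
    by (auto intro!: bexI[of _ \<psi>] ext simp: compose_def \<psi>\<phi> \<psi>(2) cong: restrict_cong)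
qed

text \<open>In chosen bases of the stalks the restrictions become matrices \<open>B s t\<close>.
  Their transposes form the representation, because \<open>dual_sheaf\<close> transposes them
  back.\<close>

lemma dual_sheaf_essentially_surjective:
  fixes e :: "'k::field vec \<Rightarrow> 'v"
  assumes e: "inj e"
  shows "essentially_surjective (Rep :: (('p::{finite,order_bot}, 'k) rep, _) cat) (opposite Sh) (dual_sheaf e)"
  unfolding essentially_surjective_def
proof
  fix F :: "('p, 'k, 'v) sheaf" assume "F \<in> Ob (opposite Sh)"
  then have F: "is_sheaf F" by simp
  obtain d b where b: "\<And>s. is_coords (d s) (b s) (stalk F s)"
    using coords_exist[OF is_sheafD(1,2)[OF F]] by metis
  have lin: "linear_map scalars (vecs (d s)) (stalk F s) (b s)"
    and bij: "bij_betw (b s) (carrier_vec (d s)) (carrier (stalk F s))" for s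
    using b unfolding is_coords_def by auto
  define bi where "bi s = inv_into (carrier_vec (d s)) (b s)" for s
  have bi: "bi s y \<in> carrier_vec (d s)" "b s (bi s y) = y" if "y \<in> carrier (stalk F s)" for s y
    using bij[of s] that by (auto simp: bi_def bij_betw_def inv_into_into f_inv_into_f)
  have bib: "bi s (b s v) = v" if "v \<in> carrier_vec (d s)" for s v
    using bij_betw_inv_into_left[OF bij that] by (simp add: bi_def)
  have bc: "b s v \<in> carrier (stalk F s)" if "v \<in> carrier_vec (d s)" for s v
    using linear_mapD(1)[OF lin] that by (simp add: module_vec_simps)
  have bilin: "linear_map scalars (stalk F s) (vecs (d s)) (bi s)" for s
    using linear_map_inv[OF module_vecs lin] bij by (simp add: bi_def module_vec_simps)
  \<comment> \<open>A sheaf says nothing about \<open>res F s s\<close>, so the diagonal is set to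
    the identity by hand, as \<open>is_rep\<close> demands.\<close>
  define B where "B s t = (if s = t then 1\<^sub>m (d s) else matrix_of (d t) (d s) (\<lambda>v. bi t (res F s t (b s v))))" for s t
  have Bc: "B s t \<in> carrier_mat (d t) (d s)" for s t by (simp add: B_def)
  have rc: "res F s t x \<in> carrier (stalk F t)" if "t < s" "x \<in> carrier (stalk F s)" for s t x
    using mod_homD(1)[OF is_sheafD(3)[OF F that(1)] that(2)] .
  have B: "b t (B s t *\<^sub>v v) = res F s t (b s v)" if "t < s" "v \<in> carrier_vec (d s)" for s t v
  proof -
    have "linear_map scalars (vecs (d s)) (vecs (d t)) (\<lambda>v. bi t (res F s t (b s v)))"
      using linear_map_comp[OF linear_map_comp[OF lin] bilin] is_sheafD(3)[OF F that(1)]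
      by (auto simp: mod_hom_iff)
    then show ?thesis
      using that by (auto simp: B_def matrix_of bi(2) rc bc)
  qed
  have BB: "B t r * B s t = B s r" if "r \<le> t" "t \<le> s" for r t s
  proof (cases "r = t \<or> t = s")
    case True
    moreover have "B t t = 1\<^sub>m (d t)" "B s s = 1\<^sub>m (d s)" by (simp_all add: B_def)
    ultimately show ?thesis using left_mult_one_mat[OF Bc, of t s] right_mult_one_mat[OF Bc, of s r]
      by auto
  next
    case False
    then have lt: "r < t" "t < s" "r < s" using that by auto
    show ?thesis
    proof (rule mat_eqI_mult_vec[of _ "d r" "d s"])
      fix v :: "'k vec" assume v: "v \<in> carrier_vec (d s)"
      have Bv: "B s t *\<^sub>v v \<in> carrier_vec (d t)" using mult_mat_vec_carrier[OF Bc v] .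
      have "b r (B t r *\<^sub>v (B s t *\<^sub>v v)) = b r (B s r *\<^sub>v v)"
        using lt v Bv is_sheafD(4)[OF F lt(2,1)] by (simp add: B bc)
      then have "B t r *\<^sub>v (B s t *\<^sub>v v) = B s r *\<^sub>v v"
        using bib mult_mat_vec_carrier[OF Bc Bv] mult_mat_vec_carrier[OF Bc v] by metis
      then show "B t r * B s t *\<^sub>v v = B s r *\<^sub>v v"
        using assoc_mult_mat_vec[OF Bc Bc v] by simp
    qed (auto intro: Bc mult_carrier_mat)
  qed
  define V :: "('p, 'k) rep" where "V = (d, \<lambda>t s. transpose_mat (B s t))"
  have V: "is_rep V"
    unfolding is_rep_def V_def fst_conv snd_conv
    using BB by (auto simp: Bc transpose_mult[OF Bc Bc, symmetric]) (simp add: B_def)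
  define \<phi> where "\<phi> s = (\<lambda>x\<in>e ` carrier_vec (d s). b s (inv_into UNIV e x))" for s
  have bij\<phi>: "bij_betw (\<phi> s) (e ` carrier_vec (d s)) (carrier (stalk F s))" for s
    unfolding bij_betw_def
  proof
    show "inj_on (\<phi> s) (e ` carrier_vec (d s))"
      using bij_betw_imp_inj_on[OF bij] e by (auto simp: inj_on_def \<phi>_def)
    show "\<phi> s ` e ` carrier_vec (d s) = carrier (stalk F s)"
      using bij_betw_imp_surj_on[OF bij] e by (force simp: image_image \<phi>_def)
  qed
  have \<phi>: "\<phi> \<in> sheaf_hom (dual_sheaf e V) F"
    unfolding sheaf_hom_def
  proof (intro CollectI conjI allI impI ballI)
    fix s
    have "linear_map scalars (embedded_vecs e (d s)) (stalk F s) (\<lambda>x. b s (inv_into UNIV e x))"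
      by (rule linear_mapI)
         (use e linear_mapD[OF lin] in \<open>auto simp: module_vec_simps\<close>)
    then show "\<phi> s \<in> mod_hom scalars (stalk (dual_sheaf e V) s) (stalk F s)"
      using restrict_in_mod_hom[OF module_embedded_vecs[OF e]] by (fastforce simp: \<phi>_def V_def)
  next
    fix s t x assume st: "t < s" and "x \<in> carrier (stalk (dual_sheaf e V) s)"
    then obtain v where v: "v \<in> carrier_vec (d s)" "x = e v" by (auto simp: V_def)
    have T: "transpose_map e (transpose_mat (B s t)) (e v) = e (B s t *\<^sub>v v)"
      using transpose_map_apply[OF e _ v(1), of "transpose_mat (B s t)" "d t"] Bc by simp
    show "\<phi> t (res (dual_sheaf e V) s t x) = res F s t (\<phi> s x)"
      using v B[OF st v(1)] e mult_mat_vec_carrier[OF Bc v(1), of t] T by (simp add: V_def \<phi>_def)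
  qed
  have "is_iso Sh (dual_sheaf e V) F \<phi>"
    by (rule sheaf_iso[OF is_sheaf_dual_sheaf[OF e V] F \<phi>]) (simp add: V_def bij\<phi>)
  \<comment> \<open>In the opposite category an arrow from \<open>dual_sheaf e V\<close> to
    \<open>F\<close> is a sheaf morphism out of \<open>F\<close>, so the witness is the inverse of
    \<phi>.\<close>
  then show "\<exists>V\<in>Ob Rep. \<exists>f. is_iso (opposite Sh) (dual_sheaf e V) F f"
    using V by (intro bexI[of _ V]) (auto simp: is_iso_def simp del: split_paired_Ex)
qed

section \<open>Graded modules over the polynomial ring\<close>

lemma poly_ring_simps [simp]:
  "monoid.mult poly_ring = (*)" "monoid.one poly_ring = 1" "zero poly_ring = 0" "add poly_ring = (+)"
  by (simp_all add: poly_ring_def ring_of_type_algebra_def)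

lemma carrier_poly_ring:
  "f \<in> carrier poly_ring \<longleftrightarrow> (\<forall>a\<in>Poly_Mapping.keys f. bot \<notin> Poly_Mapping.keys a)"
  by (simp add: poly_ring_def)

lemma cring_poly_ring: "cring (poly_ring :: ('p::order_bot, 'k::field) mpoly ring)"
proof (intro cringI abelian_groupI comm_monoidI)
  fix f g :: "('p, 'k) mpoly" assume fg: "f \<in> carrier poly_ring" "g \<in> carrier poly_ring"
  show "f \<oplus>\<^bsub>poly_ring\<^esub> g \<in> carrier poly_ring"
    using fg Poly_Mapping.keys_add[of f g] by (auto simp: carrier_poly_ring)
  show "f \<otimes>\<^bsub>poly_ring\<^esub> g \<in> carrier poly_ring"
    using fg by (auto simp: carrier_poly_ring dest!: subsetD[OF Poly_Mapping.keys_mult] subsetD[OF Poly_Mapping.keys_add])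
  show "\<exists>h\<in>carrier poly_ring. h \<oplus>\<^bsub>poly_ring\<^esub> f = \<zero>\<^bsub>poly_ring\<^esub>"
    using fg(1) by (intro bexI[of _ "- f"]) (auto simp: carrier_poly_ring)
qed (auto simp: algebra_simps carrier_poly_ring)

definition mono_degree :: "('p \<Rightarrow>\<^sub>0 nat) \<Rightarrow> 'p \<Rightarrow> int" where
  "mono_degree a = (\<lambda>s. int (Poly_Mapping.lookup a s))"

lemma mono_degree_add [simp]: "mono_degree (a + b) = mono_degree a + mono_degree b"
  by (simp add: mono_degree_def fun_eq_iff plus_fun_def Poly_Mapping.lookup_add)

lemma mono_degree_zero [simp]: "mono_degree 0 = 0"
  by (simp add: mono_degree_def fun_eq_iff zero_fun_def)

lemma mono_degree_inj: "mono_degree a = mono_degree b \<longleftrightarrow> a = b"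
  by (auto simp: mono_degree_def fun_eq_iff intro: poly_mapping_eqI)

lemma mono_degree_nonneg: "0 \<le> mono_degree a s"
  by (simp add: mono_degree_def)

lemma shift_eq: "(\<lambda>s. u s + int (Poly_Mapping.lookup a s)) = u + mono_degree a"
  by (simp add: mono_degree_def plus_fun_def)

definition valid_mono :: "('p::order_bot \<Rightarrow>\<^sub>0 nat) \<Rightarrow> bool" where
  "valid_mono a \<longleftrightarrow> bot \<notin> Poly_Mapping.keys a"

lemma valid_mono_zero [simp]: "valid_mono 0"
  by (simp add: valid_mono_def)

lemma valid_mono_add [simp]: "valid_mono (a + b) \<longleftrightarrow> valid_mono a \<and> valid_mono b"
  by (auto simp: valid_mono_def in_keys_iff Poly_Mapping.lookup_add)

lemma single_poly_ring: "valid_mono a \<Longrightarrow> Poly_Mapping.single a c \<in> carrier poly_ring"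
  by (simp add: valid_mono_def carrier_poly_ring)

lemma degrees_simps [simp]:
  "valid_mono a \<Longrightarrow> u + mono_degree a \<in> degrees \<longleftrightarrow> u \<in> degrees"
  "valid_mono a \<Longrightarrow> u - mono_degree a \<in> degrees \<longleftrightarrow> u \<in> degrees"
  "valid_mono a \<Longrightarrow> mono_degree a \<in> degrees"
  "0 \<in> degrees"
  by (auto simp: degrees_def valid_mono_def mono_degree_def in_keys_iff)

text \<open>A polynomial is the sum of its terms, and all partial sums stay in
  \<open>poly_ring\<close>. Statements additive in the polynomial thereby reduce to single terms
  whose monomial avoids \<open>bot\<close>.\<close>

lemma poly_ring_induct [consumes 1, case_names zero single add]:
  assumes f: "f \<in> carrier poly_ring" and 0: "P 0"
    and single: "\<And>a c. valid_mono a \<Longrightarrow> P (Poly_Mapping.single a c)"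
    and add: "\<And>f g. f \<in> carrier poly_ring \<Longrightarrow> g \<in> carrier poly_ring \<Longrightarrow> P f \<Longrightarrow> P g \<Longrightarrow> P (f + g)"
  shows "P f"
proof -
  have *: "A \<subseteq> Poly_Mapping.keys f \<Longrightarrow>
      (\<Sum>a\<in>A. Poly_Mapping.single a (Poly_Mapping.lookup f a)) \<in> carrier poly_ring \<and>
      P (\<Sum>a\<in>A. Poly_Mapping.single a (Poly_Mapping.lookup f a))" if "finite A" for A
    using that
  proof (induction A)
    case (insert a A)
    then have a: "valid_mono a" using f by (auto simp: valid_mono_def carrier_poly_ring)
    let ?s = "\<Sum>a\<in>A. Poly_Mapping.single a (Poly_Mapping.lookup f a)"
    have s: "?s \<in> carrier poly_ring" "P ?s" using insert by auto
    have "Poly_Mapping.single a (Poly_Mapping.lookup f a) + ?s \<in> carrier poly_ring"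
      using cring.cring_simprules(1)[OF cring_poly_ring single_poly_ring[OF a] s(1)] by simp
    then show ?case
      using insert.hyps add[OF single_poly_ring[OF a] s(1) single[OF a] s(2)] by simp
  qed (simp add: 0 carrier_poly_ring)
  have "(\<Sum>a\<in>Poly_Mapping.keys f. Poly_Mapping.single a (Poly_Mapping.lookup f a)) = f"
    by (rule poly_mapping_eqI)
      (simp add: Poly_Mapping.lookup_sum Poly_Mapping.lookup_single when_def sum.delta in_keys_iff)
  then show ?thesis using *[OF finite_keys order_refl] by simp
qed

lemma linear_map_poly_ringI:
  assumes M: "module poly_ring M" and N: "module poly_ring N"
    and car: "\<And>x. x \<in> carrier M \<Longrightarrow> f x \<in> carrier N"
    and add: "\<And>x y. x \<in> carrier M \<Longrightarrow> y \<in> carrier M \<Longrightarrow> f (x \<oplus>\<^bsub>M\<^esub> y) = f x \<oplus>\<^bsub>N\<^esub> f y"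
    and single: "\<And>a c x. valid_mono a \<Longrightarrow> x \<in> carrier M \<Longrightarrow>
      f (Poly_Mapping.single a c \<odot>\<^bsub>M\<^esub> x) = Poly_Mapping.single a c \<odot>\<^bsub>N\<^esub> f x"
  shows "linear_map poly_ring M N f"
proof (rule linear_mapI[OF car add])
  interpret M: module poly_ring M by fact
  interpret N: module poly_ring N by fact
  have fz: "f \<zero>\<^bsub>M\<^esub> = \<zero>\<^bsub>N\<^esub>"
    using single[of 0 "\<zero>\<^bsub>M\<^esub>" 0] car[of "\<zero>\<^bsub>M\<^esub>"] M.smult_l_null N.smult_l_null by simp
  fix r :: "('a, 'b) mpoly" and x assume "r \<in> carrier poly_ring" and x: "x \<in> carrier M"
  then show "f (r \<odot>\<^bsub>M\<^esub> x) = r \<odot>\<^bsub>N\<^esub> f x"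
  proof (induction r rule: poly_ring_induct)
    case zero
    then show ?case using x car[OF x] M.smult_l_null N.smult_l_null fz by simp
  next
    case (add r s)
    then show ?case
      using x car[OF x] M.smult_l_distr[of r s x] N.smult_l_distr[of r s "f x"] assms(4) by simp
  qed (rule single, assumption, rule x)
qed

definition is_decomposition ::
  "('p::order_bot, 'k::field, 'm) gr_mod \<Rightarrow> 'm \<Rightarrow> (('p \<Rightarrow> int) \<Rightarrow> 'm) \<Rightarrow> bool" where
  "is_decomposition M x c \<longleftrightarrow>
    (\<forall>u\<in>degrees. c u \<in> hcomp M u) \<and> (\<forall>u. u \<notin> degrees \<longrightarrow> c u = \<zero>\<^bsub>M\<^esub>) \<and>
    finite {u. c u \<noteq> \<zero>\<^bsub>M\<^esub>} \<and> x = (\<Oplus>\<^bsub>M\<^esub>u\<in>{u. c u \<noteq> \<zero>\<^bsub>M\<^esub>}. c u)"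

text \<open>All components of \<open>x\<close> at once; for \<open>x\<close> in the carrier the
  description is proper by the unique existence demanded in \<open>graded_module\<close>.\<close>

definition component ::
  "('p::order_bot, 'k::field, 'm) gr_mod \<Rightarrow> 'm \<Rightarrow> ('p \<Rightarrow> int) \<Rightarrow> 'm" where
  "component M x = (THE c. is_decomposition M x c)"

text \<open>A homogeneous component is a vector space rather than a submodule: the scalars are the
  constant polynomials, which preserve the degree.\<close>

definition component_space :: "('p::order_bot, 'k::field, 'm) gr_mod \<Rightarrow> ('p \<Rightarrow> int) \<Rightarrow> ('k, 'm) module" where
  "component_space M u = \<lparr>carrier = hcomp M u, monoid.mult = undefined, one = undefined,
     zero = \<zero>\<^bsub>M\<^esub>, add = add M, module.smult = (\<lambda>c x. Poly_Mapping.single 0 c \<odot>\<^bsub>M\<^esub> x)\<rparr>"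

lemma component_space_simps [simp]:
  "carrier (component_space M u) = hcomp M u" "\<zero>\<^bsub>component_space M u\<^esub> = \<zero>\<^bsub>M\<^esub>"
  "x \<oplus>\<^bsub>component_space M u\<^esub> y = x \<oplus>\<^bsub>M\<^esub> y"
  "c \<odot>\<^bsub>component_space M u\<^esub> x = Poly_Mapping.single 0 c \<odot>\<^bsub>M\<^esub> x"
  by (simp_all add: component_space_def)

locale graded_mod =
  fixes M :: "('p::{finite,order_bot}, 'k::field, 'm) gr_mod"
  assumes graded: "graded_module M"

sublocale graded_mod \<subseteq> module poly_ring M
  using graded by (simp add: graded_module_def)

context graded_mod begin

abbreviation mono_mult :: "('p \<Rightarrow>\<^sub>0 nat) \<Rightarrow> 'm \<Rightarrow> 'm" where
  "mono_mult a x \<equiv> Poly_Mapping.single a 1 \<odot>\<^bsub>M\<^esub> x"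

lemma hcomp_subgroup: "u \<in> degrees \<Longrightarrow> additive_subgroup (hcomp M u) M"
  using graded by (simp add: graded_module_def)

lemma hcomp_closed:
  assumes "u \<in> degrees"
  shows "x \<in> hcomp M u \<Longrightarrow> x \<in> carrier M"
    and "\<zero>\<^bsub>M\<^esub> \<in> hcomp M u"
    and "x \<in> hcomp M u \<Longrightarrow> y \<in> hcomp M u \<Longrightarrow> x \<oplus>\<^bsub>M\<^esub> y \<in> hcomp M u"
    and "x \<in> hcomp M u \<Longrightarrow> \<ominus>\<^bsub>M\<^esub> x \<in> hcomp M u"
  using additive_subgroup.a_Hcarr[OF hcomp_subgroup[OF assms]]
    additive_subgroup.zero_closed[OF hcomp_subgroup[OF assms]]
    additive_subgroup.a_closed[OF hcomp_subgroup[OF assms]]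
    abelian_group.a_inv_closed
    subgroup.m_inv_closed[OF additive_subgroup.a_subgroup[OF hcomp_subgroup[OF assms]]]
  by (auto simp: a_inv_def)

lemma single_smult_hcomp:
  assumes "u \<in> degrees" "x \<in> hcomp M u" "valid_mono a"
  shows "Poly_Mapping.single a c \<odot>\<^bsub>M\<^esub> x \<in> hcomp M (u + mono_degree a)"
  using graded assms unfolding graded_module_def valid_mono_def shift_eq by blast

lemma scalar_smult_hcomp:
  "u \<in> degrees \<Longrightarrow> x \<in> hcomp M u \<Longrightarrow> Poly_Mapping.single 0 c \<odot>\<^bsub>M\<^esub> x \<in> hcomp M u"
  using single_smult_hcomp[of u x 0 c] by simp

lemma single_smult_smult:
  assumes "x \<in> carrier M" "valid_mono a" "valid_mono b"
  shows "Poly_Mapping.single a c \<odot>\<^bsub>M\<^esub> (Poly_Mapping.single b d \<odot>\<^bsub>M\<^esub> x) = Poly_Mapping.single (a + b) (c * d) \<odot>\<^bsub>M\<^esub> x"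
  using smult_assoc1[OF single_poly_ring[OF assms(2)] single_poly_ring[OF assms(3)] assms(1)]
  by (simp add: Poly_Mapping.mult_single)

lemma single_smult_closed:
  "x \<in> carrier M \<Longrightarrow> valid_mono a \<Longrightarrow> Poly_Mapping.single a c \<odot>\<^bsub>M\<^esub> x \<in> carrier M"
  by (rule smult_closed[OF single_poly_ring])

lemma mono_mult_zero [simp]: "x \<in> carrier M \<Longrightarrow> mono_mult 0 x = x"
  using smult_one by simp

lemma one_smult [simp]: "x \<in> carrier M \<Longrightarrow> 1 \<odot>\<^bsub>M\<^esub> x = x"
  using smult_one by simp

lemma module_component_space:
  assumes u: "u \<in> degrees"
  shows "module scalars (component_space M u)"
proof (intro module.intro cring_scalars abelian_groupI module_axioms.intro)
  note c = hcomp_closed[OF u]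
  fix x assume "x \<in> carrier (component_space M u)"
  then show "\<exists>y\<in>carrier (component_space M u). y \<oplus>\<^bsub>component_space M u\<^esub> x = \<zero>\<^bsub>component_space M u\<^esub>"
    using c by (intro bexI[of _ "\<ominus>\<^bsub>M\<^esub> x"]) (auto intro: M.l_neg)
next
  note c = hcomp_closed[OF u]
  fix r s :: 'k and x assume "x \<in> carrier (component_space M u)"
  then have x: "x \<in> carrier M" using c by simp
  show "(r \<oplus>\<^bsub>scalars\<^esub> s) \<odot>\<^bsub>component_space M u\<^esub> x = r \<odot>\<^bsub>component_space M u\<^esub> x \<oplus>\<^bsub>component_space M u\<^esub> s \<odot>\<^bsub>component_space M u\<^esub> x"
    using smult_l_distr[OF single_poly_ring[of 0 r] single_poly_ring[of 0 s] x] by (simp add: Poly_Mapping.single_add)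
  show "(r \<otimes>\<^bsub>scalars\<^esub> s) \<odot>\<^bsub>component_space M u\<^esub> x = r \<odot>\<^bsub>component_space M u\<^esub> (s \<odot>\<^bsub>component_space M u\<^esub> x)"
    using x by (simp add: single_smult_smult)
next
  note c = hcomp_closed[OF u]
  fix r :: 'k and x y assume "x \<in> carrier (component_space M u)" "y \<in> carrier (component_space M u)"
  then show "r \<odot>\<^bsub>component_space M u\<^esub> (x \<oplus>\<^bsub>component_space M u\<^esub> y) = r \<odot>\<^bsub>component_space M u\<^esub> x \<oplus>\<^bsub>component_space M u\<^esub> r \<odot>\<^bsub>component_space M u\<^esub> y"
    using c smult_r_distr[OF single_poly_ring[of 0 r]] by simp
qed (use hcomp_closed[OF u] scalar_smult_hcomp[OF u] mono_mult_zero in \<open>auto simp: M.a_assoc intro: M.a_comm\<close>)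

lemma linear_map_mono_mult:
  assumes "u \<in> degrees" "valid_mono a"
  shows "linear_map scalars (component_space M u) (component_space M (u + mono_degree a)) (mono_mult a)"
proof (rule linear_mapI)
  fix x assume "x \<in> carrier (component_space M u)"
  then show "mono_mult a x \<in> carrier (component_space M (u + mono_degree a))"
    using single_smult_hcomp[OF assms(1) _ assms(2)] by simp
next
  fix x y assume "x \<in> carrier (component_space M u)" "y \<in> carrier (component_space M u)"
  then show "mono_mult a (x \<oplus>\<^bsub>component_space M u\<^esub> y) = mono_mult a x \<oplus>\<^bsub>component_space M (u + mono_degree a)\<^esub> mono_mult a y"
    using hcomp_closed[OF assms(1)] smult_r_distr[OF single_poly_ring[OF assms(2)]] by simp
next
  fix r x assume "x \<in> carrier (component_space M u)"
  then show "mono_mult a (r \<odot>\<^bsub>component_space M u\<^esub> x) = r \<odot>\<^bsub>component_space M (u + mono_degree a)\<^esub> mono_mult a x"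
    using hcomp_closed[OF assms(1)] assms(2) by (simp add: single_smult_smult)
qed

section \<open>Calculus of homogeneous components\<close>

lemma component_unique:
  assumes "is_decomposition M x c" "x \<in> carrier M"
  shows "component M x = c"
proof -
  have "\<exists>!c. is_decomposition M x c"
    using graded assms(2) unfolding graded_module_def is_decomposition_def by blast
  then show ?thesis unfolding component_def by (rule the1_equality) (rule assms(1))
qed

lemma component_decomposition: "x \<in> carrier M \<Longrightarrow> is_decomposition M x (component M x)"
proof -
  assume "x \<in> carrier M"
  then have "\<exists>!c. is_decomposition M x c"
    using graded unfolding graded_module_def is_decomposition_def by blast
  then show ?thesis unfolding component_def by (rule theI')
qed

lemma component_props:
  assumes "x \<in> carrier M"
  shows "u \<in> degrees \<Longrightarrow> component M x u \<in> hcomp M u"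
    and "u \<notin> degrees \<Longrightarrow> component M x u = \<zero>\<^bsub>M\<^esub>"
    and "finite {u. component M x u \<noteq> \<zero>\<^bsub>M\<^esub>}"
    and "x = (\<Oplus>\<^bsub>M\<^esub>u\<in>{u. component M x u \<noteq> \<zero>\<^bsub>M\<^esub>}. component M x u)"
  using component_decomposition[OF assms] unfolding is_decomposition_def by blast+

lemma component_closed: "x \<in> carrier M \<Longrightarrow> component M x u \<in> carrier M"
  using component_props(1,2)[of x u] hcomp_closed(1)[of u] by (cases "u \<in> degrees") auto

text \<open>Summing over any finite set \<open>U\<close> that contains the support avoids
  determining the exact support, over which \<open>is_decomposition\<close> sums.\<close>

lemma is_decompositionI:
  assumes U: "finite U" "U \<subseteq> degrees" and c: "\<And>u. u \<in> U \<Longrightarrow> c u \<in> hcomp M u"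
    and z: "\<And>u. u \<notin> U \<Longrightarrow> c u = \<zero>\<^bsub>M\<^esub>" and x: "x = (\<Oplus>\<^bsub>M\<^esub>u\<in>U. c u)"
  shows "is_decomposition M x c"
proof -
  have sub: "{u. c u \<noteq> \<zero>\<^bsub>M\<^esub>} \<subseteq> U" using z by auto
  have cM: "c u \<in> carrier M" for u
    using c[of u] z[of u] hcomp_closed(1)[of u x] U(2) hcomp_closed(1) by (cases "u \<in> U") auto
  have "(\<Oplus>\<^bsub>M\<^esub>u\<in>{u. c u \<noteq> \<zero>\<^bsub>M\<^esub>}. c u) = (\<Oplus>\<^bsub>M\<^esub>u\<in>U. c u)"
    by (rule M.add.finprod_mono_neutral_cong_left) (use U sub cM in auto)
  then show ?thesis
    unfolding is_decomposition_def
  proof (intro conjI ballI allI impI)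
    fix u :: "'p \<Rightarrow> int" assume "u \<in> degrees"
    then show "c u \<in> hcomp M u" using c[of u] z[of u] hcomp_closed(2)[of u] by (cases "u \<in> U") auto
  qed (use U z x sub in \<open>auto intro: finite_subset\<close>)
qed

lemma component_finsum:
  assumes "finite U" "U \<subseteq> degrees" and c: "\<And>u. u \<in> U \<Longrightarrow> c u \<in> hcomp M u"
  shows "component M (\<Oplus>\<^bsub>M\<^esub>u\<in>U. c u) w = (if w \<in> U then c w else \<zero>\<^bsub>M\<^esub>)"
proof -
  have cM: "c \<in> U \<rightarrow> carrier M" using assms hcomp_closed(1) by auto
  have "(\<Oplus>\<^bsub>M\<^esub>u\<in>U. c u) = (\<Oplus>\<^bsub>M\<^esub>u\<in>U. if u \<in> U then c u else \<zero>\<^bsub>M\<^esub>)"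
    by (rule M.finsum_cong') (use cM in auto)
  then have "is_decomposition M (\<Oplus>\<^bsub>M\<^esub>u\<in>U. c u) (\<lambda>u. if u \<in> U then c u else \<zero>\<^bsub>M\<^esub>)"
    by (intro is_decompositionI[OF assms(1,2)]) (use c in auto)
  then show ?thesis
    using component_unique M.finsum_closed[OF cM] by simp
qed

lemma component_hcomp:
  assumes "u \<in> degrees" "x \<in> hcomp M u"
  shows "component M x w = (if w = u then x else \<zero>\<^bsub>M\<^esub>)"
  using component_finsum[of "{u}" "\<lambda>_. x" w] assms hcomp_closed(1)[OF assms] by simp

text \<open>Applying \<open>f\<close> to the decomposition of \<open>x\<close> gives a decomposition
  of \<open>f x\<close> with all degrees shifted by \<open>w\<close>, and decompositions are
  unique.\<close>

lemma component_additive: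
  assumes f: "\<And>x y. x \<in> carrier M \<Longrightarrow> y \<in> carrier M \<Longrightarrow> f (x \<oplus>\<^bsub>M\<^esub> y) = f x \<oplus>\<^bsub>M\<^esub> f y" "f \<zero>\<^bsub>M\<^esub> = \<zero>\<^bsub>M\<^esub>"
    and fh: "\<And>u x. u \<in> degrees \<Longrightarrow> x \<in> hcomp M u \<Longrightarrow> f x \<in> hcomp M (u + w)"
    and w: "\<And>u. u + w \<in> degrees \<longleftrightarrow> u \<in> degrees" and x: "x \<in> carrier M"
  shows "component M (f x) (u + w) = f (component M x u)"
proof -
  let ?U = "{u. component M x u \<noteq> \<zero>\<^bsub>M\<^esub>}"
  have cc: "component M x u \<in> carrier M" for u using x component_closed by blast
  have U: "finite ?U" "?U \<subseteq> degrees" using component_props[OF x] by auto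
  have fM: "f (component M x u) \<in> carrier M" for u
    using component_props(1,2)[OF x, of u] hcomp_closed[of "u + w"] w[of u] fh[of u] f(2)
    by (cases "u \<in> degrees") auto
  have sum: "f (\<Oplus>\<^bsub>M\<^esub>u\<in>A. component M x u) = (\<Oplus>\<^bsub>M\<^esub>u\<in>A. f (component M x u))" if "finite A" for A
    using that
  proof (induction A)
    case (insert a A)
    have "(\<Oplus>\<^bsub>M\<^esub>u\<in>A. component M x u) \<in> carrier M" by (rule M.finsum_closed) (use cc in auto)
    with insert show ?case by (simp add: cc fM f(1) Pi_iff)
  qed (simp add: f(2))
  have "f x = (\<Oplus>\<^bsub>M\<^esub>u\<in>?U. f (component M x u))"
    using sum[OF U(1)] component_props(4)[OF x] by simp
  also have "\<dots> = (\<Oplus>\<^bsub>M\<^esub>v\<in>(\<lambda>u. u + w) ` ?U. f (component M x (v - w)))"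
    by (subst M.finsum_reindex) (use fM in \<open>auto simp: inj_on_def\<close>)
  finally have *: "f x = \<dots>" .
  have "component M (f x) (u + w) = (if u + w \<in> (\<lambda>u. u + w) ` ?U then f (component M x (u + w - w)) else \<zero>\<^bsub>M\<^esub>)"
    unfolding * by (rule component_finsum) (use U w fh component_props(1)[OF x] in auto)
  then show ?thesis using f(2) by (auto split: if_splits)
qed

lemma component_single_smult:
  assumes "valid_mono a" "x \<in> carrier M"
  shows "component M (Poly_Mapping.single a c \<odot>\<^bsub>M\<^esub> x) u = Poly_Mapping.single a c \<odot>\<^bsub>M\<^esub> component M x (u - mono_degree a)"
  using component_additive[of "\<lambda>x. Poly_Mapping.single a c \<odot>\<^bsub>M\<^esub> x" "mono_degree a" x "u - mono_degree a"]
    assms smult_r_distr[OF single_poly_ring[OF assms(1)]] single_smult_hcomp smult_r_null[OF single_poly_ring[OF assms(1)]]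
  by simp

lemma component_add:
  assumes x: "x \<in> carrier M" and y: "y \<in> carrier M"
  shows "component M (x \<oplus>\<^bsub>M\<^esub> y) u = component M x u \<oplus>\<^bsub>M\<^esub> component M y u"
proof -
  let ?U = "{u. component M x u \<noteq> \<zero>\<^bsub>M\<^esub>} \<union> {u. component M y u \<noteq> \<zero>\<^bsub>M\<^esub>}"
  have U: "finite ?U" "?U \<subseteq> degrees" using component_props[OF x] component_props[OF y] by auto
  have sum: "z = (\<Oplus>\<^bsub>M\<^esub>u\<in>?U. component M z u)" if "z \<in> {x, y}" for z
  proof -
    have z: "z \<in> carrier M" using that x y by auto
    have "(\<Oplus>\<^bsub>M\<^esub>u\<in>{u. component M z u \<noteq> \<zero>\<^bsub>M\<^esub>}. component M z u) = (\<Oplus>\<^bsub>M\<^esub>u\<in>?U. component M z u)"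
      by (rule M.add.finprod_mono_neutral_cong_left) (use U that component_closed[OF z] in auto)
    then show ?thesis using component_props(4)[OF z] by simp
  qed
  have "x \<oplus>\<^bsub>M\<^esub> y = (\<Oplus>\<^bsub>M\<^esub>u\<in>?U. component M x u \<oplus>\<^bsub>M\<^esub> component M y u)"
    using sum[of x] sum[of y] component_closed[OF x] component_closed[OF y]
      M.finsum_addf[of "component M x" ?U "component M y"] by simp
  then have "is_decomposition M (x \<oplus>\<^bsub>M\<^esub> y) (\<lambda>u. component M x u \<oplus>\<^bsub>M\<^esub> component M y u)"
  proof (intro is_decompositionI[OF U])
    fix w assume "w \<in> ?U"
    then show "component M x w \<oplus>\<^bsub>M\<^esub> component M y w \<in> hcomp M w"
      using U(2) component_props(1)[OF x] component_props(1)[OF y] hcomp_closed(3)[of w] by blast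
  qed simp_all
  then show ?thesis using component_unique x y by simp
qed

lemma component_zero: "component M \<zero>\<^bsub>M\<^esub> u = \<zero>\<^bsub>M\<^esub>"
  using component_finsum[of "{}" "\<lambda>_. \<zero>\<^bsub>M\<^esub>" u] by simp

text \<open>The finitely many generators have finitely many nonzero components, and at most one
  monomial moves a given component into degree \<open>u\<close>. The resulting multiples span that
  degree over the field.\<close>

lemma finitely_generated_component_space:
  assumes fg: "finitely_generated poly_ring M" and u: "u \<in> degrees"
  shows "finitely_generated scalars (component_space M u)"
proof -
  obtain S where S: "finite S" "S \<subseteq> carrier M" "carrier M \<subseteq> module_span poly_ring M S"
    using fg unfolding finitely_generated_iff by blast
  interpret C: module scalars "component_space M u" by (rule module_component_space[OF u])
  \<comment> \<open>The monomials that carry some nonzero component of \<open>s\<close> into degree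
    \<open>u\<close>. A monomial is determined by its degree, so there are finitely many of
    them.\<close>
  define E where "E s = {a. valid_mono a \<and> component M s (u - mono_degree a) \<noteq> \<zero>\<^bsub>M\<^esub>}" for s
  define T where "T = (\<Union>s\<in>S. (\<lambda>a. mono_mult a (component M s (u - mono_degree a))) ` E s)"
  have "finite (E s)" if "s \<in> S" for s
  proof -
    have "E s \<subseteq> (\<lambda>a. u - mono_degree a) -` {w. component M s w \<noteq> \<zero>\<^bsub>M\<^esub>}" by (auto simp: E_def)
    moreover have "inj (\<lambda>a. u - mono_degree a)" by (auto simp: inj_def mono_degree_inj)
    ultimately show ?thesis
      using component_props(3)[of s] S(2) that by (meson finite_subset finite_vimageI subsetD)
  qed
  then have T: "finite T" using S(1) by (simp add: T_def)
  have in_u: "mono_mult a (component M s (u - mono_degree a)) \<in> hcomp M u" if "valid_mono a" "s \<in> carrier M" for a s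
    using single_smult_hcomp[of "u - mono_degree a" "component M s (u - mono_degree a)" a 1] that u component_props(1)[OF that(2)]
    by simp
  then have Tu: "T \<subseteq> carrier (component_space M u)"
    using S(2) by (auto simp: T_def E_def)
  let ?span = "module_span scalars (component_space M u) T"
  have smult: "component M (r \<odot>\<^bsub>M\<^esub> s) u \<in> ?span" if "r \<in> carrier poly_ring" and s: "s \<in> S" for r s
    using that(1)
  proof (induction r rule: poly_ring_induct)
    case zero
    have "0 \<odot>\<^bsub>M\<^esub> s = \<zero>\<^bsub>M\<^esub>" using smult_l_null[of s] s S(2) by auto
    then show ?case using component_zero C.module_span_zero[OF T Tu] by simp
  next
    case (single a c)
    have sM: "s \<in> carrier M" using s S(2) by auto
    let ?t = "mono_mult a (component M s (u - mono_degree a))"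
    have eq: "component M (Poly_Mapping.single a c \<odot>\<^bsub>M\<^esub> s) u = c \<odot>\<^bsub>component_space M u\<^esub> ?t"
      using single sM by (simp add: component_single_smult single_smult_smult component_closed)
    have "?t \<in> ?span"
    proof (cases "a \<in> E s")
      case True
      then show ?thesis using s by (intro C.module_span_incl[OF T Tu]) (auto simp: T_def)
    next
      case False
      then have "?t = \<zero>\<^bsub>M\<^esub>" using single smult_r_null[OF single_poly_ring] by (auto simp: E_def)
      then show ?thesis using C.module_span_zero[OF T Tu] by simp
    qed
    then show ?case unfolding eq by (intro C.module_span_smult[OF T Tu]) auto
  next
    case (add f g)
    have sM: "s \<in> carrier M" using s S(2) by auto
    have "component M ((f + g) \<odot>\<^bsub>M\<^esub> s) u = component M (f \<odot>\<^bsub>M\<^esub> s) u \<oplus>\<^bsub>M\<^esub> component M (g \<odot>\<^bsub>M\<^esub> s) u"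
      using smult_l_distr[OF add(1,2) sM] component_add[OF smult_closed[OF add(1) sM] smult_closed[OF add(2) sM]] by simp
    then show ?case using C.module_span_add[OF T Tu add(3,4)] by simp
  qed
  \<comment> \<open>Quantifying over all multiples of \<open>x\<close> lets the induction pass
    through the case of scalar multiplication.\<close>
  have "\<forall>r\<in>carrier poly_ring. component M (r \<odot>\<^bsub>M\<^esub> x) u \<in> ?span" if "x \<in> carrier M" for x
  proof -
    have "x \<in> module_span poly_ring M S" using S(3) that by blast
    then show ?thesis using S(1,2)
    proof (induction rule: module_span_induct)
      case zero
      show ?case using smult_r_null component_zero C.module_span_zero[OF T Tu] by simp
    next
      case (gen s)
      then show ?case using smult by blast
    next
      case (add x y)
      then show ?case
        using smult_r_distr component_add[OF smult_closed smult_closed] C.module_span_add[OF T Tu] by simp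
    next
      case (smult r x)
      then show ?case using smult_assoc1[of _ r x, symmetric] R.m_closed[of _ r] by simp
    qed
  qed
  then have "component M x u \<in> ?span" if "x \<in> carrier M" for x
    using that smult_one[OF that] by (metis R.one_closed)
  then have "x \<in> ?span" if "x \<in> hcomp M u" for x
    using component_hcomp[OF u that, of u] hcomp_closed(1)[OF u that] by metis
  then have "carrier (component_space M u) \<subseteq> ?span"
    by (simp add: subset_iff)
  then show ?thesis unfolding finitely_generated_iff using T Tu by blast
qed

end

section \<open>Chain-supported degrees\<close>

definition chain_degree :: "('p::{finite,order_bot} \<Rightarrow> int) \<Rightarrow> bool" where
  "chain_degree u \<longleftrightarrow> u \<in> degrees \<and> (\<forall>s. 0 \<le> u s) \<and> supp u \<in> order_complex UNIV"

text \<open>On empty support, where \<open>GREATEST\<close> has nothing to pick, the value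
  \<open>bot\<close> assigns degree 0 to the minimal element.\<close>

definition top_of :: "('p::{finite,order_bot} \<Rightarrow> int) \<Rightarrow> 'p" where
  "top_of u = (if supp u = {} then bot else (GREATEST s. s \<in> supp u))"

text \<open>The value at \<open>bot\<close> matches \<open>top_of\<close>: degree 0 is the degree
  belonging to \<open>bot\<close>, so that it is treated like the degrees of the variables.\<close>

definition elem_mono :: "'p::order_bot \<Rightarrow> 'p \<Rightarrow>\<^sub>0 nat" where
  "elem_mono s = (if s = bot then 0 else Poly_Mapping.single s 1)"

abbreviation elem_degree :: "'p::order_bot \<Rightarrow> 'p \<Rightarrow> int" where
  "elem_degree s \<equiv> mono_degree (elem_mono s)"

lemma order_complex_UNIV:
  "F \<in> order_complex UNIV \<longleftrightarrow> bot \<notin> F \<and> (\<forall>x\<in>F. \<forall>y\<in>F. x \<le> y \<or> y \<le> x)"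
  by (auto simp: order_complex_def Complete_Partial_Order.chain_def)

lemma finite_chain_Greatest:
  fixes F :: "'p::order set"
  assumes "finite F" "F \<noteq> {}" "\<forall>x\<in>F. \<forall>y\<in>F. x \<le> y \<or> y \<le> x"
  shows "\<exists>m\<in>F. \<forall>x\<in>F. x \<le> m"
  using assms
proof (induction F rule: finite_ne_induct)
  case (insert x F)
  then obtain m where "m \<in> F" "\<forall>x\<in>F. x \<le> m" by auto
  then show ?case using insert.prems by (metis insertE insertI1 insertI2 order_refl order_trans)
qed simp

lemma chain_degree_supp: "chain_degree u \<Longrightarrow> supp u \<in> order_complex UNIV"
  by (simp add: chain_degree_def)

lemma top_of_greatest:
  assumes "chain_degree u" "supp u \<noteq> {}"
  shows "top_of u \<in> supp u" "s \<in> supp u \<Longrightarrow> s \<le> top_of u"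
proof -
  obtain m where m: "m \<in> supp u" "\<forall>x\<in>supp u. x \<le> m"
    using finite_chain_Greatest[of "supp u"] assms chain_degree_supp[OF assms(1)]
    by (auto simp: order_complex_UNIV)
  then have "top_of u = m"
    using assms(2) unfolding top_of_def by (auto intro: Greatest_equality)
  then show "top_of u \<in> supp u" "s \<in> supp u \<Longrightarrow> s \<le> top_of u" using m by auto
qed

lemma le_top_of: "chain_degree u \<Longrightarrow> s \<in> supp u \<Longrightarrow> s \<le> top_of u"
  using top_of_greatest(2)[of u s] by fastforce

lemma top_of_eqI:
  assumes "s \<in> supp u" "\<And>t. t \<in> supp u \<Longrightarrow> t \<le> s"
  shows "top_of u = s"
  using assms unfolding top_of_def by (auto intro: Greatest_equality)

text \<open>Below \<open>u\<close> the support can only shrink, and a subset of a chain is a chain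
  with a maximum at most as large.\<close>

lemma chain_degree_mono:
  assumes "chain_degree u" "w \<in> degrees" "\<And>s. 0 \<le> w s" "\<And>s. w s \<le> u s"
  shows "chain_degree w" "top_of w \<le> top_of u"
proof -
  have sub: "supp w \<subseteq> supp u"
  proof
    fix s assume "s \<in> supp w"
    then show "s \<in> supp u" using assms(3,4)[of s] by (simp add: supp_def)
  qed
  show w: "chain_degree w"
    using assms(1-3) sub unfolding chain_degree_def order_complex_UNIV by blast
  show "top_of w \<le> top_of u"
  proof (cases "supp w = {}")
    case True
    then show ?thesis by (simp add: top_of_def)
  next
    case False
    then show ?thesis using top_of_greatest(1)[OF w] le_top_of[OF assms(1)] sub by blast
  qed
qed

lemma valid_elem_mono [simp]: "valid_mono (elem_mono s)"
  by (simp add: elem_mono_def valid_mono_def)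

lemma elem_degree_apply: "elem_degree s t = (if t = s \<and> s \<noteq> bot then 1 else 0)"
  by (simp add: mono_degree_def elem_mono_def Poly_Mapping.lookup_single when_def)

lemma supp_add_elem_degree:
  fixes u :: "'p::order_bot \<Rightarrow> int"
  assumes "\<And>t. 0 \<le> u t"
  shows "supp (u + elem_degree s) = supp u \<union> ({s} - {bot})"
  using assms by (auto simp: supp_def elem_degree_apply add_nonneg_eq_0_iff dest: order_antisym)

lemma supp_zero [simp]: "supp 0 = {}"
  by (simp add: supp_def)

lemma chain_degree_zero [simp]: "chain_degree 0"
  by (simp add: chain_degree_def order_complex_UNIV)

text \<open>In the degree of \<open>x\<^sub>t x\<^sub>s\<close> the components at \<open>t\<close>
  and at \<open>s\<close> meet: each is mapped into it by the other variable. The cases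
  \<open>t = s\<close> and \<open>t = bot\<close> are included.\<close>

lemma chain_degree_elem_degrees:
  assumes "t \<le> s"
  shows "chain_degree (elem_degree t + elem_degree s)" "top_of (elem_degree t + elem_degree s) = s"
proof -
  have "supp (elem_degree t) = {t} - {bot}"
    using supp_add_elem_degree[of 0 t] by simp
  then have supp: "supp (elem_degree t + elem_degree s) = ({t} - {bot}) \<union> ({s} - {bot})"
    using supp_add_elem_degree[of "elem_degree t" s] by (simp add: mono_degree_nonneg)
  show "chain_degree (elem_degree t + elem_degree s)"
    unfolding chain_degree_def supp order_complex_UNIV using assms
    by (auto simp: mono_degree_nonneg)
  show "top_of (elem_degree t + elem_degree s) = s"
  proof (cases "s = bot")
    case True
    then have "t = bot" using assms by (simp add: bot_unique)
    then show ?thesis using True supp by (simp add: top_of_def)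
  next
    case False
    then show ?thesis using assms by (intro top_of_eqI) (auto simp: supp)
  qed
qed

lemma elem_degree_bot [simp]: "elem_degree bot = 0"
  by (simp add: elem_mono_def)

lemma chain_degree_elem [simp]: "chain_degree (elem_degree s)" "top_of (elem_degree s) = s"
  using chain_degree_elem_degrees[of bot s] by simp_all

lemma elem_degree_top_le:
  assumes "chain_degree u"
  shows "elem_degree (top_of u) t \<le> u t"
proof (cases "supp u = {}")
  case True
  then show ?thesis using assms by (simp add: top_of_def chain_degree_def)
next
  case False
  then have "u (top_of u) \<noteq> 0" using top_of_greatest(1)[OF assms] by (simp add: supp_def)
  moreover have "0 \<le> u t" "0 \<le> u (top_of u)" using assms by (auto simp: chain_degree_def)
  ultimately show ?thesis by (auto simp: elem_degree_apply)
qed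

text \<open>Finiteness of \<open>'p\<close> supplies the finite support. Negative exponents are cut
  to zero by \<open>nat\<close>, so the inverse relation with \<open>mono_degree\<close> is stated
  for nonnegative degrees.\<close>

definition mono_of :: "('p::finite \<Rightarrow> int) \<Rightarrow> 'p \<Rightarrow>\<^sub>0 nat" where
  "mono_of u = Abs_poly_mapping (\<lambda>s. nat (u s))"

lemma mono_degree_mono_of: "(\<And>s. 0 \<le> u s) \<Longrightarrow> mono_degree (mono_of u) = u"
  by (simp add: mono_of_def mono_degree_def fun_eq_iff Abs_poly_mapping_inverse)

lemma mono_of_mono_degree [simp]: "mono_of (mono_degree a) = a"
  using mono_degree_mono_of[of "mono_degree a"] by (simp add: mono_degree_inj mono_degree_nonneg)

lemma valid_mono_of: "u \<in> degrees \<Longrightarrow> valid_mono (mono_of u)"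
  by (simp add: valid_mono_def mono_of_def degrees_def in_keys_iff Abs_poly_mapping_inverse)

text \<open>The monomial of degree \<open>u\<close> divided by the variable at the top of its
  support; the quotient is a genuine monomial for chain-supported \<open>u\<close> by
  \<open>elem_degree_top_le\<close>.\<close>

definition cofactor :: "('p::{finite,order_bot} \<Rightarrow> int) \<Rightarrow> 'p \<Rightarrow>\<^sub>0 nat" where
  "cofactor u = mono_of (u - elem_degree (top_of u))"

lemma cofactor:
  assumes "chain_degree u"
  shows "elem_degree (top_of u) + mono_degree (cofactor u) = u" "valid_mono (cofactor u)"
proof -
  have "mono_degree (cofactor u) = u - elem_degree (top_of u)"
    unfolding cofactor_def
    by (rule mono_degree_mono_of) (use elem_degree_top_le[OF assms] in \<open>simp add: fun_diff_def\<close>)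
  then show "elem_degree (top_of u) + mono_degree (cofactor u) = u" by simp
  show "valid_mono (cofactor u)"
    unfolding cofactor_def by (rule valid_mono_of) (use assms in \<open>simp add: chain_degree_def\<close>)
qed

section \<open>Coefficient functions of a representation\<close>

text \<open>Dimension 0 off the chain-supported degrees encodes the vanishing of those components,
  without a case distinction in the construction of the module.\<close>

definition deg_dim :: "('p::{finite,order_bot}, 'k::field) rep \<Rightarrow> ('p \<Rightarrow> int) \<Rightarrow> nat" where
  "deg_dim V u = (if chain_degree u then fst V (top_of u) else 0)"

text \<open>Multiplication by the monomial of degree \<open>u - w\<close>, in coordinates. The zero
  matrix elsewhere is given the shape dictated by \<open>deg_dim\<close>, so all degrees are handled
  uniformly.\<close>

definition transition :: "('p::{finite,order_bot}, 'k::field) rep \<Rightarrow> ('p \<Rightarrow> int) \<Rightarrow> ('p \<Rightarrow> int) \<Rightarrow> 'k mat" where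
  "transition V w u = (if chain_degree w \<and> chain_degree u \<and> top_of w \<le> top_of u
     then snd V (top_of w) (top_of u) else 0\<^sub>m (deg_dim V u) (deg_dim V w))"

lemma mult_mat_zero_vec: "A \<in> carrier_mat m n \<Longrightarrow> A *\<^sub>v 0\<^sub>v n = 0\<^sub>v m"
  by (intro eq_vecI) auto

text \<open>Settles every matrix identity that starts or ends in a degree of dimension 0.\<close>

lemma empty_mat_eq:
  "A \<in> carrier_mat m n \<Longrightarrow> B \<in> carrier_mat m n \<Longrightarrow> m = 0 \<or> n = 0 \<Longrightarrow> A = B"
  by (intro eq_matI) auto

lemma transition_carrier:
  "is_rep V \<Longrightarrow> transition V w u \<in> carrier_mat (deg_dim V u) (deg_dim V w)"
  by (auto simp: transition_def deg_dim_def is_repD(1))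

lemma transition_id:
  assumes "is_rep V" shows "transition V u u = 1\<^sub>m (deg_dim V u)"
proof (cases "chain_degree u")
  case True
  then show ?thesis by (simp add: transition_def deg_dim_def is_repD(2)[OF assms])
next
  case False
  then show ?thesis using transition_carrier[OF assms, of u u]
    by (intro empty_mat_eq[of _ 0 0]) (auto simp: deg_dim_def)
qed

text \<open>If both ends are chain-supported, so is the middle degree, which lies between them, and
  the claim is functoriality of \<open>V\<close>. Otherwise both sides are matrices without rows or
  without columns.\<close>

lemma transition_comp:
  assumes V: "is_rep V"
  shows "transition V (w + mono_degree a) (w + mono_degree a + mono_degree b) * transition V w (w + mono_degree a) =
    transition V w (w + mono_degree a + mono_degree b)"
proof (cases "chain_degree w \<and> chain_degree (w + mono_degree a + mono_degree b)")
  case True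
  let ?u = "w + mono_degree a" let ?v = "?u + mono_degree b"
  have nn: "0 \<le> w s" for s using True by (simp add: chain_degree_def)
  \<comment> \<open>The monomials may a priori have exponents at \<open>bot\<close>; as these are
    nonnegative, vanishing at \<open>bot\<close> for both ends forces it in between.\<close>
  have "w bot = 0" "?v bot = 0" using True by (auto simp: chain_degree_def degrees_def)
  then have "?u \<in> degrees" using mono_degree_nonneg[of a bot] mono_degree_nonneg[of b bot]
    by (simp add: degrees_def)
  then have u: "chain_degree ?u" "top_of ?u \<le> top_of ?v"
    using chain_degree_mono[of ?v ?u] True nn by (auto simp: mono_degree_nonneg add_nonneg_nonneg)
  moreover have "top_of w \<le> top_of ?u"
    using chain_degree_mono(2)[of ?u w] u True nn by (auto simp: mono_degree_nonneg chain_degree_def)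
  ultimately show ?thesis
    using True order_trans[of "top_of w" "top_of ?u" "top_of ?v"] by (simp add: transition_def is_repD(3)[OF V])
next
  case False
  show ?thesis
    by (rule empty_mat_eq[OF mult_carrier_mat[OF transition_carrier[OF V] transition_carrier[OF V]] transition_carrier[OF V]])
      (use False in \<open>auto simp: deg_dim_def\<close>)
qed

text \<open>
  \<open>g u i\<close> is the \<open>i\<close>-th coordinate of the component of degree \<open>u\<close>, which is a copy of the space
  attached to the largest element of the support of \<open>u\<close>.
\<close>

type_synonym ('p, 'k) coeffs = "('p \<Rightarrow> int) \<Rightarrow> nat \<Rightarrow> 'k"

text \<open>An ambient set common to all representations. Finite support over a countable index set
  is what makes it embed into any type into which \<open>'k list\<close> embeds.\<close>

definition finite_coeffs :: "('p, 'k::zero) coeffs set" where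
  "finite_coeffs = {g. finite {(u, i). g u i \<noteq> 0}}"

definition rep_coeffs :: "('p::{finite,order_bot}, 'k::field) rep \<Rightarrow> ('p, 'k) coeffs set" where
  "rep_coeffs V = {g. finite {u. g u \<noteq> 0} \<and> (\<forall>u i. deg_dim V u \<le> i \<longrightarrow> g u i = 0)}"

definition vec_at :: "('p::{finite,order_bot}, 'k::field) rep \<Rightarrow> ('p \<Rightarrow> int) \<Rightarrow> ('p, 'k) coeffs \<Rightarrow> 'k vec" where
  "vec_at V u g = vec (deg_dim V u) (g u)"

text \<open>Padding with zeros gives the vectors of all dimensions one common type.\<close>

definition unvec :: "'k::zero vec \<Rightarrow> nat \<Rightarrow> 'k" where
  "unvec v i = (if i < dim_vec v then v $ i else 0)"

definition scale_coeffs :: "'k::field \<Rightarrow> ('p, 'k) coeffs \<Rightarrow> ('p, 'k) coeffs" where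
  "scale_coeffs c g = (\<lambda>u i. c * g u i)"

text \<open>The value in degree \<open>u\<close> is fetched from degree
  \<open>u - mono_degree a\<close>; should that degree have a negative entry, its dimension is 0 and
  the value is zero.\<close>

definition mono_act :: "('p::{finite,order_bot}, 'k::field) rep \<Rightarrow> ('p \<Rightarrow>\<^sub>0 nat) \<Rightarrow> ('p, 'k) coeffs \<Rightarrow> ('p, 'k) coeffs" where
  "mono_act V a g = (\<lambda>u. unvec (transition V (u - mono_degree a) u *\<^sub>v vec_at V (u - mono_degree a) g))"

definition poly_act :: "('p::{finite,order_bot}, 'k::field) rep \<Rightarrow> ('p, 'k) mpoly \<Rightarrow> ('p, 'k) coeffs \<Rightarrow> ('p, 'k) coeffs" where
  "poly_act V r g = (\<Sum>a\<in>Poly_Mapping.keys r. scale_coeffs (Poly_Mapping.lookup r a) (mono_act V a g))"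

lemma vec_at_carrier [simp]: "vec_at V u g \<in> carrier_vec (deg_dim V u)"
  by (simp add: vec_at_def)

lemma vec_at_add: "vec_at V u (g + h) = vec_at V u g + vec_at V u h"
  by (intro eq_vecI) (auto simp: vec_at_def)

lemma vec_at_scale: "vec_at V u (scale_coeffs c g) = c \<cdot>\<^sub>v vec_at V u g"
  by (intro eq_vecI) (auto simp: vec_at_def scale_coeffs_def)

lemma vec_at_unvec: "g u = unvec v \<Longrightarrow> v \<in> carrier_vec (deg_dim V u) \<Longrightarrow> vec_at V u g = v"
  by (intro eq_vecI) (auto simp: vec_at_def unvec_def)

lemma unvec_vec_at: "g \<in> rep_coeffs V \<Longrightarrow> unvec (vec_at V u g) = g u"
  by (auto simp: unvec_def vec_at_def rep_coeffs_def fun_eq_iff not_less)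


lemma unvec_zero [simp]: "unvec (0\<^sub>v n) = 0"
  by (auto simp: unvec_def fun_eq_iff)

lemma unvec_inj: "v \<in> carrier_vec n \<Longrightarrow> w \<in> carrier_vec n \<Longrightarrow> unvec v = unvec w \<Longrightarrow> v = w"
  by (intro eq_vecI) (auto simp: unvec_def fun_eq_iff split: if_splits)

lemma scale_coeffs_simps:
  "scale_coeffs c (g + h) = scale_coeffs c g + scale_coeffs c h"
  "scale_coeffs (c + d) g = scale_coeffs c g + scale_coeffs d g"
  "scale_coeffs c (scale_coeffs d g) = scale_coeffs (c * d) g"
  "scale_coeffs 1 g = g" "scale_coeffs 0 g = 0" "scale_coeffs c 0 = 0"
  by (auto simp: scale_coeffs_def fun_eq_iff algebra_simps)

lemma rep_coeffsI:
  "finite {u. g u \<noteq> 0} \<Longrightarrow> (\<And>u i. deg_dim V u \<le> i \<Longrightarrow> g u i = 0) \<Longrightarrow> g \<in> rep_coeffs V"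
  by (simp add: rep_coeffs_def)

lemma rep_coeffs_closed:
  shows "g \<in> rep_coeffs V \<Longrightarrow> h \<in> rep_coeffs V \<Longrightarrow> g + h \<in> rep_coeffs V"
    and "g \<in> rep_coeffs V \<Longrightarrow> scale_coeffs c g \<in> rep_coeffs V"
    and "g \<in> rep_coeffs V \<Longrightarrow> - g \<in> rep_coeffs V"
    and "0 \<in> rep_coeffs V"
proof -
  assume g: "g \<in> rep_coeffs V"
  show "g + h \<in> rep_coeffs V" if "h \<in> rep_coeffs V"
  proof (rule rep_coeffsI)
    show "finite {u. (g + h) u \<noteq> 0}"
      by (rule finite_subset[of _ "{u. g u \<noteq> 0} \<union> {u. h u \<noteq> 0}"]) (use g that in \<open>auto simp: rep_coeffs_def\<close>)
  qed (use g that in \<open>simp add: rep_coeffs_def\<close>)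
  show "scale_coeffs c g \<in> rep_coeffs V"
  proof (rule rep_coeffsI)
    show "finite {u. scale_coeffs c g u \<noteq> 0}"
      by (rule finite_subset[of _ "{u. g u \<noteq> 0}"]) (use g in \<open>auto simp: rep_coeffs_def scale_coeffs_def fun_eq_iff\<close>)
  qed (use g in \<open>simp add: rep_coeffs_def scale_coeffs_def\<close>)
  show "- g \<in> rep_coeffs V"
  proof (rule rep_coeffsI)
    show "finite {u. (- g) u \<noteq> 0}"
      by (rule finite_subset[of _ "{u. g u \<noteq> 0}"]) (use g in \<open>auto simp: rep_coeffs_def fun_eq_iff\<close>)
  qed (use g in \<open>simp add: rep_coeffs_def\<close>)
qed (simp add: rep_coeffs_def)

lemma rep_coeffs_finite: "rep_coeffs V \<subseteq> finite_coeffs"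
proof
  fix g assume g: "g \<in> rep_coeffs V"
  have "{(u, i). g u i \<noteq> 0} \<subseteq> (SIGMA u:{u. g u \<noteq> 0}. {..<deg_dim V u})"
    using g by (auto simp: rep_coeffs_def fun_eq_iff not_less[symmetric])
  then show "g \<in> finite_coeffs"
    unfolding finite_coeffs_def using g by (auto simp: rep_coeffs_def intro: finite_subset)
qed

section \<open>The action of polynomials on coefficient functions\<close>

context
  fixes V :: "('p::{finite,order_bot}, 'k::field) rep"
  assumes V: "is_rep V"
begin

lemma vec_at_mono_act:
  "vec_at V u (mono_act V a g) = transition V (u - mono_degree a) u *\<^sub>v vec_at V (u - mono_degree a) g"
  by (rule vec_at_unvec) (auto simp: mono_act_def intro!: mult_mat_vec_carrier[OF transition_carrier[OF V]])

lemma mono_act_closed: "g \<in> rep_coeffs V \<Longrightarrow> mono_act V a g \<in> rep_coeffs V"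
proof (rule rep_coeffsI)
  assume g: "g \<in> rep_coeffs V"
  have "g (u - mono_degree a) \<noteq> 0" if "mono_act V a g u \<noteq> 0" for u
  proof
    assume "g (u - mono_degree a) = 0"
    then have "vec_at V (u - mono_degree a) g = 0\<^sub>v (deg_dim V (u - mono_degree a))"
      by (intro eq_vecI) (auto simp: vec_at_def)
    then have "mono_act V a g u = unvec (0\<^sub>v (deg_dim V u))"
      using mult_mat_zero_vec[OF transition_carrier[OF V, of "u - mono_degree a" u]] by (simp add: mono_act_def)
    then show False using that by simp
  qed
  then have "{u. mono_act V a g u \<noteq> 0} \<subseteq> (\<lambda>u. u + mono_degree a) ` {u. g u \<noteq> 0}"
    by (auto intro!: image_eqI[of _ _ "_ - mono_degree a"])
  then show "finite {u. mono_act V a g u \<noteq> 0}"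
    using g by (auto simp: rep_coeffs_def intro: finite_subset)
  fix u i assume "deg_dim V u \<le> i"
  then show "mono_act V a g u i = 0"
    using transition_carrier[OF V, of "u - mono_degree a" u] by (simp add: mono_act_def unvec_def)
qed

lemma mono_act_add: "mono_act V a (g + h) = mono_act V a g + mono_act V a h"
proof (intro ext)
  fix u i
  let ?A = "transition V (u - mono_degree a) u" and ?v = "\<lambda>g. vec_at V (u - mono_degree a) g"
  have "?A *\<^sub>v ?v (g + h) = ?A *\<^sub>v ?v g + ?A *\<^sub>v ?v h"
    unfolding vec_at_add by (rule mult_add_distrib_mat_vec[OF transition_carrier[OF V]]) simp_all
  then show "mono_act V a (g + h) u i = (mono_act V a g + mono_act V a h) u i"
    unfolding mono_act_def plus_fun_apply by (simp add: unvec_def)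
qed

lemma mono_act_scale: "mono_act V a (scale_coeffs c g) = scale_coeffs c (mono_act V a g)"
  unfolding mono_act_def vec_at_scale mult_mat_vec[OF transition_carrier[OF V] vec_at_carrier]
  by (auto simp: fun_eq_iff unvec_def scale_coeffs_def)

lemma mono_act_zero: "g \<in> rep_coeffs V \<Longrightarrow> mono_act V 0 g = g"
  using unvec_vec_at[of g V] by (simp add: mono_act_def transition_id[OF V] fun_eq_iff)

text \<open>Associativity of the action is \<open>transition_comp\<close> in disguise, that is,
  functoriality of the representation.\<close>

lemma mono_act_mono_act: "mono_act V a (mono_act V b g) = mono_act V (a + b) g"
proof
  fix u
  let ?w = "u - mono_degree (a + b)"
  have eq: "?w + mono_degree b = u - mono_degree a" "?w + mono_degree b + mono_degree a = u"
    "u - mono_degree a - mono_degree b = ?w" by simp_all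
  have "transition V (u - mono_degree a) u * transition V ?w (u - mono_degree a) = transition V ?w u"
    using transition_comp[OF V, of ?w b a] by (simp only: eq diff_add_cancel)
  then have "transition V (u - mono_degree a) u *\<^sub>v (transition V ?w (u - mono_degree a) *\<^sub>v vec_at V ?w g) =
      transition V ?w u *\<^sub>v vec_at V ?w g"
    using assoc_mult_mat_vec[OF transition_carrier[OF V, of "u - mono_degree a" u]
      transition_carrier[OF V, of ?w "u - mono_degree a"] vec_at_carrier[of V ?w g]] by simp
  then show "mono_act V a (mono_act V b g) u = mono_act V (a + b) g u"
    unfolding mono_act_def[of V a] mono_act_def[of V "a + b"] vec_at_mono_act eq by simp
qed

text \<open>A common larger index set allows the actions of polynomials with different supports to
  be added term by term.\<close>

lemma poly_act_superset:
  assumes "finite A" "Poly_Mapping.keys r \<subseteq> A"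
  shows "poly_act V r g = (\<Sum>a\<in>A. scale_coeffs (Poly_Mapping.lookup r a) (mono_act V a g))"
  unfolding poly_act_def
  by (rule sum.mono_neutral_left) (use assms in \<open>auto simp: in_keys_iff scale_coeffs_simps\<close>)

lemma poly_act_single: "poly_act V (Poly_Mapping.single a c) g = scale_coeffs c (mono_act V a g)"
  by (subst poly_act_superset[of "{a}"]) auto

lemma poly_act_0: "poly_act V 0 g = 0"
  by (simp add: poly_act_def)

lemma poly_act_add_left: "poly_act V (r + s) g = poly_act V r g + poly_act V s g"
proof -
  let ?A = "Poly_Mapping.keys r \<union> Poly_Mapping.keys s"
  have "poly_act V (r + s) g = (\<Sum>a\<in>?A. scale_coeffs (Poly_Mapping.lookup (r + s) a) (mono_act V a g))"
    by (rule poly_act_superset) (use Poly_Mapping.keys_add[of r s] in auto)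
  also have "\<dots> = poly_act V r g + poly_act V s g"
    unfolding poly_act_superset[of ?A r g, simplified] poly_act_superset[of ?A s g, simplified]
    by (simp add: Poly_Mapping.lookup_add scale_coeffs_simps sum.distrib)
  finally show ?thesis .
qed

lemma poly_act_add_right: "poly_act V r (g + h) = poly_act V r g + poly_act V r h"
  by (simp add: poly_act_def mono_act_add scale_coeffs_simps sum.distrib)

lemma poly_act_closed:
  assumes "r \<in> carrier poly_ring" "g \<in> rep_coeffs V"
  shows "poly_act V r g \<in> rep_coeffs V"
  using assms(1)
proof (induction r rule: poly_ring_induct)
  case zero
  then show ?case unfolding poly_act_0 by (rule rep_coeffs_closed)
next
  case (single a c)
  then show ?case unfolding poly_act_single by (intro rep_coeffs_closed mono_act_closed assms(2))
next
  case (add r s)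
  show ?case unfolding poly_act_add_left by (rule rep_coeffs_closed(1)[OF add(3,4)])
qed

text \<open>Both sides are additive in \<open>r\<close> and in \<open>s\<close>, which reduces the
  claim to two single terms, where it is \<open>mono_act_mono_act\<close>.\<close>

lemma poly_act_mult:
  assumes "r \<in> carrier poly_ring" "s \<in> carrier poly_ring"
  shows "poly_act V (r * s) g = poly_act V r (poly_act V s g)"
  using assms(1)
proof (induction r rule: poly_ring_induct)
  case (single a c)
  show ?case using assms(2)
  proof (induction s rule: poly_ring_induct)
    case zero
    have "mono_act V a 0 = 0" using mono_act_add[of a 0 0] by simp
    then show ?case unfolding mult_zero_right poly_act_0 poly_act_single by (simp only: scale_coeffs_simps)
  next
    case (single b d)
    then show ?case
      by (simp add: Poly_Mapping.mult_single poly_act_single mono_act_scale scale_coeffs_simps mono_act_mono_act)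
  next
    case (add s t)
    then show ?case unfolding distrib_left poly_act_add_left poly_act_add_right by (simp only:)
  qed
next
  case (add r r')
  then show ?case unfolding distrib_right poly_act_add_left by (simp only:)
qed (simp add: poly_act_0)

lemma poly_act_one: "g \<in> rep_coeffs V \<Longrightarrow> poly_act V 1 g = g"
  using poly_act_single[of 0 1 g] by (simp add: mono_act_zero scale_coeffs_simps)

end

section \<open>The squarefree module of a representation\<close>

lemma sum_fun_apply: "(\<Sum>a\<in>A. f a) x = (\<Sum>a\<in>A. f a x)"
  for f :: "'a \<Rightarrow> 'b \<Rightarrow> 'c::comm_monoid_add"
  by (induction A rule: infinite_finite_induct) simp_all

text \<open>Short for concentrated: with \<open>v\<close> of the right dimension these are the
  homogeneous elements of degree \<open>u\<close>.\<close>

definition conc :: "('p \<Rightarrow> int) \<Rightarrow> 'k::field vec \<Rightarrow> ('p, 'k) coeffs" where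
  "conc u v = (\<lambda>w. if w = u then unvec v else 0)"

lemma conc_apply: "conc u v u = unvec v" "w \<noteq> u \<Longrightarrow> conc u v w = 0"
  by (simp_all add: conc_def)

lemma conc_zero [simp]: "conc u (0\<^sub>v n) = 0"
  unfolding conc_def unvec_zero by (auto simp: fun_eq_iff)

lemma conc_rep_coeffs [simp]:
  assumes "v \<in> carrier_vec (deg_dim V u)"
  shows "conc u v \<in> rep_coeffs V"
proof (rule rep_coeffsI)
  show "finite {w. conc u v w \<noteq> 0}"
    by (rule finite_subset[of _ "{u}"]) (auto simp: conc_def)
  fix w i assume "deg_dim V w \<le> i"
  then show "conc u v w i = 0" using assms by (auto simp: conc_def unvec_def)
qed

lemma conc_add: "v \<in> carrier_vec n \<Longrightarrow> w \<in> carrier_vec n \<Longrightarrow> conc u v + conc u w = conc u (v + w)"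
  by (intro ext) (auto simp: conc_def unvec_def)

lemma conc_scale: "scale_coeffs c (conc u v) = conc u (c \<cdot>\<^sub>v v)"
  by (intro ext) (auto simp: conc_def unvec_def scale_coeffs_def)

lemma vec_at_conc: "v \<in> carrier_vec (deg_dim V u) \<Longrightarrow> vec_at V u (conc u v) = v"
  by (rule vec_at_unvec[OF conc_apply(1)])

lemma conc_inj: "v \<in> carrier_vec n \<Longrightarrow> w \<in> carrier_vec n \<Longrightarrow> conc u v = conc u w \<Longrightarrow> v = w"
  by (metis conc_apply(1) unvec_inj)

lemma mono_act_conc:
  assumes V: "is_rep V" and v: "v \<in> carrier_vec (deg_dim V u)"
  shows "mono_act V a (conc u v) = conc (u + mono_degree a) (transition V u (u + mono_degree a) *\<^sub>v v)"
proof
  fix w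
  show "mono_act V a (conc u v) w = conc (u + mono_degree a) (transition V u (u + mono_degree a) *\<^sub>v v) w"
  proof (cases "w = u + mono_degree a")
    case True
    then have "w - mono_degree a = u" by simp
    then show ?thesis using True vec_at_conc[OF v] by (simp only: mono_act_def conc_apply)
  next
    case False
    then have "w - mono_degree a \<noteq> u" by auto
    then have "vec_at V (w - mono_degree a) (conc u v) = 0\<^sub>v (deg_dim V (w - mono_degree a))"
      by (intro eq_vecI) (auto simp: vec_at_def conc_def)
    then show ?thesis
      using False mult_mat_zero_vec[OF transition_carrier[OF V, of "w - mono_degree a" w]]
      by (simp only: mono_act_def conc_apply unvec_zero not_False_eq_True)
  qed
qed

lemma rep_coeffs_sum_conc:
  assumes g: "g \<in> rep_coeffs V"
  shows "(\<Sum>u\<in>{u. g u \<noteq> 0}. conc u (vec_at V u g)) = g"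
proof
  fix w
  have "(\<Sum>u\<in>{u. g u \<noteq> 0}. conc u (vec_at V u g)) w = (\<Sum>u\<in>{u. g u \<noteq> 0}. if w = u then g u else 0)"
    by (subst sum_fun_apply, rule sum.cong) (auto simp: conc_def unvec_vec_at[OF g])
  also have "\<dots> = g w"
    using g by (auto simp: rep_coeffs_def sum.delta)
  finally show "(\<Sum>u\<in>{u. g u \<noteq> 0}. conc u (vec_at V u g)) w = g w" .
qed

lemma shift_unit_vec: "(\<lambda>s. u s + Defs.unit_vec t s) = u + mono_degree (Poly_Mapping.single t 1)"
  by (auto simp: Defs.unit_vec_def mono_degree_def fun_eq_iff Poly_Mapping.lookup_single when_def)

text \<open>
  The multiplications decode on all of \<open>finite_coeffs\<close> rather than on \<open>rep_coeffs V\<close>, so that a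
  single decoding map serves all representations.
\<close>

definition rep_module ::
  "(('p, 'k) coeffs \<Rightarrow> 'm) \<Rightarrow> ('p::{finite,order_bot}, 'k::field) rep \<Rightarrow> ('p, 'k, 'm) gr_mod" where
  "rep_module enc V =
    \<lparr>carrier = enc ` rep_coeffs V, monoid.mult = undefined, one = undefined, zero = enc 0,
     add = (\<lambda>x y. enc (inv_into finite_coeffs enc x + inv_into finite_coeffs enc y)),
     module.smult = (\<lambda>r x. enc (poly_act V r (inv_into finite_coeffs enc x))),
     hcomp = (\<lambda>u. (\<lambda>v. enc (conc u v)) ` carrier_vec (deg_dim V u))\<rparr>"

text \<open>All that is asked of the element type \<open>'m\<close> is room for the finitely
  supported coefficient functions.\<close>

locale coeff_embedding =
  fixes enc :: "('p::{finite,order_bot}, 'k::field) coeffs \<Rightarrow> 'm"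
  assumes inj_enc: "inj_on enc finite_coeffs"
begin

abbreviation RM :: "('p, 'k) rep \<Rightarrow> ('p, 'k, 'm) gr_mod" where
  "RM \<equiv> rep_module enc"

definition dec :: "'m \<Rightarrow> ('p, 'k) coeffs" where
  "dec = inv_into finite_coeffs enc"

lemma dec_enc: "g \<in> rep_coeffs V \<Longrightarrow> dec (enc g) = g"
  unfolding dec_def using inv_into_f_f[OF inj_enc] rep_coeffs_finite by blast

lemma enc_inj: "g \<in> rep_coeffs V \<Longrightarrow> h \<in> rep_coeffs V \<Longrightarrow> enc g = enc h \<longleftrightarrow> g = h"
  by (metis dec_enc)

lemma RM_carrier: "carrier (RM V) = enc ` rep_coeffs V"
  by (simp add: rep_module_def)

lemma RM_zero: "\<zero>\<^bsub>RM V\<^esub> = enc 0"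
  by (simp add: rep_module_def)

lemma RM_add: "g \<in> rep_coeffs V \<Longrightarrow> h \<in> rep_coeffs V \<Longrightarrow> enc g \<oplus>\<^bsub>RM V\<^esub> enc h = enc (g + h)"
  by (simp add: rep_module_def dec_enc[unfolded dec_def] del: plus_fun_apply)

lemma RM_smult: "g \<in> rep_coeffs V \<Longrightarrow> r \<odot>\<^bsub>RM V\<^esub> enc g = enc (poly_act V r g)"
  by (simp add: rep_module_def dec_enc[unfolded dec_def])

lemma RM_hcomp: "hcomp (RM V) u = (\<lambda>v. enc (conc u v)) ` carrier_vec (deg_dim V u)"
  by (simp add: rep_module_def)

lemmas RM_simps = RM_zero RM_add RM_smult

lemma RM_smult_conc:
  assumes "is_rep V" "v \<in> carrier_vec (deg_dim V u)"
  shows "Poly_Mapping.single a c \<odot>\<^bsub>RM V\<^esub> enc (conc u v) =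
    enc (conc (u + mono_degree a) (c \<cdot>\<^sub>v (transition V u (u + mono_degree a) *\<^sub>v v)))"
  using assms by (simp only: RM_smult conc_rep_coeffs poly_act_single mono_act_conc conc_scale)

lemma module_RM:
  assumes V: "is_rep V" shows "module poly_ring (RM V)"
proof (intro module.intro cring_poly_ring abelian_groupI module_axioms.intro)
  note cl = rep_coeffs_closed[where V = V] poly_act_closed[OF V]
  fix x y z assume "x \<in> carrier (RM V)" "y \<in> carrier (RM V)" "z \<in> carrier (RM V)"
  then obtain g h k where g: "g \<in> rep_coeffs V" "x = enc g" and h: "h \<in> rep_coeffs V" "y = enc h"
    and k: "k \<in> rep_coeffs V" "z = enc k" by (auto simp: RM_carrier)
  show "x \<oplus>\<^bsub>RM V\<^esub> y \<in> carrier (RM V)"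
    unfolding g(2) h(2) RM_add[OF g(1) h(1)] RM_carrier using cl(1) g(1) h(1) by blast
  show "x \<oplus>\<^bsub>RM V\<^esub> y \<oplus>\<^bsub>RM V\<^esub> z = x \<oplus>\<^bsub>RM V\<^esub> (y \<oplus>\<^bsub>RM V\<^esub> z)"
    using g h k by (simp only: RM_simps cl add.assoc)
  show "x \<oplus>\<^bsub>RM V\<^esub> y = y \<oplus>\<^bsub>RM V\<^esub> x"
    using g h by (simp only: RM_simps add.commute)
  show "\<zero>\<^bsub>RM V\<^esub> \<oplus>\<^bsub>RM V\<^esub> x = x"
    using g by (simp only: RM_simps cl add_0)
  show "\<exists>y\<in>carrier (RM V). y \<oplus>\<^bsub>RM V\<^esub> x = \<zero>\<^bsub>RM V\<^esub>"
    by (rule bexI[of _ "enc (- g)"]) (simp_all only: g RM_simps cl RM_carrier ab_left_minus imageI)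
next
  note cl = rep_coeffs_closed[where V = V] poly_act_closed[OF V]
  show "\<zero>\<^bsub>RM V\<^esub> \<in> carrier (RM V)" by (simp only: RM_zero RM_carrier cl imageI)
next
  note cl = rep_coeffs_closed[where V = V] poly_act_closed[OF V]
  fix r s :: "('p, 'k) mpoly" and x assume rs: "r \<in> carrier poly_ring" "s \<in> carrier poly_ring" and "x \<in> carrier (RM V)"
  then obtain g where g: "g \<in> rep_coeffs V" "x = enc g" by (auto simp: RM_carrier)
  show "r \<odot>\<^bsub>RM V\<^esub> x \<in> carrier (RM V)"
    using g rs by (simp only: RM_simps cl RM_carrier imageI)
  show "(r \<oplus>\<^bsub>poly_ring\<^esub> s) \<odot>\<^bsub>RM V\<^esub> x = r \<odot>\<^bsub>RM V\<^esub> x \<oplus>\<^bsub>RM V\<^esub> s \<odot>\<^bsub>RM V\<^esub> x"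
    using g rs by (simp only: RM_simps cl poly_ring_simps poly_act_add_left[OF V])
  show "(r \<otimes>\<^bsub>poly_ring\<^esub> s) \<odot>\<^bsub>RM V\<^esub> x = r \<odot>\<^bsub>RM V\<^esub> (s \<odot>\<^bsub>RM V\<^esub> x)"
    using g rs by (simp only: RM_simps cl poly_ring_simps poly_act_mult[OF V])
next
  note cl = rep_coeffs_closed[where V = V] poly_act_closed[OF V]
  fix r :: "('p, 'k) mpoly" and x y
  assume r: "r \<in> carrier poly_ring" and "x \<in> carrier (RM V)" "y \<in> carrier (RM V)"
  then obtain g h where g: "g \<in> rep_coeffs V" "x = enc g" and h: "h \<in> rep_coeffs V" "y = enc h"
    by (auto simp: RM_carrier)
  show "r \<odot>\<^bsub>RM V\<^esub> (x \<oplus>\<^bsub>RM V\<^esub> y) = r \<odot>\<^bsub>RM V\<^esub> x \<oplus>\<^bsub>RM V\<^esub> r \<odot>\<^bsub>RM V\<^esub> y"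
    using g h r by (simp only: RM_simps cl poly_act_add_right[OF V])
next
  fix x assume "x \<in> carrier (RM V)"
  then show "\<one>\<^bsub>poly_ring\<^esub> \<odot>\<^bsub>RM V\<^esub> x = x"
    by (auto simp: RM_carrier RM_smult poly_act_one[OF V])
qed

text \<open>\<open>RM_add\<close> applies within \<open>rep_coeffs V\<close>, so membership of the
  partial sums has to travel along with the induction.\<close>

lemma RM_finsum:
  assumes V: "is_rep V" and "finite A" "\<And>a. a \<in> A \<Longrightarrow> f a \<in> rep_coeffs V"
  shows "(\<Oplus>\<^bsub>RM V\<^esub>a\<in>A. enc (f a)) = enc (\<Sum>a\<in>A. f a)" "(\<Sum>a\<in>A. f a) \<in> rep_coeffs V"
proof -
  interpret module poly_ring "RM V" by (rule module_RM[OF V])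
  have "(\<Oplus>\<^bsub>RM V\<^esub>a\<in>A. enc (f a)) = enc (\<Sum>a\<in>A. f a) \<and> (\<Sum>a\<in>A. f a) \<in> rep_coeffs V"
    using assms(2,3)
  proof (induction A)
    case empty
    show ?case unfolding M.finsum_empty sum.empty RM_zero using rep_coeffs_closed(4) by blast
  next
    case (insert a A)
    have fa: "f b \<in> rep_coeffs V" if "b \<in> insert a A" for b using insert.prems that .
    have IH: "(\<Oplus>\<^bsub>RM V\<^esub>a\<in>A. enc (f a)) = enc (\<Sum>a\<in>A. f a)" "(\<Sum>a\<in>A. f a) \<in> rep_coeffs V"
      using insert by auto
    have "(\<Oplus>\<^bsub>RM V\<^esub>a\<in>insert a A. enc (f a)) = enc (f a) \<oplus>\<^bsub>RM V\<^esub> (\<Oplus>\<^bsub>RM V\<^esub>a\<in>A. enc (f a))"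
      by (rule M.finsum_insert) (use insert.hyps fa in \<open>auto simp: RM_carrier\<close>)
    moreover have "f a + (\<Sum>a\<in>A. f a) \<in> rep_coeffs V" using rep_coeffs_closed(1) fa IH(2) by blast
    ultimately show ?case
      unfolding IH(1) sum.insert[OF insert.hyps] using RM_add[OF fa IH(2), of a] by (simp del: plus_fun_apply)
  qed
  then show "(\<Oplus>\<^bsub>RM V\<^esub>a\<in>A. enc (f a)) = enc (\<Sum>a\<in>A. f a)" "(\<Sum>a\<in>A. f a) \<in> rep_coeffs V" by auto
qed

lemma conc_eq_zero:
  fixes V :: "('p, 'k) rep"
  shows "v \<in> carrier_vec (deg_dim V u) \<Longrightarrow> enc (conc u v) = enc 0 \<longleftrightarrow> unvec v = 0"
proof -
  assume v: "v \<in> carrier_vec (deg_dim V u)"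
  have "enc (conc u v) = enc 0 \<longleftrightarrow> conc u v = 0"
    by (rule enc_inj[OF conc_rep_coeffs[OF v] rep_coeffs_closed(4)])
  also have "\<dots> \<longleftrightarrow> unvec v = 0"
    by (auto simp: conc_def fun_eq_iff)
  finally show ?thesis .
qed

lemma graded_module_RM:
  assumes V: "is_rep V"
  shows "graded_module (RM V)"
  unfolding graded_module_def
proof (intro conjI ballI allI impI)
  show "module poly_ring (RM V)" by (rule module_RM[OF V])
  interpret module poly_ring "RM V" by (rule module_RM[OF V])
  show "additive_subgroup (hcomp (RM V) u) (RM V)" for u
  proof (intro additive_subgroup.intro M.add.subgroupI)
    show "hcomp (RM V) u \<subseteq> carrier (RM V)" by (auto simp: RM_hcomp RM_carrier)
    show "hcomp (RM V) u \<noteq> {}" unfolding RM_hcomp using zero_carrier_vec[of "deg_dim V u"] by blast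
    fix x assume "x \<in> hcomp (RM V) u"
    then obtain v where v: "v \<in> carrier_vec (deg_dim V u)" "x = enc (conc u v)" by (auto simp: RM_hcomp)
    have "enc (conc u (- v)) \<oplus>\<^bsub>RM V\<^esub> x = \<zero>\<^bsub>RM V\<^esub>"
      using v by (simp add: RM_simps conc_add[of _ "deg_dim V u"])
    then have "\<ominus>\<^bsub>RM V\<^esub> x = enc (conc u (- v))"
      using v by (intro M.minus_equality) (auto simp: RM_carrier)
    then show "\<ominus>\<^bsub>RM V\<^esub> x \<in> hcomp (RM V) u"
      using v by (auto simp: RM_hcomp)
    fix y assume "y \<in> hcomp (RM V) u"
    then obtain w where w: "w \<in> carrier_vec (deg_dim V u)" "y = enc (conc u w)" by (auto simp: RM_hcomp)
    show "x \<oplus>\<^bsub>RM V\<^esub> y \<in> hcomp (RM V) u"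
      using v w by (auto simp: RM_hcomp RM_add conc_add[of _ "deg_dim V u"])
  qed
next
  fix a :: "'p \<Rightarrow>\<^sub>0 nat" and r :: 'k and u x
  assume "x \<in> hcomp (RM V) u"
  then obtain v where v: "v \<in> carrier_vec (deg_dim V u)" "x = enc (conc u v)" by (auto simp: RM_hcomp)
  show "Poly_Mapping.single a r \<odot>\<^bsub>RM V\<^esub> x \<in> hcomp (RM V) (\<lambda>s. u s + int (Poly_Mapping.lookup a s))"
    unfolding shift_eq v(2) RM_smult_conc[OF V v(1)]
    using mult_mat_vec_carrier[OF transition_carrier[OF V] v(1)] by (auto simp: RM_hcomp)
next
  fix x assume "x \<in> carrier (RM V)"
  then obtain g where g: "g \<in> rep_coeffs V" "x = enc g" by (auto simp: RM_carrier)
  let ?c = "\<lambda>u. enc (conc u (vec_at V u g))"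
  have c0: "?c u = \<zero>\<^bsub>RM V\<^esub> \<longleftrightarrow> g u = 0" for u
    unfolding RM_zero conc_eq_zero[OF vec_at_carrier] unvec_vec_at[OF g(1)] ..
  have dim0: "deg_dim V u = 0" if "u \<notin> degrees" for u
    using that by (simp add: deg_dim_def chain_degree_def)
  show "\<exists>!c. (\<forall>u\<in>degrees. c u \<in> hcomp (RM V) u) \<and> (\<forall>u. u \<notin> degrees \<longrightarrow> c u = \<zero>\<^bsub>RM V\<^esub>) \<and>
        finite {u. c u \<noteq> \<zero>\<^bsub>RM V\<^esub>} \<and> x = (\<Oplus>\<^bsub>RM V\<^esub>u\<in>{u. c u \<noteq> \<zero>\<^bsub>RM V\<^esub>}. c u)"
  proof (intro ex1I[of _ ?c] conjI ballI allI impI)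
    show "?c u \<in> hcomp (RM V) u" for u by (auto simp: RM_hcomp)
    show "?c u = \<zero>\<^bsub>RM V\<^esub>" if "u \<notin> degrees" for u
      using dim0[OF that] g(1) unfolding c0 by (auto simp: rep_coeffs_def)
    show fin: "finite {u. ?c u \<noteq> \<zero>\<^bsub>RM V\<^esub>}"
      unfolding c0 using g(1) by (simp add: rep_coeffs_def)
    have "(\<Oplus>\<^bsub>RM V\<^esub>u\<in>{u. g u \<noteq> 0}. ?c u) = enc (\<Sum>u\<in>{u. g u \<noteq> 0}. conc u (vec_at V u g))"
      by (rule RM_finsum[OF V]) (use fin in \<open>simp_all add: c0\<close>)
    then show "x = (\<Oplus>\<^bsub>RM V\<^esub>u\<in>{u. ?c u \<noteq> \<zero>\<^bsub>RM V\<^esub>}. ?c u)"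
      unfolding c0 rep_coeffs_sum_conc[OF g(1)] g(2) by simp
  next
    fix c assume c: "(\<forall>u\<in>degrees. c u \<in> hcomp (RM V) u) \<and> (\<forall>u. u \<notin> degrees \<longrightarrow> c u = \<zero>\<^bsub>RM V\<^esub>) \<and>
        finite {u. c u \<noteq> \<zero>\<^bsub>RM V\<^esub>} \<and> x = (\<Oplus>\<^bsub>RM V\<^esub>u\<in>{u. c u \<noteq> \<zero>\<^bsub>RM V\<^esub>}. c u)"
    \<comment> \<open>For uniqueness, the members of another decomposition are encoded vectors
      \<open>v u\<close>. As \<open>enc\<close> is injective, \<open>g\<close> is the sum of the
      functions \<open>conc u (v u)\<close>, and evaluation at a degree recovers each
      summand.\<close>
    have "\<exists>v\<in>carrier_vec (deg_dim V u). c u = enc (conc u v)" for u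
    proof (cases "u \<in> degrees")
      case True
      then show ?thesis using c by (auto simp: RM_hcomp)
    next
      case False
      then show ?thesis using c by (intro bexI[of _ "0\<^sub>v (deg_dim V u)"]) (simp_all add: RM_zero)
    qed
    then obtain v where v: "\<And>u. v u \<in> carrier_vec (deg_dim V u)" "\<And>u. c u = enc (conc u (v u))" by metis
    let ?U = "{u. c u \<noteq> \<zero>\<^bsub>RM V\<^esub>}"
    have U: "finite ?U" using c by blast
    have "enc g = (\<Oplus>\<^bsub>RM V\<^esub>u\<in>?U. enc (conc u (v u)))"
      using c g(2) v(2) by simp
    also have "\<dots> = enc (\<Sum>u\<in>?U. conc u (v u))"
      by (rule RM_finsum[OF V U]) (use v in simp)
    finally have "g = (\<Sum>u\<in>?U. conc u (v u))"
      using enc_inj[OF g(1) RM_finsum(2)[OF V U]] v(1) by simp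
    then have "g w = (\<Sum>u\<in>?U. if w = u then unvec (v u) else 0)" for w
      by (simp add: sum_fun_apply[where x = w] conc_def)
    then have "g w = (if w \<in> ?U then unvec (v w) else 0)" for w
      using U by (simp add: sum.delta)
    moreover have "unvec (v w) = 0" if "w \<notin> ?U" for w
      using that conc_eq_zero[OF v(1)] v(2) by (simp add: RM_zero)
    ultimately have "g w = unvec (v w)" for w by metis
    then show "c = ?c"
      using v vec_at_unvec by (metis (no_types, lifting) ext)
  qed
qed

lemma graded_mod_RM: "is_rep V \<Longrightarrow> graded_mod (RM V)"
  by (simp add: graded_mod_def graded_module_RM)

text \<open>Bases of the components in degree 0, contributed by \<open>s = bot\<close>, and in the
  degrees of the variables.\<close>

definition generators :: "('p, 'k) rep \<Rightarrow> 'm set" where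
  "generators V = (\<Union>s. (\<lambda>i. enc (conc (elem_degree s) (Matrix.unit_vec (fst V s) i))) ` {..<fst V s})"

lemma deg_dim_elem [simp]: "deg_dim V (elem_degree s) = fst V s"
  by (simp add: deg_dim_def)

lemma generators_span:
  assumes V: "is_rep V"
  shows "finite (generators V)" "generators V \<subseteq> carrier (RM V)"
    "carrier (RM V) \<subseteq> module_span poly_ring (RM V) (generators V)"
proof -
  interpret graded_mod "RM V" by (rule graded_mod_RM[OF V])
  show fin: "finite (generators V)" by (simp add: generators_def)
  show sub: "generators V \<subseteq> carrier (RM V)"
    by (auto simp: generators_def RM_carrier)
  let ?span = "module_span poly_ring (RM V) (generators V)"
  have elem: "enc (conc (elem_degree s) v) \<in> ?span" if "v \<in> carrier_vec (fst V s)" for s v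
  proof -
    interpret C: module scalars "vecs (fst V s) :: ('k, 'k vec) module" by (rule module_vecs)
    have "v \<in> module_span scalars (vecs (fst V s)) (Matrix.unit_vec (fst V s) ` {..<fst V s})"
      using vecs_span that by blast
    then show ?thesis using unit_vecs_generate(1,2)
    proof (induction rule: C.module_span_induct)
      case zero
      then show ?case
        using module_span_zero[OF fin sub] by (simp add: module_vec_simps RM_zero del: zero_fun_apply)
    next
      case (gen v)
      then show ?case by (intro module_span_incl[OF fin sub]) (auto simp: generators_def)
    next
      case (add v w)
      have "enc (conc (elem_degree s) v) \<oplus>\<^bsub>RM V\<^esub> enc (conc (elem_degree s) w) \<in> ?span"
        by (rule module_span_add[OF fin sub add(3,4)])
      then show ?case using add(1,2)
        by (simp add: RM_add module_vec_simps conc_add[of _ "fst V s"])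
    next
      case (smult r v)
      have v: "v \<in> carrier_vec (deg_dim V (elem_degree s))" using smult by (simp add: module_vec_simps)
      have "Poly_Mapping.single 0 r \<odot>\<^bsub>RM V\<^esub> enc (conc (elem_degree s) v) \<in> ?span"
        using smult by (intro module_span_smult[OF fin sub]) (auto simp: single_poly_ring)
      then show ?case
        unfolding RM_smult_conc[OF V v] using v transition_id[OF V] by (simp add: module_vec_simps)
    qed
  qed
  \<comment> \<open>For chain-supported \<open>u\<close> the transition from the degree of
    \<open>top_of u\<close> is an identity matrix, so multiplication by the cofactor reaches all of
    degree \<open>u\<close>.\<close>
  have conc: "enc (conc u v) \<in> ?span" if v: "v \<in> carrier_vec (deg_dim V u)" for u v
  proof (cases "chain_degree u")
    case True
    let ?s = "top_of u" let ?a = "cofactor u"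
    have u: "elem_degree ?s + mono_degree ?a = u" "valid_mono ?a" using cofactor[OF True] by auto
    have v': "v \<in> carrier_vec (deg_dim V (elem_degree ?s))" using v True by (simp add: deg_dim_def)
    have "transition V (elem_degree ?s) u = 1\<^sub>m (deg_dim V u)"
      using True is_repD(2)[OF V] by (simp add: transition_def deg_dim_def)
    then have "Poly_Mapping.single ?a 1 \<odot>\<^bsub>RM V\<^esub> enc (conc (elem_degree ?s) v) = enc (conc u v)"
      unfolding RM_smult_conc[OF V v'] u(1) using v by simp
    then show ?thesis
      using module_span_smult[OF fin sub elem single_poly_ring[OF u(2)], of v ?s 1] v' by simp
  next
    case False
    then have "v = 0\<^sub>v 0" using v by (auto simp: deg_dim_def)
    then show ?thesis using module_span_zero[OF fin sub] by (simp only: RM_zero conc_zero)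
  qed
  show "carrier (RM V) \<subseteq> ?span"
  proof
    fix x assume "x \<in> carrier (RM V)"
    then obtain g where g: "g \<in> rep_coeffs V" "x = enc g" by (auto simp: RM_carrier)
    have "finite {u. g u \<noteq> 0}" using g by (simp add: rep_coeffs_def)
    then have "x = (\<Oplus>\<^bsub>RM V\<^esub>u\<in>{u. g u \<noteq> 0}. enc (conc u (vec_at V u g)))"
      using RM_finsum(1)[OF V, of "{u. g u \<noteq> 0}" "\<lambda>u. conc u (vec_at V u g)"]
      by (simp add: rep_coeffs_sum_conc[OF g(1)] g(2))
    also have "\<dots> \<in> ?span"
      by (rule module_span_finsum[OF fin sub]) (use g in \<open>auto simp: rep_coeffs_def conc\<close>)
    finally show "x \<in> ?span" .
  qed
qed

lemma hcomp_RM_trivial: "\<not> chain_degree u \<Longrightarrow> hcomp (RM V) u = {\<zero>\<^bsub>RM V\<^esub>}"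
proof -
  assume "\<not> chain_degree u"
  then have "deg_dim V u = 0" by (simp add: deg_dim_def)
  moreover have z: "carrier_vec 0 = {0\<^sub>v 0 :: 'k vec}" by auto
  ultimately show ?thesis
    unfolding RM_hcomp RM_zero by (simp only: z image_insert image_empty conc_zero)
qed

text \<open>A variable \<open>x\<^sub>t\<close> with \<open>t\<close> below the top leaves the top
  of the support unchanged, hence acts by an identity matrix. The vanishing conditions hold because
  the dimension is 0 there.\<close>

lemma squarefree_module_RM:
  assumes V: "is_rep V"
  shows "squarefree_module (RM V)"
  unfolding squarefree_module_def
proof (intro conjI ballI allI impI)
  show "graded_module (RM V)" by (rule graded_module_RM[OF V])
  show "finitely_generated poly_ring (RM V)"
    unfolding finitely_generated_iff using generators_span[OF V] by blast
next
  fix u :: "'p \<Rightarrow> int" assume "\<not> (\<forall>s. 0 \<le> u s)"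
  then show "hcomp (RM V) u = {\<zero>\<^bsub>RM V\<^esub>}"
    by (intro hcomp_RM_trivial) (simp add: chain_degree_def)
next
  fix u :: "'p \<Rightarrow> int" assume "supp u \<notin> order_complex UNIV"
  then show "hcomp (RM V) u = {\<zero>\<^bsub>RM V\<^esub>}"
    by (intro hcomp_RM_trivial) (simp add: chain_degree_def)
next
  fix u :: "'p \<Rightarrow> int" and t
  let ?a = "Poly_Mapping.single t 1 :: 'p \<Rightarrow>\<^sub>0 nat" let ?w = "u + mono_degree ?a"
  assume u: "u \<in> degrees" "\<forall>s. 0 \<le> u s" "supp u \<in> order_complex UNIV" "supp u \<noteq> {}" and t: "t \<noteq> bot"
    and w: "supp (\<lambda>s. u s + Defs.unit_vec t s) \<in> order_complex UNIV"
    and tle: "t \<le> (GREATEST s. s \<in> supp u)"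
  have ta: "elem_mono t = ?a" using t by (simp add: elem_mono_def)
  have cu: "chain_degree u" using u by (simp add: chain_degree_def)
  have cw: "chain_degree ?w"
    using u w t mono_degree_nonneg[of ?a] degrees_simps(1)[OF valid_elem_mono[of t], of u]
    by (simp add: chain_degree_def shift_unit_vec ta)
  have top: "top_of ?w = top_of u"
    using top_of_greatest[OF cu u(4)] tle u(4) supp_add_elem_degree[of u t] u(2)
    by (intro top_of_eqI) (auto simp: ta top_of_def)
  have dim: "deg_dim V ?w = deg_dim V u" using cu cw top by (simp add: deg_dim_def)
  have "transition V u ?w = 1\<^sub>m (deg_dim V u)"
    using cu cw top is_repD(2)[OF V] by (simp add: transition_def deg_dim_def)
  then have eq: "poly_var t \<odot>\<^bsub>RM V\<^esub> enc (conc u v) = enc (conc ?w v)" if "v \<in> carrier_vec (deg_dim V u)" for v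
    unfolding poly_var_def RM_smult_conc[OF V that] using that by simp
  show "bij_betw (\<lambda>x. poly_var t \<odot>\<^bsub>RM V\<^esub> x) (hcomp (RM V) u) (hcomp (RM V) (\<lambda>s. u s + Defs.unit_vec t s))"
    unfolding shift_unit_vec bij_betw_def
  proof
    show "(\<lambda>x. poly_var t \<odot>\<^bsub>RM V\<^esub> x) ` hcomp (RM V) u = hcomp (RM V) ?w"
      unfolding RM_hcomp dim image_image by (rule image_cong) (simp_all add: eq)
    show "inj_on (\<lambda>x. poly_var t \<odot>\<^bsub>RM V\<^esub> x) (hcomp (RM V) u)"
    proof (rule inj_onI)
      fix x y assume "x \<in> hcomp (RM V) u" "y \<in> hcomp (RM V) u" and xy: "poly_var t \<odot>\<^bsub>RM V\<^esub> x = poly_var t \<odot>\<^bsub>RM V\<^esub> y"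
      then obtain v v' where v: "v \<in> carrier_vec (deg_dim V u)" "x = enc (conc u v)"
        "v' \<in> carrier_vec (deg_dim V u)" "y = enc (conc u v')" by (auto simp: RM_hcomp)
      have "enc (conc ?w v) = enc (conc ?w v')" using xy v by (simp add: eq)
      then have "conc ?w v = conc ?w v'"
        using v dim enc_inj[OF conc_rep_coeffs[of v V ?w] conc_rep_coeffs[of v' V ?w]] by simp
      then have "v = v'" using conc_inj v(1,3) by blast
      then show "x = y" using v by simp
    qed
  qed
qed

end

section \<open>The category of squarefree modules\<close>

lemma Sq_simps [simp]:
  "Ob Sq = {M. squarefree_module M}" "Hom Sq = gr_hom" "Id Sq M = (\<lambda>x\<in>carrier M. x)"
  "Comp Sq L M N g f = compose (carrier L) g f"
  by (simp_all add: Sq_def)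

lemma squarefree_moduleD:
  assumes "squarefree_module M"
  shows "graded_mod M" "module poly_ring M" "finitely_generated poly_ring M"
  using assms by (auto simp: squarefree_module_def graded_mod_def graded_module_def)

lemma gr_homD:
  assumes "f \<in> gr_hom M N"
  shows "f \<in> mod_hom poly_ring M N" "u \<in> degrees \<Longrightarrow> x \<in> hcomp M u \<Longrightarrow> f x \<in> hcomp N u"
    "linear_map poly_ring M N f" "f \<in> extensional (carrier M)" "x \<in> carrier M \<Longrightarrow> f x \<in> carrier N"
  using assms by (simp_all add: gr_hom_def mod_hom_iff linear_map_def image_subset_iff)

lemma gr_homI:
  "f \<in> mod_hom poly_ring M N \<Longrightarrow> (\<And>u x. u \<in> degrees \<Longrightarrow> x \<in> hcomp M u \<Longrightarrow> f x \<in> hcomp N u) \<Longrightarrow> f \<in> gr_hom M N"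
  by (auto simp: gr_hom_def)

lemma category_Sq: "category (Sq :: (('p::{finite,order_bot}, 'k::field, 'm) gr_mod, 'm \<Rightarrow> 'm) cat)"
  unfolding category_def
proof (intro conjI ballI)
  fix M :: "('p, 'k, 'm) gr_mod" assume "M \<in> Ob Sq"
  then have M: "squarefree_module M" by simp
  interpret graded_mod M by (rule squarefree_moduleD(1)[OF M])
  show "Id Sq M \<in> Hom Sq M M"
    using mod_hom_id[OF squarefree_moduleD(2)[OF M]] hcomp_closed(1) by (auto intro!: gr_homI)
next
  fix L M N :: "('p, 'k, 'm) gr_mod" and f g assume "L \<in> Ob Sq" "f \<in> Hom Sq L M" "g \<in> Hom Sq M N"
  then have L: "squarefree_module L" and f: "f \<in> gr_hom L M" and g: "g \<in> gr_hom M N" by simp_all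
  interpret graded_mod L by (rule squarefree_moduleD(1)[OF L])
  show "Comp Sq L M N g f \<in> Hom Sq L N"
    using mod_hom_compose[OF squarefree_moduleD(2)[OF L] gr_homD(1)[OF f] gr_homD(1)[OF g]]
      gr_homD(2)[OF f] gr_homD(2)[OF g] hcomp_closed(1)
    by (auto intro!: gr_homI simp: compose_def)
next
  fix M N :: "('p, 'k, 'm) gr_mod" and f assume "f \<in> Hom Sq M N"
  then have f: "f \<in> gr_hom M N" by simp
  show "Comp Sq M M N f (Id Sq M) = f" "Comp Sq M N N (Id Sq N) f = f"
    using compose_unit[OF gr_homD(4)[OF f] gr_homD(5)[OF f]] by simp_all
next
  fix K L M N :: "('p, 'k, 'm) gr_mod" and f g h assume "f \<in> Hom Sq K L"
  then have f: "f \<in> gr_hom K L" by simp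
  show "Comp Sq K M N h (Comp Sq K L M g f) = Comp Sq K L N (Comp Sq L M N h g) f"
    using compose_assoc'[OF gr_homD(5)[OF f]] by simp
qed

section \<open>Maps of coefficient functions induced by morphisms of representations\<close>

definition deg_matrix :: "('p::{finite,order_bot} \<Rightarrow> 'k::field mat) \<Rightarrow> ('p \<Rightarrow> int) \<Rightarrow> 'k mat" where
  "deg_matrix \<phi> u = (if chain_degree u then \<phi> (top_of u) else 0\<^sub>m 0 0)"

definition coeffs_map ::
  "('p::{finite,order_bot}, 'k::field) rep \<Rightarrow> ('p \<Rightarrow> 'k mat) \<Rightarrow> ('p, 'k) coeffs \<Rightarrow> ('p, 'k) coeffs" where
  "coeffs_map V \<phi> g = (\<lambda>u. unvec (deg_matrix \<phi> u *\<^sub>v vec_at V u g))"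

lemma deg_matrix_carrier:
  "\<phi> \<in> rep_hom V W \<Longrightarrow> deg_matrix \<phi> u \<in> carrier_mat (deg_dim W u) (deg_dim V u)"
  by (auto simp: deg_matrix_def deg_dim_def rep_homD(1))

lemma deg_matrix_elem [simp]: "deg_matrix \<phi> (elem_degree s) = \<phi> s"
  by (simp add: deg_matrix_def)

text \<open>Multiplication by a monomial can only raise the top of the support, so naturality on the
  poset passes to chain-supported degrees; in all others the matrices are empty.\<close>

lemma deg_matrix_transition:
  assumes V: "is_rep V" and W: "is_rep W" and \<phi>: "\<phi> \<in> rep_hom V W"
  shows "deg_matrix \<phi> (w + mono_degree a) * transition V w (w + mono_degree a) =
    transition W w (w + mono_degree a) * deg_matrix \<phi> w"
proof (cases "chain_degree w \<and> chain_degree (w + mono_degree a)")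
  case True
  then have "top_of w \<le> top_of (w + mono_degree a)"
    by (intro chain_degree_mono(2)) (auto simp: chain_degree_def mono_degree_nonneg)
  then show ?thesis
    using True rep_homD(2)[OF \<phi>] by (simp add: deg_matrix_def transition_def)
next
  case False
  note cV = transition_carrier[OF V, of w "w + mono_degree a"] and cW = transition_carrier[OF W, of w "w + mono_degree a"]
  show ?thesis
    by (rule empty_mat_eq[OF mult_carrier_mat[OF deg_matrix_carrier[OF \<phi>] cV] mult_carrier_mat[OF cW deg_matrix_carrier[OF \<phi>]]])
      (use False in \<open>auto simp: deg_dim_def\<close>)
qed

lemma vec_at_coeffs_map:
  "\<phi> \<in> rep_hom V W \<Longrightarrow> vec_at W u (coeffs_map V \<phi> g) = deg_matrix \<phi> u *\<^sub>v vec_at V u g"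
  by (rule vec_at_unvec) (auto simp: coeffs_map_def intro!: mult_mat_vec_carrier[OF deg_matrix_carrier])

lemma unvec_zero_vec_at: "g u = 0 \<Longrightarrow> vec_at V u g = 0\<^sub>v (deg_dim V u)"
  by (intro eq_vecI) (auto simp: vec_at_def)

lemma coeffs_map_closed:
  assumes \<phi>: "\<phi> \<in> rep_hom V W" and g: "g \<in> rep_coeffs V"
  shows "coeffs_map V \<phi> g \<in> rep_coeffs W"
proof (rule rep_coeffsI)
  have "coeffs_map V \<phi> g u = 0" if "g u = 0" for u
    unfolding coeffs_map_def unvec_zero_vec_at[of g u V, OF that] mult_mat_zero_vec[OF deg_matrix_carrier[OF \<phi>]] unvec_zero ..
  then have "{u. coeffs_map V \<phi> g u \<noteq> 0} \<subseteq> {u. g u \<noteq> 0}" by blast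
  then show "finite {u. coeffs_map V \<phi> g u \<noteq> 0}"
    using g by (auto simp: rep_coeffs_def intro: finite_subset)
  fix u i assume "deg_dim W u \<le> i"
  then show "coeffs_map V \<phi> g u i = 0"
    using deg_matrix_carrier[OF \<phi>, of u] by (simp add: coeffs_map_def unvec_def)
qed

lemma coeffs_map_add:
  assumes \<phi>: "\<phi> \<in> rep_hom V W"
  shows "coeffs_map V \<phi> (g + h) = coeffs_map V \<phi> g + coeffs_map V \<phi> h"
proof (intro ext)
  fix u i
  have "deg_matrix \<phi> u *\<^sub>v vec_at V u (g + h) = deg_matrix \<phi> u *\<^sub>v vec_at V u g + deg_matrix \<phi> u *\<^sub>v vec_at V u h"
    unfolding vec_at_add by (rule mult_add_distrib_mat_vec[OF deg_matrix_carrier[OF \<phi>]]) simp_all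
  then show "coeffs_map V \<phi> (g + h) u i = (coeffs_map V \<phi> g + coeffs_map V \<phi> h) u i"
    unfolding coeffs_map_def plus_fun_apply by (simp add: unvec_def)
qed

lemma coeffs_map_scale:
  assumes \<phi>: "\<phi> \<in> rep_hom V W"
  shows "coeffs_map V \<phi> (scale_coeffs c g) = scale_coeffs c (coeffs_map V \<phi> g)"
  unfolding coeffs_map_def vec_at_scale mult_mat_vec[OF deg_matrix_carrier[OF \<phi>] vec_at_carrier]
  by (auto simp: fun_eq_iff unvec_def scale_coeffs_def)

lemma coeffs_map_mono_act:
  assumes V: "is_rep V" and W: "is_rep W" and \<phi>: "\<phi> \<in> rep_hom V W"
  shows "coeffs_map V \<phi> (mono_act V a g) = mono_act W a (coeffs_map V \<phi> g)"
proof
  fix u let ?w = "u - mono_degree a"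
  note c = deg_matrix_carrier[OF \<phi>, of u] transition_carrier[OF V, of ?w u]
    transition_carrier[OF W, of ?w u] deg_matrix_carrier[OF \<phi>, of ?w] vec_at_carrier[of V ?w g]
  have "deg_matrix \<phi> u *\<^sub>v (transition V ?w u *\<^sub>v vec_at V ?w g) = transition W ?w u *\<^sub>v (deg_matrix \<phi> ?w *\<^sub>v vec_at V ?w g)"
    using deg_matrix_transition[OF V W \<phi>, of ?w a] assoc_mult_mat_vec[OF c(1,2,5)] assoc_mult_mat_vec[OF c(3,4,5)]
    by (simp only: diff_add_cancel)
  then show "coeffs_map V \<phi> (mono_act V a g) u = mono_act W a (coeffs_map V \<phi> g) u"
    unfolding coeffs_map_def[of V \<phi> "mono_act V a g"] mono_act_def[of W a] vec_at_mono_act[OF V] vec_at_coeffs_map[OF \<phi>]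
    by (simp only:)
qed

lemma coeffs_map_conc:
  assumes \<phi>: "\<phi> \<in> rep_hom V W" and v: "v \<in> carrier_vec (deg_dim V u)"
  shows "coeffs_map V \<phi> (conc u v) = conc u (deg_matrix \<phi> u *\<^sub>v v)"
proof
  fix w show "coeffs_map V \<phi> (conc u v) w = conc u (deg_matrix \<phi> u *\<^sub>v v) w"
  proof (cases "w = u")
    case True
    then show ?thesis using vec_at_conc[OF v] by (simp only: coeffs_map_def conc_apply)
  next
    case False
    then have "vec_at V w (conc u v) = 0\<^sub>v (deg_dim V w)"
      by (intro unvec_zero_vec_at conc_apply)
    then show ?thesis
      using False mult_mat_zero_vec[OF deg_matrix_carrier[OF \<phi>]]
      by (simp only: coeffs_map_def conc_apply unvec_zero not_False_eq_True)
  qed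
qed

context coeff_embedding begin

definition RM_map :: "('p, 'k) rep \<Rightarrow> ('p, 'k) rep \<Rightarrow> ('p \<Rightarrow> 'k mat) \<Rightarrow> 'm \<Rightarrow> 'm" where
  "RM_map V W \<phi> = (\<lambda>x\<in>carrier (RM V). enc (coeffs_map V \<phi> (dec x)))"

lemma RM_map_apply: "g \<in> rep_coeffs V \<Longrightarrow> RM_map V W \<phi> (enc g) = enc (coeffs_map V \<phi> g)"
  by (simp add: RM_map_def RM_carrier dec_enc)

lemma RM_map_gr_hom:
  assumes V: "is_rep V" and W: "is_rep W" and \<phi>: "\<phi> \<in> rep_hom V W"
  shows "RM_map V W \<phi> \<in> gr_hom (RM V) (RM W)"
proof (rule gr_homI)
  have "linear_map poly_ring (RM V) (RM W) (RM_map V W \<phi>)"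
  proof (rule linear_map_poly_ringI[OF module_RM[OF V] module_RM[OF W]])
    fix x assume "x \<in> carrier (RM V)"
    then obtain g where g: "g \<in> rep_coeffs V" "x = enc g" by (auto simp: RM_carrier)
    show "RM_map V W \<phi> x \<in> carrier (RM W)"
      using g by (auto simp: RM_map_apply RM_carrier coeffs_map_closed[OF \<phi>])
    fix a :: "'p \<Rightarrow>\<^sub>0 nat" and c :: 'k
    show "RM_map V W \<phi> (Poly_Mapping.single a c \<odot>\<^bsub>RM V\<^esub> x) = Poly_Mapping.single a c \<odot>\<^bsub>RM W\<^esub> RM_map V W \<phi> x"
      using g by (simp only: RM_smult RM_map_apply coeffs_map_closed[OF \<phi>] poly_act_single[OF V] poly_act_single[OF W]
        rep_coeffs_closed mono_act_closed[OF V] coeffs_map_scale[OF \<phi>] coeffs_map_mono_act[OF V W \<phi>])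
    fix y assume "y \<in> carrier (RM V)"
    then obtain h where h: "h \<in> rep_coeffs V" "y = enc h" by (auto simp: RM_carrier)
    show "RM_map V W \<phi> (x \<oplus>\<^bsub>RM V\<^esub> y) = RM_map V W \<phi> x \<oplus>\<^bsub>RM W\<^esub> RM_map V W \<phi> y"
      using g h by (simp only: RM_add RM_map_apply coeffs_map_closed[OF \<phi>] rep_coeffs_closed coeffs_map_add[OF \<phi>])
  qed
  then show "RM_map V W \<phi> \<in> mod_hom poly_ring (RM V) (RM W)"
    by (simp add: mod_hom_iff RM_map_def)
next
  fix u x assume "x \<in> hcomp (RM V) u"
  then obtain v where v: "v \<in> carrier_vec (deg_dim V u)" "x = enc (conc u v)" by (auto simp: RM_hcomp)
  then show "RM_map V W \<phi> x \<in> hcomp (RM W) u"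
    using mult_mat_vec_carrier[OF deg_matrix_carrier[OF \<phi>] v(1)]
    by (auto simp: RM_map_apply coeffs_map_conc[OF \<phi>] RM_hcomp)
qed

text \<open>The generators lie in the degrees \<open>elem_degree s\<close>. Testing there serves for
  the functor laws as well as for fullness.\<close>

lemma gr_hom_RM_eqI:
  assumes V: "is_rep V" and N: "module poly_ring N"
    and f: "f \<in> gr_hom (RM V) N" and g: "g \<in> gr_hom (RM V) N"
    and eq: "\<And>s v. v \<in> carrier_vec (fst V s) \<Longrightarrow> f (enc (conc (elem_degree s) v)) = g (enc (conc (elem_degree s) v))"
  shows "f = g"
proof (rule extensionalityI[OF gr_homD(4)[OF f] gr_homD(4)[OF g]])
  fix x assume x: "x \<in> carrier (RM V)"
  show "f x = g x"
    by (rule linear_map_eqI[OF module_RM[OF V] N gr_homD(3)[OF f] gr_homD(3)[OF g] generators_span[OF V] _ x])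
      (auto simp: generators_def eq)
qed

lemma RM_map_inj:
  assumes \<phi>: "\<phi> \<in> rep_hom V W" and \<psi>: "\<psi> \<in> rep_hom V W" and eq: "RM_map V W \<phi> = RM_map V W \<psi>"
  shows "\<phi> = \<psi>"
proof
  fix s
  show "\<phi> s = \<psi> s"
  proof (rule mat_eqI_mult_vec[OF rep_homD(1)[OF \<phi>] rep_homD(1)[OF \<psi>]])
    fix v :: "'k vec" assume v: "v \<in> carrier_vec (fst V s)"
    let ?e = "elem_degree s"
    have v': "v \<in> carrier_vec (deg_dim V ?e)" using v by simp
    have c: "\<phi> s *\<^sub>v v \<in> carrier_vec (deg_dim W ?e)" "\<psi> s *\<^sub>v v \<in> carrier_vec (deg_dim W ?e)"
      using mult_mat_vec_carrier[OF rep_homD(1)[OF \<phi>] v] mult_mat_vec_carrier[OF rep_homD(1)[OF \<psi>] v] by simp_all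
    have "enc (conc ?e (\<phi> s *\<^sub>v v)) = enc (conc ?e (\<psi> s *\<^sub>v v))"
      using fun_cong[OF eq, of "enc (conc ?e v)"]
      by (simp only: RM_map_apply conc_rep_coeffs[OF v'] coeffs_map_conc[OF \<phi> v'] coeffs_map_conc[OF \<psi> v'] deg_matrix_elem)
    then show "\<phi> s *\<^sub>v v = \<psi> s *\<^sub>v v"
      using enc_inj[OF conc_rep_coeffs[OF c(1)] conc_rep_coeffs[OF c(2)]] conc_inj[OF c] by simp
  qed
qed

text \<open>Linearity over constants turns \<open>f\<close> on the components at the elements
  \<open>s\<close> into matrices, linearity over variables makes these natural, and agreement on the
  generators identifies \<open>f\<close>.\<close>

lemma RM_map_surj:
  assumes V: "is_rep V" and W: "is_rep W" and f: "f \<in> gr_hom (RM V) (RM W)"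
  shows "f \<in> RM_map V W ` rep_hom V W"
proof -
  \<comment> \<open>The restriction of \<open>f\<close> to the component at \<open>s\<close>, read
    in coordinates; a graded map sends that component to the corresponding one.\<close>
  define h where "h s v = vec_at W (elem_degree s) (dec (f (enc (conc (elem_degree s) v))))" for s v
  have hc: "h s v \<in> carrier_vec (fst W s)" for s v
    using vec_at_carrier[of W "elem_degree s"] by (simp add: h_def)
  have fh: "f (enc (conc (elem_degree s) v)) = enc (conc (elem_degree s) (h s v))" if "v \<in> carrier_vec (fst V s)" for s v
  proof -
    have "enc (conc (elem_degree s) v) \<in> hcomp (RM V) (elem_degree s)" using that by (auto simp: RM_hcomp)
    then have "f (enc (conc (elem_degree s) v)) \<in> hcomp (RM W) (elem_degree s)"
      by (rule gr_homD(2)[OF f, rotated]) simp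
    then obtain w where w: "w \<in> carrier_vec (deg_dim W (elem_degree s))"
        "f (enc (conc (elem_degree s) v)) = enc (conc (elem_degree s) w)"
      unfolding RM_hcomp by auto
    then have "h s v = w" by (simp only: h_def dec_enc[OF conc_rep_coeffs] vec_at_conc)
    then show ?thesis using w by simp
  qed
  have inj: "v = w" if "enc (conc u v) = enc (conc u w)" "v \<in> carrier_vec (deg_dim W u)" "w \<in> carrier_vec (deg_dim W u)" for u v w
    using enc_inj[OF conc_rep_coeffs[OF that(2)] conc_rep_coeffs[OF that(3)]] that(1) conc_inj[OF that(2,3)] by simp
  note flin = linear_mapD[OF gr_homD(3)[OF f]]
  have lin: "linear_map scalars (vecs (fst V s)) (vecs (fst W s)) (h s)" for s
  proof (rule linear_mapI)
    fix v w :: "'k vec" assume "v \<in> carrier (vecs (fst V s))" "w \<in> carrier (vecs (fst V s))"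
    then have vw: "v \<in> carrier_vec (fst V s)" "w \<in> carrier_vec (fst V s)" by (simp_all add: module_vec_simps)
    then have r: "conc (elem_degree s) v \<in> rep_coeffs V" "conc (elem_degree s) w \<in> rep_coeffs V" by simp_all
    have r': "conc (elem_degree s) (h s v) \<in> rep_coeffs W" "conc (elem_degree s) (h s w) \<in> rep_coeffs W" using hc by simp_all
    have "f (enc (conc (elem_degree s) v) \<oplus>\<^bsub>RM V\<^esub> enc (conc (elem_degree s) w)) =
        f (enc (conc (elem_degree s) v)) \<oplus>\<^bsub>RM W\<^esub> f (enc (conc (elem_degree s) w))"
      by (rule flin(2)) (use r in \<open>auto simp: RM_carrier\<close>)
    then have "enc (conc (elem_degree s) (h s (v + w))) = enc (conc (elem_degree s) (h s v + h s w))"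
      using vw hc by (simp only: RM_add[OF r] fh RM_add[OF r'] conc_add[of _ "fst V s"] conc_add[of _ "fst W s"] add_carrier_vec)
    then have "h s (v + w) = h s v + h s w" by (rule inj) (use hc in simp_all)
    then show "h s (v \<oplus>\<^bsub>vecs (fst V s)\<^esub> w) = h s v \<oplus>\<^bsub>vecs (fst W s)\<^esub> h s w" by (simp add: module_vec_simps)
  next
    fix c and v :: "'k vec" assume "v \<in> carrier (vecs (fst V s))"
    then have v: "v \<in> carrier_vec (fst V s)" by (simp add: module_vec_simps)
    then have r: "conc (elem_degree s) v \<in> rep_coeffs V" by simp
    have r': "conc (elem_degree s) (h s v) \<in> rep_coeffs W" using hc by simp
    have m: "mono_act V 0 (conc (elem_degree s) v) = conc (elem_degree s) v"
      "mono_act W 0 (conc (elem_degree s) (h s v)) = conc (elem_degree s) (h s v)"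
      using mono_act_zero[OF V r] mono_act_zero[OF W r'] by blast+
    have "f (Poly_Mapping.single 0 c \<odot>\<^bsub>RM V\<^esub> enc (conc (elem_degree s) v)) =
        Poly_Mapping.single 0 c \<odot>\<^bsub>RM W\<^esub> f (enc (conc (elem_degree s) v))"
      by (rule flin(3)) (use r in \<open>auto simp: RM_carrier single_poly_ring\<close>)
    then have "enc (conc (elem_degree s) (h s (c \<cdot>\<^sub>v v))) = enc (conc (elem_degree s) (c \<cdot>\<^sub>v h s v))"
      using v by (simp only: RM_smult[OF r] fh RM_smult[OF r'] poly_act_single[OF V] poly_act_single[OF W] m conc_scale smult_carrier_vec)
    then have "h s (c \<cdot>\<^sub>v v) = c \<cdot>\<^sub>v h s v" by (rule inj) (use hc in simp_all)
    then show "h s (c \<odot>\<^bsub>vecs (fst V s)\<^esub> v) = c \<odot>\<^bsub>vecs (fst W s)\<^esub> h s v" by (simp add: module_vec_simps)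
  qed (use hc in \<open>simp add: module_vec_simps\<close>)
  define \<phi> where "\<phi> s = matrix_of (fst W s) (fst V s) (h s)" for s
  have \<phi>c: "\<phi> s \<in> carrier_mat (fst W s) (fst V s)" for s by (simp add: \<phi>_def)
  have \<phi>v: "\<phi> s *\<^sub>v v = h s v" if "v \<in> carrier_vec (fst V s)" for s v
    using matrix_of[OF lin that] by (simp add: \<phi>_def)
  have \<phi>: "\<phi> \<in> rep_hom V W"
    unfolding rep_hom_def
  proof (intro CollectI conjI allI impI \<phi>c)
    fix t s :: 'p assume ts: "t \<le> s"
    \<comment> \<open>The degree of \<open>x\<^sub>t x\<^sub>s\<close>. There
      \<open>x\<^sub>s\<close> acts on the component at \<open>t\<close> as
      \<open>snd U t s\<close>, and \<open>x\<^sub>t\<close> acts on the component at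
      \<open>s\<close> as the identity; a map that commutes with both variables is therefore
      natural.\<close>
    let ?w = "elem_degree t + elem_degree s"
    have w': "elem_degree s + elem_degree t = ?w" by (simp only: add.commute)
    note cw = chain_degree_elem_degrees[OF ts]
    have tr: "transition U (elem_degree t) ?w = snd U t s" "transition U (elem_degree s) ?w = 1\<^sub>m (fst U s)" "deg_dim U ?w = fst U s"
      if "is_rep U" for U :: "('p, 'k) rep"
      using cw ts is_repD(2)[OF that] by (simp_all add: transition_def deg_dim_def)
    show "\<phi> s * snd V t s = snd W t s * \<phi> t"
    proof (rule mat_eqI_mult_vec[OF mult_carrier_mat[OF \<phi>c is_repD(1)[OF V ts]] mult_carrier_mat[OF is_repD(1)[OF W ts] \<phi>c]])
      fix v :: "'k vec" assume v: "v \<in> carrier_vec (fst V t)"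
      let ?Av = "snd V t s *\<^sub>v v"
      have Av: "?Av \<in> carrier_vec (fst V s)" using mult_mat_vec_carrier[OF is_repD(1)[OF V ts] v] .
      have hA: "snd W t s *\<^sub>v h t v \<in> carrier_vec (fst W s)" using mult_mat_vec_carrier[OF is_repD(1)[OF W ts] hc] .
      have mult: "Poly_Mapping.single (elem_mono s) 1 \<odot>\<^bsub>RM U\<^esub> enc (conc (elem_degree t) x) =
          Poly_Mapping.single (elem_mono t) 1 \<odot>\<^bsub>RM U\<^esub> enc (conc (elem_degree s) (snd U t s *\<^sub>v x))"
        "Poly_Mapping.single (elem_mono s) 1 \<odot>\<^bsub>RM U\<^esub> enc (conc (elem_degree t) x) = enc (conc ?w (snd U t s *\<^sub>v x))"
        if U: "is_rep U" and x: "x \<in> carrier_vec (fst U t)" for U x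
      proof -
        have Ax: "snd U t s *\<^sub>v x \<in> carrier_vec (fst U s)" using mult_mat_vec_carrier[OF is_repD(1)[OF U ts] x] .
        show "Poly_Mapping.single (elem_mono s) 1 \<odot>\<^bsub>RM U\<^esub> enc (conc (elem_degree t) x) = enc (conc ?w (snd U t s *\<^sub>v x))"
          using RM_smult_conc[OF U, of x "elem_degree t" "elem_mono s" 1] x by (simp add: tr[OF U])
        moreover have "Poly_Mapping.single (elem_mono t) 1 \<odot>\<^bsub>RM U\<^esub> enc (conc (elem_degree s) (snd U t s *\<^sub>v x)) = enc (conc ?w (snd U t s *\<^sub>v x))"
          using RM_smult_conc[OF U, of "snd U t s *\<^sub>v x" "elem_degree s" "elem_mono t" 1] Ax by (simp add: w' tr[OF U])
        ultimately show "Poly_Mapping.single (elem_mono s) 1 \<odot>\<^bsub>RM U\<^esub> enc (conc (elem_degree t) x) =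
          Poly_Mapping.single (elem_mono t) 1 \<odot>\<^bsub>RM U\<^esub> enc (conc (elem_degree s) (snd U t s *\<^sub>v x))" by simp
      qed
      have fm: "f (Poly_Mapping.single (elem_mono r) 1 \<odot>\<^bsub>RM V\<^esub> enc (conc (elem_degree q) x)) =
          Poly_Mapping.single (elem_mono r) 1 \<odot>\<^bsub>RM W\<^esub> enc (conc (elem_degree q) (h q x))"
        if "x \<in> carrier_vec (fst V q)" for r q x
        using flin(3)[OF single_poly_ring[OF valid_elem_mono], of "enc (conc (elem_degree q) x)" r 1] that
        by (simp add: fh RM_carrier)
      have "enc (conc ?w (snd W t s *\<^sub>v h t v)) = f (Poly_Mapping.single (elem_mono s) 1 \<odot>\<^bsub>RM V\<^esub> enc (conc (elem_degree t) v))"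
        using mult(2)[OF W hc] fm[OF v] by simp
      also have "\<dots> = Poly_Mapping.single (elem_mono t) 1 \<odot>\<^bsub>RM W\<^esub> enc (conc (elem_degree s) (h s ?Av))"
        unfolding mult(1)[OF V v] by (rule fm[OF Av])
      also have "\<dots> = enc (conc ?w (h s ?Av))"
        using RM_smult_conc[OF W, of "h s ?Av" "elem_degree s" "elem_mono t" 1] hc by (simp add: w' tr[OF W])
      finally have "snd W t s *\<^sub>v h t v = h s ?Av" by (rule inj) (simp_all add: tr[OF W] hA hc)
      then show "\<phi> s * snd V t s *\<^sub>v v = snd W t s * \<phi> t *\<^sub>v v"
        using assoc_mult_mat_vec[OF \<phi>c is_repD(1)[OF V ts] v] assoc_mult_mat_vec[OF is_repD(1)[OF W ts] \<phi>c v]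
        by (simp add: \<phi>v v Av)
    qed
  qed
  have "f = RM_map V W \<phi>"
  proof (rule gr_hom_RM_eqI[OF V module_RM[OF W] f RM_map_gr_hom[OF V W \<phi>]])
    fix s and v :: "'k vec" assume v: "v \<in> carrier_vec (fst V s)"
    then have v': "v \<in> carrier_vec (deg_dim V (elem_degree s))" by simp
    show "f (enc (conc (elem_degree s) v)) = RM_map V W \<phi> (enc (conc (elem_degree s) v))"
      using v by (simp only: fh RM_map_apply conc_rep_coeffs[OF v'] coeffs_map_conc[OF \<phi> v'] deg_matrix_elem \<phi>v)
  qed
  then show ?thesis using \<phi> by blast
qed

lemma RM_functor:
  "is_functor (Rep :: (('p, 'k) rep, _) cat) Sq RM RM_map"
  "fully_faithful (Rep :: (('p, 'k) rep, _) cat) Sq RM RM_map"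
proof -
  show "is_functor (Rep :: (('p, 'k) rep, _) cat) Sq RM RM_map"
    unfolding is_functor_def
  proof (intro conjI ballI)
    fix V :: "('p, 'k) rep" assume "V \<in> Ob Rep"
    then have V: "is_rep V" by simp
    then show "RM V \<in> Ob Sq" using squarefree_module_RM by simp
    have id: "Id Rep V \<in> rep_hom V V"
      using category_Id[OF category_Rep, of V] V by (simp del: Rep_simps(3))
    show "RM_map V V (Id Rep V) = Id Sq (RM V)"
    proof (rule gr_hom_RM_eqI[OF V module_RM[OF V] RM_map_gr_hom[OF V V id]])
      show "Id Sq (RM V) \<in> gr_hom (RM V) (RM V)"
        using category_Id[OF category_Sq, of "RM V"] squarefree_module_RM[OF V] by (simp del: Sq_simps(3))
      fix s and v :: "'k vec" assume v: "v \<in> carrier_vec (fst V s)"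
      then have v': "v \<in> carrier_vec (deg_dim V (elem_degree s))" by simp
      show "RM_map V V (Id Rep V) (enc (conc (elem_degree s) v)) = Id Sq (RM V) (enc (conc (elem_degree s) v))"
        using v conc_rep_coeffs[OF v']
        by (simp add: RM_map_apply coeffs_map_conc[OF id v'] RM_carrier del: Rep_simps(3)) simp
    qed
  next
    fix V W :: "('p, 'k) rep" and \<phi> assume "V \<in> Ob Rep" "W \<in> Ob Rep" "\<phi> \<in> Hom Rep V W"
    then show "RM_map V W \<phi> \<in> Hom Sq (RM V) (RM W)" by (simp add: RM_map_gr_hom)
  next
    fix U V W :: "('p, 'k) rep" and f g
    assume *: "U \<in> Ob Rep" "V \<in> Ob Rep" "W \<in> Ob Rep" "f \<in> Hom Rep U V" "g \<in> Hom Rep V W"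
    then have U: "is_rep U" and V: "is_rep V" and W: "is_rep W" and f: "f \<in> rep_hom U V" and g: "g \<in> rep_hom V W"
      by simp_all
    have gf: "Comp Rep U V W g f \<in> rep_hom U W"
      using category_Comp[OF category_Rep *] by (simp del: Rep_simps(4))
    show "RM_map U W (Comp Rep U V W g f) = Comp Sq (RM U) (RM V) (RM W) (RM_map V W g) (RM_map U V f)"
    proof (rule gr_hom_RM_eqI[OF U module_RM[OF W] RM_map_gr_hom[OF U W gf]])
      show "Comp Sq (RM U) (RM V) (RM W) (RM_map V W g) (RM_map U V f) \<in> gr_hom (RM U) (RM W)"
        using category_Comp[OF category_Sq, of "RM U" "RM V" "RM W" "RM_map U V f" "RM_map V W g"]
          squarefree_module_RM[OF U] squarefree_module_RM[OF V] squarefree_module_RM[OF W]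
          RM_map_gr_hom[OF U V f] RM_map_gr_hom[OF V W g] by simp
      fix s and v :: "'k vec" assume v: "v \<in> carrier_vec (fst U s)"
      then have v': "v \<in> carrier_vec (deg_dim U (elem_degree s))" by simp
      have fv: "f s *\<^sub>v v \<in> carrier_vec (deg_dim V (elem_degree s))"
        using mult_mat_vec_carrier[OF rep_homD(1)[OF f] v] by simp
      have "enc (conc (elem_degree s) v) \<in> carrier (RM U)" using v' by (auto simp: RM_carrier)
      then show "RM_map U W (Comp Rep U V W g f) (enc (conc (elem_degree s) v)) =
          Comp Sq (RM U) (RM V) (RM W) (RM_map V W g) (RM_map U V f) (enc (conc (elem_degree s) v))"
        using assoc_mult_mat_vec[OF rep_homD(1)[OF g] rep_homD(1)[OF f] v]
        by (simp add: RM_map_apply[OF conc_rep_coeffs[OF v']] RM_map_apply[OF conc_rep_coeffs[OF fv]] compose_eq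
          coeffs_map_conc[OF gf v'] coeffs_map_conc[OF f v'] coeffs_map_conc[OF g fv] del: Rep_simps(4)) simp
    qed
  qed
  show "fully_faithful (Rep :: (('p, 'k) rep, _) cat) Sq RM RM_map"
    unfolding fully_faithful_def bij_betw_def
  proof (intro ballI conjI inj_onI subset_antisym image_subsetI subsetI)
    fix V W :: "('p, 'k) rep" assume "V \<in> Ob Rep" "W \<in> Ob Rep"
    then have VW: "is_rep V" "is_rep W" by simp_all
    show "\<phi> = \<psi>" if "\<phi> \<in> Hom Rep V W" "\<psi> \<in> Hom Rep V W" "RM_map V W \<phi> = RM_map V W \<psi>" for \<phi> \<psi>
      using RM_map_inj that by simp
    show "RM_map V W \<phi> \<in> Hom Sq (RM V) (RM W)" if "\<phi> \<in> Hom Rep V W" for \<phi>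
      using RM_map_gr_hom[OF VW] that by simp
    show "f \<in> RM_map V W ` Hom Rep V W" if "f \<in> Hom Sq (RM V) (RM W)" for f
      using RM_map_surj[OF VW] that by simp
  qed
qed

end

section \<open>Every squarefree module comes from a representation\<close>

lemma chain_degree_degrees: "chain_degree u \<Longrightarrow> u \<in> degrees"
  by (simp add: chain_degree_def)

lemma bij_betw_comp_on:
  assumes "bij_betw f A B" "bij_betw g B C" "\<And>x. x \<in> A \<Longrightarrow> h x = g (f x)"
  shows "bij_betw h A C"
  using bij_betw_trans[OF assms(1,2)] bij_betw_cong[of A h "g \<circ> f" C] assms(3) by simp

locale squarefree_mod =
  fixes M :: "('p::{finite,order_bot}, 'k::field, 'm) gr_mod"
  assumes squarefree: "squarefree_module M"

sublocale squarefree_mod \<subseteq> graded_mod M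
  by (rule squarefree_moduleD(1)[OF squarefree])

context squarefree_mod begin

lemma hcomp_trivial:
  assumes "u \<in> degrees" "\<not> chain_degree u"
  shows "hcomp M u = {\<zero>\<^bsub>M\<^esub>}"
  using squarefree assms unfolding squarefree_module_def chain_degree_def by blast

lemma bij_poly_var:
  assumes w: "chain_degree w" "supp w \<noteq> {}" and t: "t \<noteq> bot" "t \<le> top_of w"
    and wt: "supp (w + mono_degree (Poly_Mapping.single t 1)) \<in> order_complex UNIV"
  shows "bij_betw (mono_mult (Poly_Mapping.single t 1)) (hcomp M w) (hcomp M (w + mono_degree (Poly_Mapping.single t 1)))"
proof -
  note sq = squarefree[unfolded squarefree_module_def, THEN conjunct2, THEN conjunct2, THEN conjunct2, THEN conjunct2,
    unfolded poly_var_def, rule_format, of w t]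
  have "t \<le> (GREATEST s. s \<in> supp w)" using t(2) w(2) by (simp add: top_of_def)
  then show ?thesis
    using sq w t(1) wt unfolding shift_unit_vec chain_degree_def by blast
qed

text \<open>Variables are multiplied in one at a time. Each intermediate degree lies between
  \<open>u\<close> and \<open>u + mono_degree a\<close>, so it is chain-supported, and its top is
  still \<open>top_of u\<close>; the bijectivity condition applies at every stage.\<close>

lemma bij_mono_mult:
  assumes u: "chain_degree u" "supp u \<noteq> {}"
  shows "\<lbrakk>valid_mono a; chain_degree (u + mono_degree a); \<And>t. t \<in> Poly_Mapping.keys a \<Longrightarrow> t \<le> top_of u\<rbrakk> \<Longrightarrow>
    bij_betw (mono_mult a) (hcomp M u) (hcomp M (u + mono_degree a))"
proof (induction "\<Sum>s\<in>UNIV. Poly_Mapping.lookup a s" arbitrary: a)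
  case 0
  then have "a = 0" by (intro poly_mapping_eqI) simp
  moreover have "mono_mult 0 x = x" if "x \<in> hcomp M u" for x
    using hcomp_closed(1)[OF chain_degree_degrees[OF u(1)] that] by (rule mono_mult_zero)
  ultimately show ?case by (simp add: bij_betw_def inj_on_def image_def)
next
  case (Suc n)
  obtain t where t: "Poly_Mapping.lookup a t \<noteq> 0"
    using Suc.hyps(2) by (metis (mono_tags, lifting) Zero_neq_Suc sum.neutral)
  let ?x = "Poly_Mapping.single t 1 :: 'p \<Rightarrow>\<^sub>0 nat"
  define c where "c = a - ?x"
  have a: "a = ?x + c"
    unfolding c_def using t
    by (intro poly_mapping_eqI) (auto simp: Poly_Mapping.lookup_add Poly_Mapping.lookup_minus Poly_Mapping.lookup_single when_def)
  have tk: "t \<in> Poly_Mapping.keys a" using t by (simp add: in_keys_iff)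
  have v: "valid_mono ?x" "valid_mono c" using Suc.prems(1) unfolding a by auto
  have "(\<Sum>s\<in>UNIV. Poly_Mapping.lookup a s) = (\<Sum>s\<in>UNIV. Poly_Mapping.lookup c s) + 1"
    unfolding a Poly_Mapping.lookup_add sum.distrib by (simp add: Poly_Mapping.lookup_single when_def)
  then have n: "n = (\<Sum>s\<in>UNIV. Poly_Mapping.lookup c s)" using Suc.hyps(2) by simp
  let ?w = "u + mono_degree c"
  have wx: "?w + mono_degree ?x = u + mono_degree a" unfolding a by (simp add: algebra_simps)
  have unn: "0 \<le> u s" for s using u by (simp add: chain_degree_def)
  have w: "chain_degree ?w"
  proof (rule chain_degree_mono(1)[OF Suc.prems(2)])
    show "?w \<in> degrees" using v(2) chain_degree_degrees[OF u(1)] by simp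
    show "0 \<le> ?w s" "?w s \<le> (u + mono_degree a) s" for s
      using unn[of s] mono_degree_nonneg[of c s] mono_degree_nonneg[of ?x s] by (simp_all add: a)
  qed
  have ck: "s \<in> Poly_Mapping.keys a" if "s \<in> Poly_Mapping.keys c" for s
    using that by (simp add: a in_keys_iff Poly_Mapping.lookup_add)
  have sw: "s \<in> supp ?w \<longleftrightarrow> s \<in> supp u \<or> s \<in> Poly_Mapping.keys c" for s
    using unn[of s] by (auto simp: supp_def in_keys_iff mono_degree_def)
  have top: "top_of ?w = top_of u"
    by (rule top_of_eqI) (use sw top_of_greatest[OF u] Suc.prems(3) ck in auto)
  have IH: "bij_betw (mono_mult c) (hcomp M u) (hcomp M ?w)"
    using Suc.hyps(1)[OF n v(2) w] Suc.prems(3) ck by blast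
  have "supp ?w \<noteq> {}" using sw u(2) by blast
  moreover have "t \<le> top_of u" using Suc.prems(3) tk by blast
  moreover have "t \<noteq> bot" using v(1) by (auto simp: valid_mono_def)
  moreover have "supp (?w + mono_degree ?x) \<in> order_complex UNIV"
    unfolding wx using Suc.prems(2) by (simp add: chain_degree_def)
  ultimately have step: "bij_betw (mono_mult ?x) (hcomp M ?w) (hcomp M (u + mono_degree a))"
    using bij_poly_var[OF w, of t] unfolding wx top by blast
  show ?case
  proof (rule bij_betw_comp_on[OF IH step])
    fix x assume "x \<in> hcomp M u"
    then have "x \<in> carrier M" using hcomp_closed(1)[OF chain_degree_degrees[OF u(1)]] by blast
    then show "mono_mult a x = mono_mult ?x (mono_mult c x)"
      using single_smult_smult[of x ?x c 1 1] v unfolding a by simp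
  qed
qed

text \<open>Identifies each chain-supported component with the one at the top of its support. On
  empty support the bijectivity condition is silent, but then \<open>u\<close> is 0 and the cofactor
  is 1.\<close>

lemma bij_cofactor:
  assumes u: "chain_degree u"
  shows "bij_betw (mono_mult (cofactor u)) (hcomp M (elem_degree (top_of u))) (hcomp M u)"
proof (cases "top_of u = bot")
  case True
  have "supp u = {}"
  proof (rule ccontr)
    assume "supp u \<noteq> {}"
    then have "bot \<in> supp u" using top_of_greatest(1)[OF u] True by simp
    then show False using chain_degree_supp[OF u] by (simp add: order_complex_UNIV)
  qed
  then have u0: "u = 0" by (auto simp: supp_def fun_eq_iff)
  have c: "cofactor 0 = (0 :: 'p \<Rightarrow>\<^sub>0 nat)"
    using mono_of_mono_degree[of "0 :: 'p \<Rightarrow>\<^sub>0 nat"] by (simp add: cofactor_def top_of_def)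
  have "mono_mult 0 x = x" if "x \<in> hcomp M 0" for x
    using hcomp_closed(1)[of 0 x] that by simp
  then show ?thesis unfolding u0 c by (simp add: bij_betw_def inj_on_def image_def top_of_def)
next
  case False
  let ?e = "elem_degree (top_of u)"
  have e: "supp ?e \<noteq> {}" using False by (auto simp: supp_def elem_degree_apply)
  have k: "t \<le> top_of ?e" if "t \<in> Poly_Mapping.keys (cofactor u)" for t
  proof -
    have "u t = ?e t + mono_degree (cofactor u) t" by (subst cofactor(1)[OF u, symmetric]) simp
    then have "u t \<noteq> 0" using that by (auto simp: mono_degree_def in_keys_iff)
    then show ?thesis using le_top_of[OF u, of t] by (simp add: supp_def)
  qed
  show ?thesis
    using bij_mono_mult[OF _ e cofactor(2)[OF u] _ k] u by (simp add: cofactor(1)[OF u])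
qed

text \<open>Justifies division by \<open>x\<^sub>t\<close> into degree \<open>s\<close>. For
  \<open>t = bot\<close> the multiplier is 1, which also covers \<open>s = bot\<close>, where the
  support is empty.\<close>

lemma bij_elem_mono:
  assumes ts: "t \<le> s"
  shows "bij_betw (mono_mult (elem_mono t)) (hcomp M (elem_degree s)) (hcomp M (elem_degree s + elem_degree t))"
proof (cases "t = bot")
  case True
  have "mono_mult 0 x = x" if "x \<in> hcomp M (elem_degree s)" for x
    using hcomp_closed(1)[OF _ that] by simp
  then show ?thesis using True by (simp add: elem_mono_def bij_betw_def inj_on_def image_def)
next
  case False
  then have "s \<noteq> bot" using ts bot_unique by auto
  then have e: "supp (elem_degree s) \<noteq> {}" by (auto simp: supp_def elem_degree_apply)
  show ?thesis
  proof (rule bij_mono_mult[OF _ e])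
    show "chain_degree (elem_degree s + elem_degree t)"
      using chain_degree_elem_degrees(1)[OF ts] by (simp add: add.commute)
    fix r assume "r \<in> Poly_Mapping.keys (elem_mono t)"
    then have "r = t" by (simp add: elem_mono_def split: if_splits)
    then show "r \<le> top_of (elem_degree s)" using ts by simp
  qed simp_all
qed

text \<open>
  The map from degree \<open>t\<close> to degree \<open>s\<close>: multiply by \<open>x\<^sub>s\<close> and divide by \<open>x\<^sub>t\<close>, where \<open>x\<close> at
  \<open>bot\<close> is read as 1.
\<close>

definition transfer :: "'p \<Rightarrow> 'p \<Rightarrow> 'm \<Rightarrow> 'm" where
  "transfer t s y = inv_into (hcomp M (elem_degree s)) (mono_mult (elem_mono t)) (mono_mult (elem_mono s) y)"

lemma elem_degree_degrees: "elem_degree s \<in> degrees"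
  by simp

lemma elem_hcomp_closed: "y \<in> hcomp M (elem_degree s) \<Longrightarrow> y \<in> carrier M"
  by (rule hcomp_closed(1)[OF elem_degree_degrees])

text \<open>The defining equation of the quotient; together with \<open>elem_mono_cancel\<close> it
  takes the place of \<open>inv_into\<close> in the calculations with
  \<open>transfer\<close>.\<close>

lemma transfer:
  assumes "t \<le> s" "y \<in> hcomp M (elem_degree t)"
  shows "transfer t s y \<in> hcomp M (elem_degree s)"
    "mono_mult (elem_mono t) (transfer t s y) = mono_mult (elem_mono s) y"
proof -
  have "mono_mult (elem_mono s) y \<in> hcomp M (elem_degree s + elem_degree t)"
    using single_smult_hcomp[OF elem_degree_degrees assms(2) valid_elem_mono, of s 1] by (simp add: add.commute)
  then have "mono_mult (elem_mono s) y \<in> mono_mult (elem_mono t) ` hcomp M (elem_degree s)"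
    using bij_betw_imp_surj_on[OF bij_elem_mono[OF assms(1)]] by simp
  then show "transfer t s y \<in> hcomp M (elem_degree s)"
    "mono_mult (elem_mono t) (transfer t s y) = mono_mult (elem_mono s) y"
    unfolding transfer_def by (rule inv_into_into, rule f_inv_into_f)
qed

lemma elem_mono_cancel:
  assumes "t \<le> s" "y \<in> hcomp M (elem_degree s)" "z \<in> hcomp M (elem_degree s)"
    "mono_mult (elem_mono t) y = mono_mult (elem_mono t) z"
  shows "y = z"
  using inj_onD[OF bij_betw_imp_inj_on[OF bij_elem_mono[OF assms(1)]] assms(4,2,3)] .

lemma transfer_id: "y \<in> hcomp M (elem_degree s) \<Longrightarrow> transfer s s y = y"
  using elem_mono_cancel[of s s "transfer s s y" y] transfer[of s s y] by simp

lemma mono_mult_commute: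
  assumes "y \<in> carrier M" "valid_mono a" "valid_mono b"
  shows "mono_mult a (mono_mult b y) = mono_mult b (mono_mult a y)"
  using assms by (simp add: single_smult_smult add.commute)

text \<open>Clearing denominators: multiplied by \<open>x\<^sub>r x\<^sub>t\<close>, both sides
  become \<open>x\<^sub>s x\<^sub>t y\<close>. Then \<open>x\<^sub>r\<close> is cancelled in the
  degree of \<open>x\<^sub>s x\<^sub>t\<close>, and \<open>x\<^sub>t\<close> in degree
  \<open>s\<close>.\<close>

lemma transfer_transfer:
  assumes rt: "r \<le> t" and ts: "t \<le> s" and y: "y \<in> hcomp M (elem_degree r)"
  shows "transfer t s (transfer r t y) = transfer r s y"
proof -
  have rs: "r \<le> s" using rt ts by simp
  let ?y = "transfer r t y" let ?z = "transfer t s ?y" let ?w = "transfer r s y"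
  let ?x = "\<lambda>s. mono_mult (elem_mono s)"
  note y1 = transfer[OF rt y]
  note z = transfer[OF ts y1(1)]
  note w = transfer[OF rs y]
  note c = elem_hcomp_closed[OF y] elem_hcomp_closed[OF y1(1)] elem_hcomp_closed[OF z(1)] elem_hcomp_closed[OF w(1)]
  note comm = mono_mult_commute[OF _ valid_elem_mono valid_elem_mono]
  have "?x t (?x r ?z) = ?x r (?x s ?y)" using comm[OF c(3), of t r] z(2) by simp
  also have "\<dots> = ?x s (?x t y)" using comm[OF c(2), of r s] y1(2) by simp
  also have "\<dots> = ?x t (?x r ?w)" using comm[OF c(1), of s t] comm[OF c(4), of t r] w(2) by simp
  finally have eq: "?x t (?x r ?z) = ?x t (?x r ?w)" .
  have "?x r (?x t ?z) = ?x r (?x t ?w)"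
    using eq comm[OF c(3), of t r] comm[OF c(4), of t r] by simp
  \<comment> \<open>Cancelling \<open>x\<^sub>r\<close> requires a degree with nonempty support and
    top \<open>s\<close>. For \<open>s = bot\<close> all three elements are \<open>bot\<close> and
    every multiplier is 1.\<close>
  have tr: "?x t ?z = ?x t ?w"
  proof (cases "s = bot")
    case True
    then have "t = bot" "r = bot" using ts rs bot_unique by auto
    then show ?thesis using eq c by (simp add: elem_mono_def)
  next
    case False
    have e: "supp (elem_degree s + elem_degree t) \<noteq> {}"
      using False by (auto simp: supp_def elem_degree_apply)
    have cst: "chain_degree (elem_degree s + elem_degree t)" "top_of (elem_degree s + elem_degree t) = s"
      using chain_degree_elem_degrees[OF ts] by (simp_all add: add.commute)
    have sup: "supp (elem_degree s + elem_degree t + elem_degree r) = supp (elem_degree s + elem_degree t) \<union> ({r} - {bot})"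
      by (rule supp_add_elem_degree) (simp add: mono_degree_nonneg)
    have sup2: "supp (elem_degree s + elem_degree t) = ({s} - {bot}) \<union> ({t} - {bot})"
      using supp_add_elem_degree[of 0 s] supp_add_elem_degree[of "elem_degree s" t] by (simp add: mono_degree_nonneg)
    have "chain_degree (elem_degree s + elem_degree t + elem_degree r)"
      unfolding chain_degree_def sup sup2 order_complex_UNIV using rt ts rs
      by (auto simp: mono_degree_nonneg)
    then have "bij_betw (?x r) (hcomp M (elem_degree s + elem_degree t)) (hcomp M (elem_degree s + elem_degree t + elem_degree r))"
    proof (rule bij_mono_mult[OF cst(1) e valid_elem_mono])
      fix q assume "q \<in> Poly_Mapping.keys (elem_mono r)"
      then show "q \<le> top_of (elem_degree s + elem_degree t)"
        unfolding cst(2) using rs by (simp add: elem_mono_def split: if_splits)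
    qed
    then have inj: "inj_on (?x r) (hcomp M (elem_degree s + elem_degree t))"
      by (rule bij_betw_imp_inj_on)
    show ?thesis
      by (rule inj_onD[OF inj \<open>?x r (?x t ?z) = ?x r (?x t ?w)\<close>])
        (use bij_betwE[OF bij_elem_mono[OF ts]] z(1) w(1) in simp_all)
  qed
  show ?thesis by (rule elem_mono_cancel[OF ts z(1) w(1) tr])
qed

lemma linear_map_transfer:
  assumes ts: "t \<le> s"
  shows "linear_map scalars (component_space M (elem_degree t)) (component_space M (elem_degree s)) (transfer t s)"
proof -
  have "linear_map scalars (component_space M (elem_degree t)) (component_space M (elem_degree s + elem_degree t)) (mono_mult (elem_mono s))"
    using linear_map_mono_mult[OF elem_degree_degrees valid_elem_mono, of t s] by (simp add: add.commute)
  moreover have "linear_map scalars (component_space M (elem_degree s + elem_degree t)) (component_space M (elem_degree s))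
      (inv_into (hcomp M (elem_degree s)) (mono_mult (elem_mono t)))"
    using linear_map_inv[OF module_component_space[OF elem_degree_degrees]
      linear_map_mono_mult[OF elem_degree_degrees valid_elem_mono]] bij_elem_mono[OF ts] by simp
  ultimately show ?thesis unfolding transfer_def by (rule linear_map_comp)
qed

end

lemma cofactor_eqI:
  assumes "chain_degree u" "elem_degree (top_of u) + mono_degree a = u"
  shows "cofactor u = a"
proof -
  have "elem_degree (top_of u) + mono_degree (cofactor u) = elem_degree (top_of u) + mono_degree a"
    using cofactor(1)[OF assms(1)] assms(2) by simp
  then show ?thesis by (simp add: mono_degree_inj)
qed

text \<open>The hypothesis \<open>hc\<close> makes the inverse graded: by injectivity the preimage
  of a homogeneous element is the homogeneous one that \<open>hc\<close> provides.\<close>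

lemma Sq_iso:
  assumes M: "squarefree_module M" and N: "squarefree_module N" and f: "f \<in> gr_hom M N"
    and bij: "bij_betw f (carrier M) (carrier N)"
    and hc: "\<And>u y. u \<in> degrees \<Longrightarrow> y \<in> hcomp N u \<Longrightarrow> \<exists>x\<in>hcomp M u. f x = y"
  shows "is_iso Sq M N f"
proof -
  interpret M: graded_mod M by (rule squarefree_moduleD(1)[OF M])
  interpret N: graded_mod N by (rule squarefree_moduleD(1)[OF N])
  define g where "g = restrict (inv_into (carrier M) f) (carrier N)"
  have g: "g y \<in> carrier M" "f (g y) = y" if "y \<in> carrier N" for y
    using bij that by (auto simp: g_def bij_betw_def inv_into_into f_inv_into_f)
  have gf: "g (f x) = x" if "x \<in> carrier M" for x
    using bij_betw_inv_into_left[OF bij that] gr_homD(5)[OF f that] by (simp add: g_def)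
  have "g \<in> gr_hom N M"
  proof (rule gr_homI)
    show "g \<in> mod_hom poly_ring N M"
      unfolding g_def
      by (rule restrict_in_mod_hom[OF squarefree_moduleD(2)[OF N] linear_map_inv[OF squarefree_moduleD(2)[OF M] gr_homD(3)[OF f] bij]])
    fix u y assume u: "u \<in> degrees" and y: "y \<in> hcomp N u"
    then obtain x where x: "x \<in> hcomp M u" "f x = y" using hc by blast
    then show "g y \<in> hcomp M u" using gf[of x] M.hcomp_closed(1)[OF u x(1)] by auto
  qed
  moreover have "compose (carrier M) g f = (\<lambda>x\<in>carrier M. x)" "compose (carrier N) f g = (\<lambda>x\<in>carrier N. x)"
    by (auto simp: compose_def fun_eq_iff gf g(2))
  ultimately show ?thesis unfolding is_iso_def using f by auto
qed

section \<open>Comparison of a squarefree module with the module of its representation\<close>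

locale squarefree_mod_coords = squarefree_mod M + coeff_embedding enc
  for M :: "('p::{finite,order_bot}, 'k::field, 'm) gr_mod" and enc :: "('p, 'k) coeffs \<Rightarrow> 'm" +
  fixes d :: "'p \<Rightarrow> nat" and b :: "'p \<Rightarrow> 'k vec \<Rightarrow> 'm"
  assumes coords: "\<And>s. is_coords (d s) (b s) (component_space M (elem_degree s))"
begin

lemma b_linear: "linear_map scalars (vecs (d s)) (component_space M (elem_degree s)) (b s)"
  and b_bij: "bij_betw (b s) (carrier_vec (d s)) (hcomp M (elem_degree s))"
  using coords unfolding is_coords_def by auto

lemma b_hcomp: "v \<in> carrier_vec (d s) \<Longrightarrow> b s v \<in> hcomp M (elem_degree s)"
  using b_bij bij_betwE by blast

lemma b_inj: "v \<in> carrier_vec (d s) \<Longrightarrow> w \<in> carrier_vec (d s) \<Longrightarrow> b s v = b s w \<Longrightarrow> v = w"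
  using b_bij by (meson bij_betw_imp_inj_on inj_onD)

definition struct_mat :: "'p \<Rightarrow> 'p \<Rightarrow> 'k mat" where
  "struct_mat t s = matrix_of (d s) (d t) (\<lambda>v. inv_into (carrier_vec (d s)) (b s) (transfer t s (b t v)))"

abbreviation mod_rep :: "('p, 'k) rep" where
  "mod_rep \<equiv> (d, struct_mat)"

lemma struct_mat_carrier: "struct_mat t s \<in> carrier_mat (d s) (d t)"
  by (simp add: struct_mat_def)

lemma struct_mat_mult: "v \<in> carrier_vec (d t) \<Longrightarrow> struct_mat t s *\<^sub>v v \<in> carrier_vec (d s)"
  by (rule mult_mat_vec_carrier[OF struct_mat_carrier])

lemma b_struct_mat:
  assumes ts: "t \<le> s" and v: "v \<in> carrier_vec (d t)"
  shows "b s (struct_mat t s *\<^sub>v v) = transfer t s (b t v)"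
proof -
  have "linear_map scalars (component_space M (elem_degree s)) (vecs (d s)) (inv_into (carrier_vec (d s)) (b s))"
    using linear_map_inv[OF module_vecs b_linear] b_bij by (simp add: module_vec_simps)
  then have "linear_map scalars (vecs (d t)) (vecs (d s)) (\<lambda>v. inv_into (carrier_vec (d s)) (b s) (transfer t s (b t v)))"
    by (rule linear_map_comp[OF linear_map_comp[OF b_linear linear_map_transfer[OF ts]]])
  then have "struct_mat t s *\<^sub>v v = inv_into (carrier_vec (d s)) (b s) (transfer t s (b t v))"
    unfolding struct_mat_def by (rule matrix_of[OF _ v])
  moreover have "transfer t s (b t v) \<in> b s ` carrier_vec (d s)"
    using transfer(1)[OF ts b_hcomp[OF v]] b_bij by (simp add: bij_betw_def)
  ultimately show ?thesis by (simp add: f_inv_into_f)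
qed

text \<open>The two laws are \<open>transfer_id\<close> and \<open>transfer_transfer\<close>, read
  through the injective coordinate maps \<open>b s\<close>.\<close>

lemma is_rep_mod_rep: "is_rep mod_rep"
  unfolding is_rep_def fst_conv snd_conv
proof (intro conjI allI impI)
  fix s
  show "struct_mat s s = 1\<^sub>m (d s)"
  proof (rule mat_eqI_mult_vec[OF struct_mat_carrier one_carrier_mat])
    fix v :: "'k vec" assume v: "v \<in> carrier_vec (d s)"
    have "b s (struct_mat s s *\<^sub>v v) = b s v"
      using b_struct_mat[OF order_refl v] transfer_id[OF b_hcomp[OF v]] by simp
    then have "struct_mat s s *\<^sub>v v = v" by (rule b_inj[OF struct_mat_mult[OF v] v])
    then show "struct_mat s s *\<^sub>v v = 1\<^sub>m (d s) *\<^sub>v v" using v by simp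
  qed
next
  fix r t s :: 'p assume rt: "r \<le> t" and ts: "t \<le> s"
  show "struct_mat t s * struct_mat r t = struct_mat r s"
  proof (rule mat_eqI_mult_vec[OF mult_carrier_mat[OF struct_mat_carrier struct_mat_carrier] struct_mat_carrier])
    fix v :: "'k vec" assume v: "v \<in> carrier_vec (d r)"
    have "b s (struct_mat t s *\<^sub>v (struct_mat r t *\<^sub>v v)) = b s (struct_mat r s *\<^sub>v v)"
      using b_struct_mat[OF ts struct_mat_mult[OF v]] b_struct_mat[OF rt v] b_struct_mat[OF order_trans[OF rt ts] v]
        transfer_transfer[OF rt ts b_hcomp[OF v]] by simp
    then have "struct_mat t s *\<^sub>v (struct_mat r t *\<^sub>v v) = struct_mat r s *\<^sub>v v"
      by (rule b_inj[OF struct_mat_mult[OF struct_mat_mult[OF v]] struct_mat_mult[OF v]])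
    then show "struct_mat t s * struct_mat r t *\<^sub>v v = struct_mat r s *\<^sub>v v"
      using assoc_mult_mat_vec[OF struct_mat_carrier struct_mat_carrier v] by simp
  qed
qed (rule struct_mat_carrier)

abbreviation deg_d :: "('p \<Rightarrow> int) \<Rightarrow> nat" where
  "deg_d u \<equiv> deg_dim mod_rep u"

text \<open>Coordinates on the component of degree \<open>u\<close>, carried over from the component
  at \<open>top_of u\<close> by the cofactor. Off the chains the only vector of the right dimension
  is the empty one, and it goes to zero.\<close>

definition deg_map :: "('p \<Rightarrow> int) \<Rightarrow> 'k vec \<Rightarrow> 'm" where
  "deg_map u v = (if chain_degree u then mono_mult (cofactor u) (b (top_of u) v) else \<zero>\<^bsub>M\<^esub>)"

lemma deg_d_chain: "chain_degree u \<Longrightarrow> deg_d u = d (top_of u)"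
  by (simp add: deg_dim_def)

lemma vec_0_eq: "v \<in> carrier_vec 0 \<Longrightarrow> w \<in> carrier_vec 0 \<Longrightarrow> v = (w :: 'k vec)"
  by (intro eq_vecI) auto

lemma deg_map_bij:
  assumes u: "u \<in> degrees"
  shows "bij_betw (deg_map u) (carrier_vec (deg_d u)) (hcomp M u)"
proof (cases "chain_degree u")
  case True
  show ?thesis unfolding deg_d_chain[OF True]
    by (rule bij_betw_comp_on[OF b_bij bij_cofactor[OF True]]) (simp add: deg_map_def True)
next
  case False
  then have "deg_d u = 0" by (simp add: deg_dim_def)
  then have "carrier_vec (deg_d u) = {0\<^sub>v 0 :: 'k vec}"
    using vec_0_eq by (simp only: set_eq_iff singleton_iff) (metis zero_carrier_vec)
  then show ?thesis
    using False hcomp_trivial[OF u False] by (simp only: bij_betw_def) (simp add: deg_map_def)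
qed

lemma deg_map_linear:
  assumes u: "u \<in> degrees"
  shows "linear_map scalars (vecs (deg_d u)) (component_space M u) (deg_map u)"
proof (cases "chain_degree u")
  case True
  have "linear_map scalars (component_space M (elem_degree (top_of u))) (component_space M u) (mono_mult (cofactor u))"
    using linear_map_mono_mult[OF elem_degree_degrees cofactor(2)[OF True], of "top_of u"]
    unfolding cofactor(1)[OF True] .
  from linear_map_comp[OF b_linear this] show ?thesis
    unfolding deg_d_chain[OF True] deg_map_def using True by simp
next
  case False
  interpret C: module scalars "component_space M u" by (rule module_component_space[OF u])
  show ?thesis
    using False hcomp_closed(2)[OF u] C.smult_r_null
    by (intro linear_mapI) (auto simp: deg_map_def)
qed

lemma deg_map_hcomp: "u \<in> degrees \<Longrightarrow> v \<in> carrier_vec (deg_d u) \<Longrightarrow> deg_map u v \<in> hcomp M u"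
  using bij_betwE[OF deg_map_bij] by blast

lemma deg_map_closed: "v \<in> carrier_vec (deg_d u) \<Longrightarrow> deg_map u v \<in> carrier M"
  using hcomp_closed(1) deg_map_hcomp by (cases "u \<in> degrees") (auto simp: deg_map_def dest: chain_degree_degrees)

lemma deg_map_inj: "u \<in> degrees \<Longrightarrow> v \<in> carrier_vec (deg_d u) \<Longrightarrow> w \<in> carrier_vec (deg_d u) \<Longrightarrow> deg_map u v = deg_map u w \<Longrightarrow> v = w"
  using deg_map_bij by (meson bij_betw_imp_inj_on inj_onD)

lemma deg_map_zero: "deg_map u (0\<^sub>v (deg_d u)) = \<zero>\<^bsub>M\<^esub>"
proof (cases "u \<in> degrees")
  case True
  show ?thesis
    using linear_map_zero[OF module_vecs module_component_space[OF True] deg_map_linear[OF True]]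
    by (simp add: module_vec_simps)
next
  case False
  then show ?thesis by (auto simp: deg_map_def dest: chain_degree_degrees)
qed

text \<open>Makes the identifications of the single degrees compatible with the module structure.
  When \<open>a\<close> raises the top of the support, the defining equation of
  \<open>transfer\<close> exchanges the old top variable for the new one.\<close>

lemma deg_map_transition:
  assumes a: "valid_mono a" and v: "v \<in> carrier_vec (deg_d u)"
  shows "deg_map (u + mono_degree a) (transition mod_rep u (u + mono_degree a) *\<^sub>v v) = mono_mult a (deg_map u v)"
proof (cases "chain_degree u")
  case False
  then have "deg_d u = 0" by (simp add: deg_dim_def)
  then have "v = 0\<^sub>v (deg_d u)" using vec_0_eq v by simp
  then show ?thesis
    using mult_mat_zero_vec[OF transition_carrier[OF is_rep_mod_rep, of u "u + mono_degree a"]]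
      smult_r_null[OF single_poly_ring[OF a]]
    by (simp add: deg_map_zero)
next
  case cu: True
  let ?w = "u + mono_degree a"
  have ud: "u \<in> degrees" by (rule chain_degree_degrees[OF cu])
  show ?thesis
  proof (cases "chain_degree ?w")
    case False
    \<comment> \<open>The product leaves the chain-supported degrees and so lies in a zero
      component.\<close>
    have "mono_mult a (deg_map u v) \<in> hcomp M ?w"
      by (rule single_smult_hcomp[OF ud deg_map_hcomp[OF ud v] a])
    then have "mono_mult a (deg_map u v) = \<zero>\<^bsub>M\<^esub>"
      using hcomp_trivial[OF _ False] ud a by simp
    then show ?thesis using False by (simp add: deg_map_def)
  next
    case cw: True
    let ?s = "top_of u" and ?s' = "top_of ?w"
    have unn: "0 \<le> u t" for t using cu by (simp add: chain_degree_def)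
    have le: "?s \<le> ?s'"
      by (rule chain_degree_mono(2)[OF cw ud unn]) (simp add: mono_degree_nonneg)
    have v': "v \<in> carrier_vec (d ?s)" using v by (simp add: deg_d_chain[OF cu])
    let ?y = "b ?s v" let ?z = "transfer ?s ?s' ?y"
    have y: "?y \<in> hcomp M (elem_degree ?s)" by (rule b_hcomp[OF v'])
    note z = transfer[OF le y]
    note yc = elem_hcomp_closed[OF y] and zc = elem_hcomp_closed[OF z(1)]
    have lhs: "deg_map ?w (transition mod_rep u ?w *\<^sub>v v) = mono_mult (cofactor ?w) ?z"
      using cu cw le b_struct_mat[OF le v'] by (simp add: deg_map_def transition_def)
    have rhs: "mono_mult a (deg_map u v) = mono_mult (a + cofactor u) ?y"
      using single_smult_smult[OF yc a cofactor(2)[OF cu], of 1 1] cu by (simp add: deg_map_def)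
    show ?thesis
    proof (cases "?s = ?s'")
      case True
      have "elem_degree ?s' + mono_degree (a + cofactor u) = ?w"
        using cofactor(1)[OF cu] unfolding True mono_degree_add
        by (metis (no_types, lifting) add.commute add.left_commute)
      then have "cofactor ?w = a + cofactor u" by (rule cofactor_eqI[OF cw])
      moreover have "?z = ?y" using transfer_id[OF y] True by simp
      ultimately show ?thesis unfolding lhs rhs by simp
    next
      case False
      \<comment> \<open>What remains of \<open>?w\<close> after removing both top variables. It is
        nonnegative because the tops differ and each of them, unless it is \<open>bot\<close>,
        occurs in \<open>?w\<close>. The monomial \<open>m\<close> is then the common factor:
        \<open>cofactor ?w\<close> is \<open>m\<close> times the variable at \<open>?s\<close>, and
        \<open>a\<close> times \<open>cofactor u\<close> is \<open>m\<close> times the variable at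
        \<open>?s'\<close>.\<close>
      let ?n = "?w - elem_degree ?s - elem_degree ?s'"
      define m where "m = mono_of ?n"
      have nn: "0 \<le> ?n t" for t
      proof -
        have "0 \<le> mono_degree a t" by (rule mono_degree_nonneg)
        then show ?thesis
          using elem_degree_top_le[OF cu, of t] elem_degree_top_le[OF cw, of t] False unn[of t]
          by (cases "t = ?s") (auto simp: elem_degree_apply fun_diff_def split: if_splits)
      qed
      have md: "mono_degree m = ?n" unfolding m_def by (rule mono_degree_mono_of[OF nn])
      have mv: "valid_mono m"
        unfolding m_def by (rule valid_mono_of) (use ud a in simp)
      have c1: "cofactor ?w = m + elem_mono ?s"
        by (rule cofactor_eqI[OF cw]) (simp add: md)
      have "elem_degree ?s + mono_degree (a + cofactor u) = elem_degree ?s + mono_degree (m + elem_mono ?s')"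
        using cofactor(1)[OF cu] unfolding mono_degree_add md by (metis (no_types, lifting) add.commute add.left_commute diff_add_cancel)
      then have c2: "a + cofactor u = m + elem_mono ?s'"
        by (simp only: add_left_cancel mono_degree_inj)
      show ?thesis
        unfolding lhs rhs c1 c2 using single_smult_smult[OF zc mv valid_elem_mono, of 1 ?s 1]
          single_smult_smult[OF yc mv valid_elem_mono, of 1 ?s' 1] z(2) by simp
    qed
  qed
qed

definition assemble :: "('p, 'k) coeffs \<Rightarrow> 'm" where
  "assemble g = (\<Oplus>\<^bsub>M\<^esub>u\<in>{u. g u \<noteq> 0}. deg_map u (vec_at mod_rep u g))"

lemma deg_map_vec_at_closed: "deg_map u (vec_at mod_rep u g) \<in> carrier M"
  by (rule deg_map_closed[OF vec_at_carrier])

lemma assemble_superset: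
  assumes "finite U" "{u. g u \<noteq> 0} \<subseteq> U"
  shows "assemble g = (\<Oplus>\<^bsub>M\<^esub>u\<in>U. deg_map u (vec_at mod_rep u g))"
  unfolding assemble_def
proof (rule M.add.finprod_mono_neutral_cong_left[OF assms])
  fix u assume "u \<in> U - {u. g u \<noteq> 0}"
  then have "g u = 0" by simp
  then show "deg_map u (vec_at mod_rep u g) = \<zero>\<^bsub>M\<^esub>"
    using unvec_zero_vec_at[of g u mod_rep] deg_map_zero by simp
qed (use deg_map_vec_at_closed in auto)

lemma rep_coeffs_support:
  "g \<in> rep_coeffs mod_rep \<Longrightarrow> finite {u. g u \<noteq> 0}"
  "g \<in> rep_coeffs mod_rep \<Longrightarrow> {u. g u \<noteq> 0} \<subseteq> degrees"
proof -
  assume g: "g \<in> rep_coeffs mod_rep"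
  show "finite {u. g u \<noteq> 0}" using g by (simp add: rep_coeffs_def)
  have "g u = 0" if "u \<notin> degrees" for u
  proof -
    have "deg_d u = 0" using that chain_degree_degrees[of u] by (auto simp: deg_dim_def)
    then show ?thesis using g by (auto simp: rep_coeffs_def fun_eq_iff)
  qed
  then show "{u. g u \<noteq> 0} \<subseteq> degrees" by blast
qed

lemma assemble_closed: "assemble g \<in> carrier M"
  unfolding assemble_def by (rule M.finsum_closed) (use deg_map_vec_at_closed in auto)

lemma component_assemble:
  assumes g: "g \<in> rep_coeffs mod_rep" and u: "u \<in> degrees"
  shows "component M (assemble g) u = deg_map u (vec_at mod_rep u g)"
proof -
  have "assemble g = (\<Oplus>\<^bsub>M\<^esub>w\<in>insert u {w. g w \<noteq> 0}. deg_map w (vec_at mod_rep w g))"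
    by (rule assemble_superset) (use rep_coeffs_support(1)[OF g] in auto)
  moreover have "component M \<dots> u = (if u \<in> insert u {w. g w \<noteq> 0} then deg_map u (vec_at mod_rep u g) else \<zero>\<^bsub>M\<^esub>)"
    by (rule component_finsum)
      (use rep_coeffs_support[OF g] u in \<open>auto intro!: deg_map_hcomp vec_at_carrier\<close>)
  ultimately show ?thesis by simp
qed

text \<open>An element of a graded module is the sum of its components, so values of
  \<open>assemble\<close> are identified degree by degree.\<close>

lemma assemble_eqI:
  assumes "g \<in> rep_coeffs mod_rep" "x \<in> carrier M"
    and "\<And>u. u \<in> degrees \<Longrightarrow> component M x u = deg_map u (vec_at mod_rep u g)"
  shows "assemble g = x"
proof -
  have "component M (assemble g) = component M x"
  proof
    fix u show "component M (assemble g) u = component M x u"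
      using assms component_assemble component_props(2) assemble_closed by (cases "u \<in> degrees") auto
  qed
  then show ?thesis
    using component_props(4)[OF assemble_closed, of g] component_props(4)[OF assms(2)] by simp
qed

lemma assemble_add:
  assumes g: "g \<in> rep_coeffs mod_rep" and h: "h \<in> rep_coeffs mod_rep"
  shows "assemble (g + h) = assemble g \<oplus>\<^bsub>M\<^esub> assemble h"
proof (rule assemble_eqI[OF rep_coeffs_closed(1)[OF g h]])
  fix u :: "'p \<Rightarrow> int" assume u: "u \<in> degrees"
  show "component M (assemble g \<oplus>\<^bsub>M\<^esub> assemble h) u = deg_map u (vec_at mod_rep u (g + h))"
    unfolding component_add[OF assemble_closed assemble_closed] component_assemble[OF g u] component_assemble[OF h u] vec_at_add
    using linear_mapD(2)[OF deg_map_linear[OF u]] by (simp add: module_vec_simps)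
qed (simp add: assemble_closed)

lemma assemble_smult:
  assumes g: "g \<in> rep_coeffs mod_rep" and a: "valid_mono a"
  shows "assemble (scale_coeffs c (mono_act mod_rep a g)) = Poly_Mapping.single a c \<odot>\<^bsub>M\<^esub> assemble g"
proof (rule assemble_eqI)
  show "scale_coeffs c (mono_act mod_rep a g) \<in> rep_coeffs mod_rep"
    by (rule rep_coeffs_closed(2)[OF mono_act_closed[OF is_rep_mod_rep g]])
  show "Poly_Mapping.single a c \<odot>\<^bsub>M\<^esub> assemble g \<in> carrier M"
    by (rule single_smult_closed[OF assemble_closed a])
  fix u :: "'p \<Rightarrow> int" assume u: "u \<in> degrees"
  let ?w = "u - mono_degree a"
  have w: "?w \<in> degrees" using u a by simp
  let ?v = "vec_at mod_rep ?w g"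
  have "component M (Poly_Mapping.single a c \<odot>\<^bsub>M\<^esub> assemble g) u = Poly_Mapping.single a c \<odot>\<^bsub>M\<^esub> deg_map ?w ?v"
    using component_single_smult[OF a assemble_closed] component_assemble[OF g w] by simp
  also have "\<dots> = Poly_Mapping.single 0 c \<odot>\<^bsub>M\<^esub> mono_mult a (deg_map ?w ?v)"
    using single_smult_smult[OF deg_map_vec_at_closed valid_mono_zero a, of c 1] by simp
  also have "mono_mult a (deg_map ?w ?v) = deg_map u (transition mod_rep ?w u *\<^sub>v ?v)"
    using deg_map_transition[OF a vec_at_carrier, of ?w g] by simp
  also have "Poly_Mapping.single 0 c \<odot>\<^bsub>M\<^esub> \<dots> = deg_map u (c \<cdot>\<^sub>v (transition mod_rep ?w u *\<^sub>v ?v))"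
    using linear_mapD(3)[OF deg_map_linear[OF u], of c "transition mod_rep ?w u *\<^sub>v ?v"]
      mult_mat_vec_carrier[OF transition_carrier[OF is_rep_mod_rep] vec_at_carrier]
    by (simp add: module_vec_simps)
  also have "c \<cdot>\<^sub>v (transition mod_rep ?w u *\<^sub>v ?v) = vec_at mod_rep u (scale_coeffs c (mono_act mod_rep a g))"
    by (simp only: vec_at_scale vec_at_mono_act[OF is_rep_mod_rep])
  finally show "component M (Poly_Mapping.single a c \<odot>\<^bsub>M\<^esub> assemble g) u = deg_map u (vec_at mod_rep u (scale_coeffs c (mono_act mod_rep a g)))" .
qed

text \<open>Each \<open>deg_map u\<close> is bijective. Comparing components gives injectivity; for
  surjectivity the vectors are chosen degree by degree, and their support is finite because an
  element has finitely many nonzero components.\<close>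

lemma assemble_bij: "bij_betw assemble (rep_coeffs mod_rep) (carrier M)"
  unfolding bij_betw_def
proof (intro conjI inj_onI subset_antisym image_subsetI subsetI assemble_closed)
  fix g h assume g: "g \<in> rep_coeffs mod_rep" and h: "h \<in> rep_coeffs mod_rep" and eq: "assemble g = assemble h"
  show "g = h"
  proof
    fix u show "g u = h u"
    proof (cases "u \<in> degrees")
      case True
      then have "deg_map u (vec_at mod_rep u g) = deg_map u (vec_at mod_rep u h)"
        using component_assemble[OF g True] component_assemble[OF h True] eq by simp
      then have "vec_at mod_rep u g = vec_at mod_rep u h"
        by (rule deg_map_inj[OF True vec_at_carrier vec_at_carrier])
      then show ?thesis using unvec_vec_at[OF g, of u] unvec_vec_at[OF h, of u] by simp
    next
      case False
      then have "g u = 0" "h u = 0" using rep_coeffs_support(2)[OF g] rep_coeffs_support(2)[OF h] by blast+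
      then show ?thesis by simp
    qed
  qed
next
  fix x assume x: "x \<in> carrier M"
  have "\<exists>v\<in>carrier_vec (deg_d u). deg_map u v = component M x u" for u
  proof (cases "u \<in> degrees")
    case True
    have "component M x u \<in> deg_map u ` carrier_vec (deg_d u)"
      using component_props(1)[OF x True] bij_betw_imp_surj_on[OF deg_map_bij[OF True]] by simp
    then show ?thesis by auto
  next
    case False
    then show ?thesis using deg_map_zero component_props(2)[OF x False] by (metis zero_carrier_vec)
  qed
  then obtain v where v: "\<And>u. v u \<in> carrier_vec (deg_d u)" "\<And>u. deg_map u (v u) = component M x u" by metis
  define g where "g u = unvec (v u)" for u
  have vg: "vec_at mod_rep u g = v u" for u by (rule vec_at_unvec[OF _ v(1)]) (simp add: g_def)
  have "g u = 0" if "component M x u = \<zero>\<^bsub>M\<^esub>" for u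
  proof (cases "u \<in> degrees")
    case True
    have "v u = 0\<^sub>v (deg_d u)"
      by (rule deg_map_inj[OF True v(1)]) (simp_all add: v(2) that deg_map_zero)
    then show ?thesis by (simp add: g_def)
  next
    case False
    then have "deg_d u = 0" using chain_degree_degrees[of u] by (auto simp: deg_dim_def)
    then have "v u = 0\<^sub>v (deg_d u)" using vec_0_eq v(1)[of u] by simp
    then show ?thesis by (simp add: g_def)
  qed
  then have "{u. g u \<noteq> 0} \<subseteq> {u. component M x u \<noteq> \<zero>\<^bsub>M\<^esub>}" by blast
  then have fin: "finite {u. g u \<noteq> 0}" using component_props(3)[OF x] finite_subset by blast
  have g: "g \<in> rep_coeffs mod_rep"
  proof (rule rep_coeffsI[OF fin])
    fix u i assume "deg_d u \<le> i"
    then show "g u i = 0" using v(1)[of u] by (simp add: g_def unvec_def)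
  qed
  have "assemble g = x"
    by (rule assemble_eqI[OF g x]) (simp add: vg v(2))
  then show "x \<in> assemble ` rep_coeffs mod_rep" using g by blast
qed

text \<open>Decoding followed by \<open>assemble\<close> sends the homogeneous element of
  \<open>v\<close> in degree \<open>u\<close> to \<open>deg_map u v\<close>. Bijectivity of
  \<open>deg_map u\<close> then yields homogeneous preimages, as \<open>Sq_iso\<close>
  requires.\<close>

lemma RM_iso: "\<exists>f. is_iso Sq (RM mod_rep) M f"
proof -
  let ?G = "RM mod_rep"
  note V = is_rep_mod_rep
  define f where "f = (\<lambda>x\<in>carrier ?G. assemble (dec x))"
  have fe: "f (enc g) = assemble g" if "g \<in> rep_coeffs mod_rep" for g
    using that by (simp add: f_def RM_carrier dec_enc)
  have conc: "assemble (conc u v) = deg_map u v" if u: "u \<in> degrees" and v: "v \<in> carrier_vec (deg_d u)" for u v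
  proof (rule assemble_eqI[OF conc_rep_coeffs[OF v] deg_map_closed[OF v]])
    fix w :: "'p \<Rightarrow> int" assume "w \<in> degrees"
    have "component M (deg_map u v) w = (if w = u then deg_map u v else \<zero>\<^bsub>M\<^esub>)"
      by (rule component_hcomp[OF u deg_map_hcomp[OF u v]])
    then show "component M (deg_map u v) w = deg_map w (vec_at mod_rep w (conc u v))"
      using vec_at_conc[OF v] unvec_zero_vec_at[of "conc u v" w mod_rep, OF conc_apply(2)] deg_map_zero by auto
  qed
  have lin: "linear_map poly_ring ?G M f"
  proof (rule linear_map_poly_ringI[OF module_RM[OF V]])
    show "module poly_ring M" by (rule module_axioms)
    fix x assume "x \<in> carrier ?G"
    then obtain g where g: "g \<in> rep_coeffs mod_rep" "x = enc g" by (auto simp: RM_carrier)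
    show "f x \<in> carrier M" using g by (simp add: fe assemble_closed)
    show "f (x \<oplus>\<^bsub>?G\<^esub> y) = f x \<oplus>\<^bsub>M\<^esub> f y" if "y \<in> carrier ?G" for y
    proof -
      from that obtain h where h: "h \<in> rep_coeffs mod_rep" "y = enc h" by (auto simp: RM_carrier)
      show ?thesis
        using g h by (simp only: RM_add fe rep_coeffs_closed(1) assemble_add)
    qed
    fix a :: "'p \<Rightarrow>\<^sub>0 nat" and c :: 'k assume a: "valid_mono a"
    show "f (Poly_Mapping.single a c \<odot>\<^bsub>?G\<^esub> x) = Poly_Mapping.single a c \<odot>\<^bsub>M\<^esub> f x"
      using g by (simp only: RM_smult poly_act_single[OF V] fe rep_coeffs_closed(2) mono_act_closed[OF V] assemble_smult[OF _ a])
  qed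
  have f: "f \<in> gr_hom ?G M"
  proof (rule gr_homI)
    show "f \<in> mod_hom poly_ring ?G M" using lin by (simp add: mod_hom_iff f_def)
    fix u x assume u: "u \<in> degrees" and "x \<in> hcomp ?G u"
    then obtain v where "v \<in> carrier_vec (deg_d u)" "x = enc (conc u v)" by (auto simp: RM_hcomp)
    then show "f x \<in> hcomp M u" using u by (simp add: fe conc deg_map_hcomp)
  qed
  have "is_iso Sq ?G M f"
  proof (rule Sq_iso[OF squarefree_module_RM[OF V] squarefree f])
    have "bij_betw dec (carrier ?G) (rep_coeffs mod_rep)"
      by (rule bij_betw_byWitness[where f' = enc]) (auto simp: RM_carrier dec_enc)
    from bij_betw_comp_on[OF this assemble_bij] show "bij_betw f (carrier ?G) (carrier M)"
      by (simp add: f_def)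
    fix u y assume u: "u \<in> degrees" and "y \<in> hcomp M u"
    then obtain v where v: "v \<in> carrier_vec (deg_d u)" "y = deg_map u v"
      using deg_map_bij[OF u] by (auto simp: bij_betw_def)
    then show "\<exists>x\<in>hcomp ?G u. f x = y"
      using u by (intro bexI[of _ "enc (conc u v)"]) (auto simp: fe conc RM_hcomp)
  qed
  then show ?thesis by blast
qed

end

text \<open>Finite generation enters here: it makes the components at the elements of the poset
  finite-dimensional, so that coordinates exist.\<close>

lemma (in coeff_embedding) RM_essentially_surjective:
  "essentially_surjective (Rep :: (('p, 'k) rep, _) cat) Sq RM"
  unfolding essentially_surjective_def
proof
  fix M :: "('p, 'k, 'm) gr_mod" assume "M \<in> Ob Sq"
  then have M: "squarefree_module M" by simp
  interpret squarefree_mod M by unfold_locales (rule M)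
  have "\<exists>n b. is_coords n b (component_space M (elem_degree s))" for s
    by (rule coords_exist[OF module_component_space finitely_generated_component_space])
      (simp_all add: squarefree_moduleD(3)[OF M])
  then obtain d b where "\<And>s. is_coords (d s) (b s) (component_space M (elem_degree s))" by metis
  then interpret squarefree_mod_coords M enc d b by unfold_locales
  show "\<exists>V\<in>Ob Rep. \<exists>f. is_iso Sq (RM V) M f"
    using RM_iso is_rep_mod_rep by (intro bexI[of _ mod_rep]) simp_all
qed

section \<open>The equivalence\<close>

text \<open>Listing the values along an enumeration of the arguments until the support is exhausted
  loses nothing, as all later values are zero.\<close>

lemma finite_support_embedding:
  "\<exists>f :: ('c::countable \<Rightarrow> 'k::zero) \<Rightarrow> 'k list. inj_on f {g. finite {x. g x \<noteq> 0}}"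
proof -
  \<comment> \<open>\<open>insert 0\<close> provides \<open>Max\<close> with a nonempty set when
    \<open>g\<close> vanishes, and \<open>Suc\<close> keeps the last index of the support inside the
    list.\<close>
  define N where "N g = Suc (Max (insert 0 (to_nat ` {x. g x \<noteq> 0})))" for g :: "'c \<Rightarrow> 'k"
  \<comment> \<open>\<open>to_nat\<close> need not be onto, so numbers outside its range receive the
    filler 0.\<close>
  define f where "f g = map (\<lambda>n. if n \<in> range (to_nat :: 'c \<Rightarrow> nat) then g (from_nat n) else 0) [0..<N g]" for g :: "'c \<Rightarrow> 'k"
  have f: "g x = (if to_nat x < length (f g) then f g ! to_nat x else 0)" if "finite {x. g x \<noteq> 0}" for g x
  proof (cases "to_nat x < N g")
    case True
    then show ?thesis by (simp add: f_def)
  next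
    case False
    have "g x = 0"
    proof (rule ccontr)
      assume "g x \<noteq> 0"
      then have "to_nat x \<le> Max (insert 0 (to_nat ` {x. g x \<noteq> 0}))"
        using that by (intro Max_ge) auto
      then show False using False by (simp add: N_def)
    qed
    then show ?thesis using False by (simp add: f_def)
  qed
  have "inj_on f {g. finite {x. g x \<noteq> 0}}"
  proof (intro inj_onI ext)
    fix g h x assume "g \<in> {g. finite {x. g x \<noteq> 0}}" "h \<in> {g. finite {x. g x \<noteq> 0}}" "f g = f h"
    then show "g x = h x" using f[of g x] f[of h x] by simp
  qed
  then show ?thesis by blast
qed

text \<open>An index is a degree together with a coordinate. Over a finite poset there are countably
  many of these, so coefficient functions of finite support embed into lists, and lists embed into
  \<open>'m\<close>.\<close>

lemma coeff_embedding_exists: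
  assumes "large_enough TYPE('k::field) TYPE('m)"
  shows "\<exists>enc :: ('p::{finite,order_bot}, 'k) coeffs \<Rightarrow> 'm. coeff_embedding enc"
proof -
  obtain j :: "'k list \<Rightarrow> 'm" where j: "inj j" using assms unfolding large_enough_def by blast
  obtain f :: "(('p \<Rightarrow> int) \<times> nat \<Rightarrow> 'k) \<Rightarrow> 'k list" where f: "inj_on f {g. finite {x. g x \<noteq> 0}}"
    using finite_support_embedding by blast
  have "inj_on (\<lambda>g. j (f (\<lambda>(u, i). g u i))) finite_coeffs"
  proof (rule inj_onI)
    fix g h :: "('p, 'k) coeffs"
    assume g: "g \<in> finite_coeffs" and h: "h \<in> finite_coeffs" and eq: "j (f (\<lambda>(u, i). g u i)) = j (f (\<lambda>(u, i). h u i))"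
    have "f (\<lambda>(u, i). g u i) = f (\<lambda>(u, i). h u i)" using eq j by (simp add: inj_eq)
    then have "(\<lambda>(u, i). g u i) = (\<lambda>(u, i). h u i)"
      by (rule inj_onD[OF f]) (use g h in \<open>simp_all add: finite_coeffs_def case_prod_unfold\<close>)
    then show "g = h" by (auto simp: fun_eq_iff)
  qed
  then show ?thesis unfolding coeff_embedding_def by blast
qed

lemma vec_embedding_exists:
  assumes "large_enough TYPE('k::field) TYPE('v)"
  shows "\<exists>e :: 'k vec \<Rightarrow> 'v. inj e"
proof -
  obtain j :: "'k list \<Rightarrow> 'v" where j: "inj j" using assms unfolding large_enough_def by blast
  have "inj (list_of_vec :: 'k vec \<Rightarrow> 'k list)" by (metis injI vec_list)
  then show ?thesis using inj_compose[OF j] by blast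
qed

theorem proposition4p5:
  assumes "quasi_CW_poset TYPE('p::{finite,order_bot}) TYPE('k::field)"
    and "large_enough TYPE('k) TYPE('m)"
    and "large_enough TYPE('k) TYPE('v)"
  shows "equivalent_categories
           (Sq :: (('p, 'k, 'm) gr_mod, 'm \<Rightarrow> 'm) cat)
           (opposite (Sh :: (('p, 'k, 'v) sheaf, 'p \<Rightarrow> 'v \<Rightarrow> 'v) cat))"
proof -
  obtain enc :: "('p, 'k) coeffs \<Rightarrow> 'm" where "coeff_embedding enc"
    using coeff_embedding_exists[OF assms(2)] by blast
  then interpret coeff_embedding enc .
  obtain e :: "'k vec \<Rightarrow> 'v" where e: "inj e"
    using vec_embedding_exists[OF assms(3)] by blast
  \<comment> \<open>\<open>Rep\<close> is the apex of the span. The contravariance is already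
    contained in the second leg, whose target is the opposite category.\<close>
  show ?thesis
    by (rule equivalent_categories_span[OF category_Rep category_Sq category_opposite[OF category_Sh]
      RM_functor RM_essentially_surjective dual_sheaf_functor[OF e] dual_sheaf_essentially_surjective[OF e]])
qed

end
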